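(* Let $G$ be a finite group and let $A$ be a $G$-graded algebra over $\mathbb C$. For every cocycle $\nu\in Z^2(G,\mathbb C^\times)$, there exist a finite cyclic group $C_m=\langle z\mid z^m=1\rangle$, a cocycle $\mu\in Z^2(G,C_m)$ and an $m$th root of unity $q\in\mathbb C^\times$ such that the twist $A_\nu$ of $A$ is isomorphic to the specialisation of $\widetilde A_\mu$ at $z=q$.
   Context: For an abelian group $\Gamma$, $Z^2(G,\Gamma)$ is the group of normalised $2$-cocycles: $\mu\colon G\times G\to\Gamma$ with $\mu(g,h)\mu(gh,k)=\mu(g,hk)\mu(h,k)$ and $\mu(1,g)=\mu(g,1)=1$. A $G$-graded algebra is $A=\bigoplus_{g\in G}A_g$ with $A_gA_h\subset A_{gh}$ and $1\in A_1$. For $\nu\in Z^2(G,\mathbb C^\times)$, the twist $A_\nu$ is the vector space $A$ with product $a\star b=\nu(g,h)ab$ for $a\in A_g$, $b\in A_h$. For $\mu\in Z^2(G,\Gamma)$, the cocycle extension $\widetilde A_\mu$ is the $\mathbb C\Gamma$-algebra $\mathbb C\Gamma\otimes_{\mathbb C}A$ with product twisted in the same way: $a\star b=\mu(g,h)ab$ for $a,b$ of degrees $g,h$, where $\mu(g,h)\in\Gamma\subset(\mathbb C\Gamma)^\times$. The specialisation at $z=q$ of a $\mathbb CC_m$-algebra $B$ (where $q^m=1$) is the $\mathbb C$-algebra $B/(z-q)B$. *)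

theory Defs
  imports
    Complex_Main
    "HOL-Algebra.Algebra"
    "HOL-Algebra.Algebraic_Closure_Type"
begin

text \<open>
  Throughout, groups, rings and modules are carrier-based records of the algebra library, and the
  operation of an abelian group is written multiplicatively. The cyclic group
  \<open>C\<^sub>m = \<langle>z | z\<^sup>m = 1\<rangle>\<close> is \<^term>\<open>integer_mod_group m\<close> with \<open>m > 0\<close>: residues \<open>0, ..., m - 1\<close> under addition
  modulo \<open>m\<close>. Its generator \<open>z\<close> is \<^term>\<open>1 mod int m\<close>, which also covers the trivial group \<open>m = 1\<close>.
\<close>

abbreviation complex_ring :: "complex ring" where
  "complex_ring \<equiv> ring_of_type_algebra"

section \<open>Associative algebras\<close>

text \<open>The library locale \<^locale>\<open>algebra\<close> demands a commutative multiplication; algebras here are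
  unital and associative, but not necessarily commutative.\<close>

locale assoc_algebra = module R A + ring A
  for R :: "('r, 'x) ring_scheme" (structure) and A :: "('r, 'a, 'y) module_scheme" (structure) +
  assumes smult_mult_left:
      "\<lbrakk>r \<in> carrier R; a \<in> carrier A; b \<in> carrier A\<rbrakk> \<Longrightarrow>
        (r \<odot>\<^bsub>A\<^esub> a) \<otimes>\<^bsub>A\<^esub> b = r \<odot>\<^bsub>A\<^esub> (a \<otimes>\<^bsub>A\<^esub> b)"
    and smult_mult_right:
      "\<lbrakk>r \<in> carrier R; a \<in> carrier A; b \<in> carrier A\<rbrakk> \<Longrightarrow>
        a \<otimes>\<^bsub>A\<^esub> (r \<odot>\<^bsub>A\<^esub> b) = r \<odot>\<^bsub>A\<^esub> (a \<otimes>\<^bsub>A\<^esub> b)"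

definition algebra_iso ::
  "('r, 'x) ring_scheme \<Rightarrow> ('r, 'a, 'y) module_scheme \<Rightarrow> ('r, 'b, 'z) module_scheme \<Rightarrow> ('a \<Rightarrow> 'b) set"
  where "algebra_iso R A B =
    {\<phi> \<in> ring_iso A B. \<forall>r \<in> carrier R. \<forall>a \<in> carrier A. \<phi> (r \<odot>\<^bsub>A\<^esub> a) = r \<odot>\<^bsub>B\<^esub> \<phi> a}"

definition algebra_isomorphic ::
  "('r, 'x) ring_scheme \<Rightarrow> ('r, 'a, 'y) module_scheme \<Rightarrow> ('r, 'b, 'z) module_scheme \<Rightarrow> bool"
  where "algebra_isomorphic R A B \<longleftrightarrow> algebra_iso R A B \<noteq> {}"

section \<open>Normalised 2-cocycles\<close>

definition normalised_cocycles ::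
  "('g, 'x) monoid_scheme \<Rightarrow> ('c, 'y) monoid_scheme \<Rightarrow> ('g \<Rightarrow> 'g \<Rightarrow> 'c) set"
  where "normalised_cocycles G \<Gamma> =
    {\<mu> \<in> carrier G \<rightarrow> carrier G \<rightarrow> carrier \<Gamma>.
       (\<forall>g \<in> carrier G. \<forall>h \<in> carrier G. \<forall>k \<in> carrier G.
          \<mu> g h \<otimes>\<^bsub>\<Gamma>\<^esub> \<mu> (g \<otimes>\<^bsub>G\<^esub> h) k = \<mu> g (h \<otimes>\<^bsub>G\<^esub> k) \<otimes>\<^bsub>\<Gamma>\<^esub> \<mu> h k) \<and>
       (\<forall>g \<in> carrier G. \<mu> \<one>\<^bsub>G\<^esub> g = \<one>\<^bsub>\<Gamma>\<^esub> \<and> \<mu> g \<one>\<^bsub>G\<^esub> = \<one>\<^bsub>\<Gamma>\<^esub>)}"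

section \<open>Graded algebras and their twists\<close>

definition supp :: "('a, 'x) ring_scheme \<Rightarrow> ('i \<Rightarrow> 'a) \<Rightarrow> 'i set"
  where "supp A f = {i. f i \<noteq> \<zero>\<^bsub>A\<^esub>}"

text \<open>\<open>c\<close> is a family of homogeneous components of \<open>a\<close>; it is zero off \<^term>\<open>carrier G\<close>, so that
  uniqueness can be expressed as equality of functions.\<close>

definition is_decomposition ::
  "('g, 'x) monoid_scheme \<Rightarrow> ('a, 'y) ring_scheme \<Rightarrow> ('g \<Rightarrow> 'a set) \<Rightarrow> 'a \<Rightarrow> ('g \<Rightarrow> 'a) \<Rightarrow> bool"
  where "is_decomposition G A \<A> a c \<longleftrightarrow>
    (\<forall>g \<in> carrier G. c g \<in> \<A> g) \<and> supp A c \<subseteq> carrier G \<and> finite (supp A c) \<and>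
    a = (\<Oplus>\<^bsub>A\<^esub> g \<in> supp A c. c g)"

locale graded_algebra = G: group G + assoc_algebra R A
  for G :: "('g, 'x) monoid_scheme" (structure) and R :: "('r, 'y) ring_scheme" (structure)
    and A :: "('r, 'a, 'z) module_scheme" (structure) and \<A> :: "'g \<Rightarrow> 'a set" +
  assumes component_submodule: "g \<in> carrier G \<Longrightarrow> submodule (\<A> g) R A"
    and direct_sum: "a \<in> carrier A \<Longrightarrow> \<exists>!c. is_decomposition G A \<A> a c"
    and mult_components:
      "\<lbrakk>g \<in> carrier G; h \<in> carrier G; a \<in> \<A> g; b \<in> \<A> h\<rbrakk> \<Longrightarrow> a \<otimes>\<^bsub>A\<^esub> b \<in> \<A> (g \<otimes>\<^bsub>G\<^esub> h)"
    and one_component: "\<one>\<^bsub>A\<^esub> \<in> \<A> \<one>\<^bsub>G\<^esub>"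

definition component ::
  "('g, 'x) monoid_scheme \<Rightarrow> ('a, 'y) ring_scheme \<Rightarrow> ('g \<Rightarrow> 'a set) \<Rightarrow> 'a \<Rightarrow> 'g \<Rightarrow> 'a"
  where "component G A \<A> a = (THE c. is_decomposition G A \<A> a c)"

text \<open>The bilinear extension of \<open>a \<star> b = \<sigma>(g, h) a b\<close> for \<open>a\<close>, \<open>b\<close> homogeneous of degrees
  \<open>g\<close>, \<open>h\<close>; the values of \<open>\<sigma>\<close> are (invertible) elements of the base ring of \<open>A\<close>.\<close>

definition twist ::
  "('g, 'x) monoid_scheme \<Rightarrow> ('r, 'a, 'y) module_scheme \<Rightarrow> ('g \<Rightarrow> 'a set) \<Rightarrow> ('g \<Rightarrow> 'g \<Rightarrow> 'r)
    \<Rightarrow> ('r, 'a, 'y) module_scheme"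
  where "twist G A \<A> \<sigma> = A\<lparr>monoid.mult := (\<lambda>a b.
    \<Oplus>\<^bsub>A\<^esub> g \<in> supp A (component G A \<A> a). \<Oplus>\<^bsub>A\<^esub> h \<in> supp A (component G A \<A> b).
      \<sigma> g h \<odot>\<^bsub>A\<^esub> (component G A \<A> a g \<otimes>\<^bsub>A\<^esub> component G A \<A> b h))\<rparr>"

section \<open>Group algebras and extension of scalars\<close>

definition finsupp :: "('c, 'x) monoid_scheme \<Rightarrow> ('a, 'y) ring_scheme \<Rightarrow> ('c \<Rightarrow> 'a) set"
  where "finsupp \<Gamma> A = {f. (\<forall>\<gamma>. f \<gamma> \<in> carrier A) \<and> supp A f \<subseteq> carrier \<Gamma> \<and> finite (supp A f)}"

definition single :: "('a, 'x) ring_scheme \<Rightarrow> 'c \<Rightarrow> 'a \<Rightarrow> 'c \<Rightarrow> 'a"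
  where "single A \<gamma> a = (\<lambda>\<delta>. if \<delta> = \<gamma> then a else \<zero>\<^bsub>A\<^esub>)"

text \<open>\<open>(\<Sum>\<alpha>. x\<^sub>\<alpha> \<alpha>) (\<Sum>\<beta>. y\<^sub>\<beta> \<beta>) = \<Sum>\<alpha> \<beta>. (x\<^sub>\<alpha> \<cdot> y\<^sub>\<beta>) \<alpha>\<beta>\<close>, where the coefficients \<open>x\<^sub>\<alpha>\<close>, \<open>y\<^sub>\<beta>\<close> and
  \<open>x\<^sub>\<alpha> \<cdot> y\<^sub>\<beta>\<close> may come from three different structures.\<close>

definition convolution ::
  "('c, 'x) monoid_scheme \<Rightarrow> ('a, 'u) ring_scheme \<Rightarrow> ('b, 'v) ring_scheme \<Rightarrow> ('d, 'w) ring_scheme \<Rightarrow>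
    ('a \<Rightarrow> 'b \<Rightarrow> 'd) \<Rightarrow> ('c \<Rightarrow> 'a) \<Rightarrow> ('c \<Rightarrow> 'b) \<Rightarrow> 'c \<Rightarrow> 'd"
  where "convolution \<Gamma> A B D op x y = (\<lambda>\<gamma>.
    \<Oplus>\<^bsub>D\<^esub> \<alpha> \<in> supp A x. \<Oplus>\<^bsub>D\<^esub> \<beta> \<in> {\<beta> \<in> supp B y. \<alpha> \<otimes>\<^bsub>\<Gamma>\<^esub> \<beta> = \<gamma>}. op (x \<alpha>) (y \<beta>))"

definition group_algebra ::
  "('k, 'x) ring_scheme \<Rightarrow> ('c, 'y) monoid_scheme \<Rightarrow> ('k, 'c \<Rightarrow> 'k) module"
  where "group_algebra K \<Gamma> =
    \<lparr>carrier = finsupp \<Gamma> K,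
     monoid.mult = convolution \<Gamma> K K K (\<otimes>\<^bsub>K\<^esub>),
     one = single K \<one>\<^bsub>\<Gamma>\<^esub> \<one>\<^bsub>K\<^esub>,
     ring.zero = (\<lambda>_. \<zero>\<^bsub>K\<^esub>),
     add = (\<lambda>x y \<gamma>. x \<gamma> \<oplus>\<^bsub>K\<^esub> y \<gamma>),
     module.smult = (\<lambda>c x \<gamma>. c \<otimes>\<^bsub>K\<^esub> x \<gamma>)\<rparr>"

abbreviation group_elem :: "('k, 'x) ring_scheme \<Rightarrow> 'c \<Rightarrow> 'c \<Rightarrow> 'k"
  where "group_elem K \<gamma> \<equiv> single K \<gamma> \<one>\<^bsub>K\<^esub>"

text \<open>The \<open>K\<Gamma>\<close>-algebra \<open>K\<Gamma> \<otimes>\<^sub>K A\<close>. Since \<open>\<Gamma>\<close> is a basis of \<open>K\<Gamma>\<close>, an element of the tensor product is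
  uniquely a finite sum \<open>\<Sum>\<gamma>. \<gamma> \<otimes> f(\<gamma>)\<close> with coefficients in \<open>A\<close>, and it is represented by the function
  \<open>f\<close>. Under this identification the product \<open>(x \<otimes> a) (y \<otimes> b) = xy \<otimes> ab\<close> and the action of \<open>K\<Gamma>\<close> on
  the left factor both become convolutions. That \<open>tensor\<close> is indeed the universal bilinear map
  is shown in \<open>tensor_universal\<close> below.\<close>

definition scalar_extension ::
  "('k, 'x) ring_scheme \<Rightarrow> ('c, 'y) monoid_scheme \<Rightarrow> ('k, 'a, 'z) module_scheme
    \<Rightarrow> ('c \<Rightarrow> 'k, 'c \<Rightarrow> 'a) module"
  where "scalar_extension K \<Gamma> A =
    \<lparr>carrier = finsupp \<Gamma> A,
     monoid.mult = convolution \<Gamma> A A A (\<otimes>\<^bsub>A\<^esub>),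
     one = single A \<one>\<^bsub>\<Gamma>\<^esub> \<one>\<^bsub>A\<^esub>,
     ring.zero = (\<lambda>_. \<zero>\<^bsub>A\<^esub>),
     add = (\<lambda>x y \<gamma>. x \<gamma> \<oplus>\<^bsub>A\<^esub> y \<gamma>),
     module.smult = convolution \<Gamma> K A A (\<odot>\<^bsub>A\<^esub>)\<rparr>"

definition tensor :: "('k, 'a, 'x) module_scheme \<Rightarrow> ('c \<Rightarrow> 'k) \<Rightarrow> 'a \<Rightarrow> 'c \<Rightarrow> 'a"
  where "tensor A x a = (\<lambda>\<gamma>. x \<gamma> \<odot>\<^bsub>A\<^esub> a)"

text \<open>The grading of \<open>K\<Gamma> \<otimes>\<^sub>K A\<close> by the subspaces \<open>K\<Gamma> \<otimes>\<^sub>K A\<^sub>g\<close>.\<close>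

definition extended_grading ::
  "('c, 'x) monoid_scheme \<Rightarrow> ('a, 'y) ring_scheme \<Rightarrow> ('g \<Rightarrow> 'a set) \<Rightarrow> 'g \<Rightarrow> ('c \<Rightarrow> 'a) set"
  where "extended_grading \<Gamma> A \<A> g = {f \<in> finsupp \<Gamma> A. \<forall>\<gamma>. f \<gamma> \<in> \<A> g}"

section \<open>Cocycle extensions and specialisations\<close>

definition cocycle_extension ::
  "('g, 'u) monoid_scheme \<Rightarrow> ('k, 'x) ring_scheme \<Rightarrow> ('c, 'y) monoid_scheme \<Rightarrow>
    ('k, 'a, 'z) module_scheme \<Rightarrow> ('g \<Rightarrow> 'a set) \<Rightarrow> ('g \<Rightarrow> 'g \<Rightarrow> 'c) \<Rightarrow> ('c \<Rightarrow> 'k, 'c \<Rightarrow> 'a) module"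
  where "cocycle_extension G K \<Gamma> A \<A> \<mu> =
    twist G (scalar_extension K \<Gamma> A) (extended_grading \<Gamma> A \<A>) (\<lambda>g h. group_elem K (\<mu> g h))"

text \<open>For a \<open>K\<Gamma>\<close>-algebra \<open>B\<close>, \<open>z \<in> \<Gamma>\<close> and \<open>q \<in> K\<close>: the \<open>K\<close>-algebra \<open>B / (z - q)B\<close>, where \<open>K\<close> acts on
  \<open>B\<close> through \<open>K \<rightarrow> K\<Gamma>\<close>, \<open>c \<mapsto> c \<cdot> 1\<close>.\<close>

definition specialisation_ideal ::
  "('k, 'x) ring_scheme \<Rightarrow> ('c, 'y) monoid_scheme \<Rightarrow> ('c \<Rightarrow> 'k, 'b, 'z) module_scheme \<Rightarrow>
    'c \<Rightarrow> 'k \<Rightarrow> 'b set"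
  where "specialisation_ideal K \<Gamma> B z q =
    (\<lambda>b. (group_elem K z \<ominus>\<^bsub>group_algebra K \<Gamma>\<^esub> q \<odot>\<^bsub>group_algebra K \<Gamma>\<^esub> \<one>\<^bsub>group_algebra K \<Gamma>\<^esub>) \<odot>\<^bsub>B\<^esub> b)
      ` carrier B"

definition specialisation ::
  "('k, 'x) ring_scheme \<Rightarrow> ('c, 'y) monoid_scheme \<Rightarrow> ('c \<Rightarrow> 'k, 'b, 'z) module_scheme \<Rightarrow>
    'c \<Rightarrow> 'k \<Rightarrow> ('k, 'b set) module"
  where "specialisation K \<Gamma> B z q =
    (let I = specialisation_ideal K \<Gamma> B z q; Q = B Quot I
     in \<lparr>carrier = carrier Q, monoid.mult = monoid.mult Q, one = one Q, ring.zero = ring.zero Q, add = add Q,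
         module.smult = (\<lambda>c Y. \<Union>b \<in> Y.
           I +>\<^bsub>B\<^esub> ((c \<odot>\<^bsub>group_algebra K \<Gamma>\<^esub> \<one>\<^bsub>group_algebra K \<Gamma>\<^esub>) \<odot>\<^bsub>B\<^esub> b))\<rparr>)"

section \<open>The constructions on homogeneous elements and pure tensors\<close>

context abelian_monoid begin

lemma finsum_superset:
  assumes "finite T" "S \<subseteq> T" "f \<in> T \<rightarrow> carrier G" "\<And>i. i \<in> T - S \<Longrightarrow> f i = \<zero>"
  shows "finsum G f S = finsum G f T"
  using assms by (intro add.finprod_mono_neutral_cong_left) auto

lemma component_homogeneous:
  fixes \<A> :: "'g \<Rightarrow> 'a set"
  assumes uniq: "\<exists>!c. is_decomposition H G \<A> a c"
    and "g \<in> carrier H" "a \<in> \<A> g" "a \<in> carrier G" "\<And>h. h \<in> carrier H \<Longrightarrow> \<zero> \<in> \<A> h"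
  shows "component H G \<A> a = single G g a"
proof -
  have *: "supp G (single G g a) = (if a = \<zero> then {} else {g})"
    by (auto simp: supp_def single_def)
  have "is_decomposition H G \<A> a (single G g a)"
    unfolding is_decomposition_def * using assms by (auto simp: single_def)
  with uniq show ?thesis unfolding component_def by (intro the1_equality)
qed

end

lemma (in graded_algebra) twist_homogeneous:
  assumes "g \<in> carrier G" "h \<in> carrier G" "a \<in> \<A> g" "b \<in> \<A> h" "\<tau> g h \<in> carrier R"
  shows "a \<otimes>\<^bsub>twist G A \<A> \<tau>\<^esub> b = \<tau> g h \<odot>\<^bsub>A\<^esub> (a \<otimes>\<^bsub>A\<^esub> b)"
proof -
  have sub: "\<A> k \<subseteq> carrier A" "\<zero>\<^bsub>A\<^esub> \<in> \<A> k" if "k \<in> carrier G" for k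
    using submoduleE(1)[OF component_submodule[OF that]]
      subgroup.one_closed[OF submodule.axioms(1)[OF component_submodule[OF that]]] by auto
  have ab: "a \<in> carrier A" "b \<in> carrier A" using sub assms by auto
  have c: "component G A \<A> a = single A g a" "component G A \<A> b = single A h b"
    by (rule M.component_homogeneous[OF direct_sum]; use assms ab sub in blast)+
  have s: "supp A (single A k x) = (if x = \<zero>\<^bsub>A\<^esub> then {} else {k})" for k :: 'g and x
    by (auto simp: supp_def single_def)
  show ?thesis
    using ab assms(5) by (simp add: twist_def c s) (simp add: single_def)
qed


lemma single_finsupp [simp]:
  assumes "ring A" "\<gamma> \<in> carrier \<Gamma>" "a \<in> carrier A"
  shows "single A \<gamma> a \<in> finsupp \<Gamma> A"
proof -
  interpret ring A by fact
  show ?thesis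
    using assms by (auto simp: finsupp_def single_def supp_def intro: finite_subset[of _ "{\<gamma>}"])
qed

lemma (in abelian_monoid) convolution_superset:
  assumes "finite S" "finite T" "supp A x \<subseteq> S" "supp B y \<subseteq> T"
    and "\<And>\<alpha> \<beta>. op (x \<alpha>) (y \<beta>) \<in> carrier G"
    and "\<And>\<alpha> \<beta>. x \<alpha> = \<zero>\<^bsub>A\<^esub> \<or> y \<beta> = \<zero>\<^bsub>B\<^esub> \<Longrightarrow> op (x \<alpha>) (y \<beta>) = \<zero>"
  shows "convolution \<Gamma> A B G op x y \<gamma> =
    (\<Oplus>\<alpha>\<in>S. \<Oplus>\<beta>\<in>{\<beta> \<in> T. \<alpha> \<otimes>\<^bsub>\<Gamma>\<^esub> \<beta> = \<gamma>}. op (x \<alpha>) (y \<beta>))"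
proof -
  have "(\<Oplus>\<beta>\<in>{\<beta> \<in> supp B y. \<alpha> \<otimes>\<^bsub>\<Gamma>\<^esub> \<beta> = \<gamma>}. op (x \<alpha>) (y \<beta>)) =
      (\<Oplus>\<beta>\<in>{\<beta> \<in> T. \<alpha> \<otimes>\<^bsub>\<Gamma>\<^esub> \<beta> = \<gamma>}. op (x \<alpha>) (y \<beta>))" for \<alpha>
  proof (rule finsum_superset)
    show "op (x \<alpha>) (y \<beta>) = \<zero>"
      if "\<beta> \<in> {\<beta> \<in> T. \<alpha> \<otimes>\<^bsub>\<Gamma>\<^esub> \<beta> = \<gamma>} - {\<beta> \<in> supp B y. \<alpha> \<otimes>\<^bsub>\<Gamma>\<^esub> \<beta> = \<gamma>}" for \<beta>
      using that by (intro assms(6)) (auto simp: supp_def)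
  qed (use assms in auto)
  then have "convolution \<Gamma> A B G op x y \<gamma> =
      (\<Oplus>\<alpha>\<in>supp A x. \<Oplus>\<beta>\<in>{\<beta> \<in> T. \<alpha> \<otimes>\<^bsub>\<Gamma>\<^esub> \<beta> = \<gamma>}. op (x \<alpha>) (y \<beta>))"
    by (simp add: convolution_def)
  also have "\<dots> = (\<Oplus>\<alpha>\<in>S. \<Oplus>\<beta>\<in>{\<beta> \<in> T. \<alpha> \<otimes>\<^bsub>\<Gamma>\<^esub> \<beta> = \<gamma>}. op (x \<alpha>) (y \<beta>))"
  proof (rule finsum_superset)
    show "(\<Oplus>\<beta>\<in>{\<beta> \<in> T. \<alpha> \<otimes>\<^bsub>\<Gamma>\<^esub> \<beta> = \<gamma>}. op (x \<alpha>) (y \<beta>)) = \<zero>" if "\<alpha> \<in> S - supp A x" for \<alpha>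
      using that by (intro add.finprod_one_eqI assms(6)) (auto simp: supp_def)
  qed (use assms in \<open>auto intro!: finsum_closed\<close>)
  finally show ?thesis .
qed

context assoc_algebra begin

lemma tensor_finsupp: "x \<in> finsupp \<Gamma> R \<Longrightarrow> a \<in> carrier A \<Longrightarrow> tensor A x a \<in> finsupp \<Gamma> A"
  by (auto simp: finsupp_def tensor_def supp_def elim!: rev_finite_subset)

lemma finsum_smult_rdistr:
  assumes "finite S" "f \<in> S \<rightarrow> carrier R" "a \<in> carrier A"
  shows "(\<Oplus>\<^bsub>R\<^esub> i\<in>S. f i) \<odot>\<^bsub>A\<^esub> a = (\<Oplus>\<^bsub>A\<^esub> i\<in>S. f i \<odot>\<^bsub>A\<^esub> a)"
  using assms(1,2)
proof (induction S rule: finite_induct)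
  case (insert i S)
  then show ?case using assms(3) by (simp add: Pi_def smult_l_distr)
qed (use assms(3) in auto)

lemma tensor_mult:
  assumes x: "x \<in> finsupp \<Gamma> R" and y: "y \<in> finsupp \<Gamma> R" and ab: "a \<in> carrier A" "b \<in> carrier A"
  shows "tensor A x a \<otimes>\<^bsub>scalar_extension R \<Gamma> A\<^esub> tensor A y b =
    tensor A (x \<otimes>\<^bsub>group_algebra R \<Gamma>\<^esub> y) (a \<otimes>\<^bsub>A\<^esub> b)"
proof
  fix \<gamma>
  have x': "\<And>\<alpha>. x \<alpha> \<in> carrier R" "finite (supp R x)" and y': "\<And>\<alpha>. y \<alpha> \<in> carrier R" "finite (supp R y)"
    using x y by (auto simp: finsupp_def)
  have "(tensor A x a \<otimes>\<^bsub>scalar_extension R \<Gamma> A\<^esub> tensor A y b) \<gamma> =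
     (\<Oplus>\<^bsub>A\<^esub> \<alpha>\<in>supp R x. \<Oplus>\<^bsub>A\<^esub> \<beta>\<in>{\<beta> \<in> supp R y. \<alpha> \<otimes>\<^bsub>\<Gamma>\<^esub> \<beta> = \<gamma>}. tensor A x a \<alpha> \<otimes>\<^bsub>A\<^esub> tensor A y b \<beta>)"
    unfolding scalar_extension_def monoid.simps
    using x' y' ab by (intro M.convolution_superset) (auto simp: supp_def tensor_def)
  also have "\<dots> = (\<Oplus>\<^bsub>A\<^esub> \<alpha>\<in>supp R x. \<Oplus>\<^bsub>A\<^esub> \<beta>\<in>{\<beta> \<in> supp R y. \<alpha> \<otimes>\<^bsub>\<Gamma>\<^esub> \<beta> = \<gamma>}.
      (x \<alpha> \<otimes> y \<beta>) \<odot>\<^bsub>A\<^esub> (a \<otimes>\<^bsub>A\<^esub> b))"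
    using x' y' ab
    by (intro M.finsum_cong' ballI)
      (auto simp: tensor_def smult_mult_left smult_mult_right
        smult_assoc1[symmetric] R.m_comm intro!: M.finsum_closed)
  also have "\<dots> = (\<Oplus>\<^bsub>A\<^esub> \<alpha>\<in>supp R x.
      (\<Oplus>\<beta>\<in>{\<beta> \<in> supp R y. \<alpha> \<otimes>\<^bsub>\<Gamma>\<^esub> \<beta> = \<gamma>}. x \<alpha> \<otimes> y \<beta>) \<odot>\<^bsub>A\<^esub> (a \<otimes>\<^bsub>A\<^esub> b))"
    using x' y' ab by (intro M.finsum_cong') (auto simp: finsum_smult_rdistr intro!: R.finsum_closed)
  also have "\<dots> = tensor A (x \<otimes>\<^bsub>group_algebra R \<Gamma>\<^esub> y) (a \<otimes>\<^bsub>A\<^esub> b) \<gamma>"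
    using x' y' ab
    by (auto simp: tensor_def group_algebra_def convolution_def finsum_smult_rdistr
        intro!: R.finsum_closed)
  finally show "(tensor A x a \<otimes>\<^bsub>scalar_extension R \<Gamma> A\<^esub> tensor A y b) \<gamma> =
    tensor A (x \<otimes>\<^bsub>group_algebra R \<Gamma>\<^esub> y) (a \<otimes>\<^bsub>A\<^esub> b) \<gamma>" .
qed

lemma smult_tensor:
  assumes x: "x \<in> finsupp \<Gamma> R" and y: "y \<in> finsupp \<Gamma> R" and ab: "a \<in> carrier A"
  shows "x \<odot>\<^bsub>scalar_extension R \<Gamma> A\<^esub> tensor A y a = tensor A (x \<otimes>\<^bsub>group_algebra R \<Gamma>\<^esub> y) a"
proof
  fix \<gamma>
  have x': "\<And>\<alpha>. x \<alpha> \<in> carrier R" "finite (supp R x)" and y': "\<And>\<alpha>. y \<alpha> \<in> carrier R" "finite (supp R y)"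
    using x y by (auto simp: finsupp_def)
  have "(x \<odot>\<^bsub>scalar_extension R \<Gamma> A\<^esub> tensor A y a) \<gamma> =
     (\<Oplus>\<^bsub>A\<^esub> \<alpha>\<in>supp R x. \<Oplus>\<^bsub>A\<^esub> \<beta>\<in>{\<beta> \<in> supp R y. \<alpha> \<otimes>\<^bsub>\<Gamma>\<^esub> \<beta> = \<gamma>}. x \<alpha> \<odot>\<^bsub>A\<^esub> tensor A y a \<beta>)"
    unfolding scalar_extension_def module.simps
    using x' y' ab by (intro M.convolution_superset) (auto simp: supp_def tensor_def)
  also have "\<dots> = (\<Oplus>\<^bsub>A\<^esub> \<alpha>\<in>supp R x. \<Oplus>\<^bsub>A\<^esub> \<beta>\<in>{\<beta> \<in> supp R y. \<alpha> \<otimes>\<^bsub>\<Gamma>\<^esub> \<beta> = \<gamma>}. (x \<alpha> \<otimes> y \<beta>) \<odot>\<^bsub>A\<^esub> a)"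
    using x' y' ab
    by (intro M.finsum_cong' ballI) (auto simp: tensor_def smult_assoc1 intro!: M.finsum_closed)
  also have "\<dots> = (\<Oplus>\<^bsub>A\<^esub> \<alpha>\<in>supp R x.
      (\<Oplus>\<beta>\<in>{\<beta> \<in> supp R y. \<alpha> \<otimes>\<^bsub>\<Gamma>\<^esub> \<beta> = \<gamma>}. x \<alpha> \<otimes> y \<beta>) \<odot>\<^bsub>A\<^esub> a)"
    using x' y' ab by (intro M.finsum_cong') (auto simp: finsum_smult_rdistr intro!: R.finsum_closed)
  also have "\<dots> = tensor A (x \<otimes>\<^bsub>group_algebra R \<Gamma>\<^esub> y) a \<gamma>"
    using x' y' ab
    by (auto simp: tensor_def group_algebra_def convolution_def finsum_smult_rdistr
        intro!: R.finsum_closed)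
  finally show "(x \<odot>\<^bsub>scalar_extension R \<Gamma> A\<^esub> tensor A y a) \<gamma> = tensor A (x \<otimes>\<^bsub>group_algebra R \<Gamma>\<^esub> y) a \<gamma>" .
qed

end


lemma (in assoc_algebra) scalar_extension_abelian_group: "abelian_group (scalar_extension R \<Gamma> A)"
proof (rule abelian_groupI)
  fix x y assume *: "x \<in> carrier (scalar_extension R \<Gamma> A)" "y \<in> carrier (scalar_extension R \<Gamma> A)"
  have "supp A (\<lambda>\<gamma>. x \<gamma> \<oplus>\<^bsub>A\<^esub> y \<gamma>) \<subseteq> supp A x \<union> supp A y"
    using * by (auto simp: supp_def scalar_extension_def finsupp_def)
  with * show "x \<oplus>\<^bsub>scalar_extension R \<Gamma> A\<^esub> y \<in> carrier (scalar_extension R \<Gamma> A)"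
    by (auto simp: scalar_extension_def finsupp_def intro: finite_subset)
next
  fix x assume *: "x \<in> carrier (scalar_extension R \<Gamma> A)"
  have "supp A (\<lambda>\<gamma>. \<ominus>\<^bsub>A\<^esub> x \<gamma>) \<subseteq> supp A x"
    by (auto simp: supp_def)
  with * have "(\<lambda>\<gamma>. \<ominus>\<^bsub>A\<^esub> x \<gamma>) \<in> carrier (scalar_extension R \<Gamma> A)"
    by (auto simp: scalar_extension_def finsupp_def intro: finite_subset)
  with * show "\<exists>y\<in>carrier (scalar_extension R \<Gamma> A).
      y \<oplus>\<^bsub>scalar_extension R \<Gamma> A\<^esub> x = \<zero>\<^bsub>scalar_extension R \<Gamma> A\<^esub>"
    by (intro bexI[of _ "\<lambda>\<gamma>. \<ominus>\<^bsub>A\<^esub> x \<gamma>"]) (auto simp: scalar_extension_def finsupp_def M.l_neg)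
qed (auto simp: scalar_extension_def finsupp_def supp_def M.a_ac)

lemma (in assoc_algebra) finsum_scalar_extension:
  assumes "finite S" "f \<in> S \<rightarrow> finsupp \<Gamma> A"
  shows "(\<Oplus>\<^bsub>scalar_extension R \<Gamma> A\<^esub> i\<in>S. f i) \<gamma> = (\<Oplus>\<^bsub>A\<^esub> i\<in>S. f i \<gamma>)"
proof -
  interpret E: abelian_group "scalar_extension R \<Gamma> A"
    by (rule scalar_extension_abelian_group)
  have E: "carrier (scalar_extension R \<Gamma> A) = finsupp \<Gamma> A"
    "\<And>x y. x \<oplus>\<^bsub>scalar_extension R \<Gamma> A\<^esub> y = (\<lambda>\<gamma>. x \<gamma> \<oplus>\<^bsub>A\<^esub> y \<gamma>)"
    "\<zero>\<^bsub>scalar_extension R \<Gamma> A\<^esub> = (\<lambda>_. \<zero>\<^bsub>A\<^esub>)"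
    by (auto simp: scalar_extension_def)
  show ?thesis using assms
  proof (induction S rule: finite_induct)
    case (insert i S)
    then have "(\<lambda>i. f i \<gamma>) \<in> insert i S \<rightarrow> carrier A" by (auto simp: finsupp_def)
    with insert show ?case by (simp add: E Pi_def)
  qed (simp add: E)
qed

lemma (in assoc_algebra) group_algebra_mult_closed:
  assumes "monoid \<Gamma>" and x: "x \<in> finsupp \<Gamma> R" and y: "y \<in> finsupp \<Gamma> R"
  shows "x \<otimes>\<^bsub>group_algebra R \<Gamma>\<^esub> y \<in> finsupp \<Gamma> R"
proof -
  interpret \<Gamma>: monoid \<Gamma> by fact
  let ?S = "(\<lambda>(\<alpha>, \<beta>). \<alpha> \<otimes>\<^bsub>\<Gamma>\<^esub> \<beta>) ` (supp R x \<times> supp R y)"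
  let ?xy = "convolution \<Gamma> R R R (\<otimes>\<^bsub>R\<^esub>) x y"
  have "?xy \<gamma> = \<zero>" if "\<gamma> \<notin> ?S" for \<gamma>
    unfolding convolution_def
  proof (rule R.add.finprod_one_eqI)
    fix \<alpha> assume "\<alpha> \<in> supp R x"
    with that have "{\<beta> \<in> supp R y. \<alpha> \<otimes>\<^bsub>\<Gamma>\<^esub> \<beta> = \<gamma>} = {}" by auto
    then show "(\<Oplus>\<beta>\<in>{\<beta> \<in> supp R y. \<alpha> \<otimes>\<^bsub>\<Gamma>\<^esub> \<beta> = \<gamma>}. x \<alpha> \<otimes> y \<beta>) = \<zero>"
      by (simp only: R.finsum_empty)
  qed
  then have "supp R ?xy \<subseteq> ?S" by (auto simp: supp_def)
  moreover have "finite ?S" "?S \<subseteq> carrier \<Gamma>" using x y by (auto simp: finsupp_def)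
  moreover have "?xy \<gamma> \<in> carrier R" for \<gamma>
    unfolding convolution_def using x y by (auto simp: finsupp_def intro!: R.finsum_closed)
  ultimately show ?thesis
    unfolding group_algebra_def finsupp_def by (simp, meson finite_subset order_trans)
qed

lemma finsupp_additive_eq:
  assumes "abelian_group A" and N: "abelian_group N" and f: "f \<in> finsupp \<Gamma> A"
    and closed: "F \<in> finsupp \<Gamma> A \<rightarrow> carrier N" "F' \<in> finsupp \<Gamma> A \<rightarrow> carrier N"
    and add: "\<And>x y. x \<in> finsupp \<Gamma> A \<Longrightarrow> y \<in> finsupp \<Gamma> A \<Longrightarrow>
        F (\<lambda>\<gamma>. x \<gamma> \<oplus>\<^bsub>A\<^esub> y \<gamma>) = F x \<oplus>\<^bsub>N\<^esub> F y"
      "\<And>x y. x \<in> finsupp \<Gamma> A \<Longrightarrow> y \<in> finsupp \<Gamma> A \<Longrightarrow>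
        F' (\<lambda>\<gamma>. x \<gamma> \<oplus>\<^bsub>A\<^esub> y \<gamma>) = F' x \<oplus>\<^bsub>N\<^esub> F' y"
    and eq: "\<And>\<gamma> a. \<gamma> \<in> carrier \<Gamma> \<Longrightarrow> a \<in> carrier A \<Longrightarrow> F (single A \<gamma> a) = F' (single A \<gamma> a)"
  shows "F f = F' f"
proof -
  interpret A: abelian_group A by fact
  interpret N: abelian_group N by fact
  have "F f = F' f" if "finite S" "supp A f \<subseteq> S" "f \<in> finsupp \<Gamma> A" for S f
    using that
  proof (induction S arbitrary: f rule: finite_induct)
    case empty
    have 0: "(\<lambda>_. \<zero>\<^bsub>A\<^esub>) \<in> finsupp \<Gamma> A" by (auto simp: finsupp_def supp_def)
    have "F (\<lambda>_. \<zero>\<^bsub>A\<^esub>) = \<zero>\<^bsub>N\<^esub>" "F' (\<lambda>_. \<zero>\<^bsub>A\<^esub>) = \<zero>\<^bsub>N\<^esub>"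
      using add[OF 0 0] closed 0 by (auto simp: N.add.l_cancel_one' Pi_iff)
    moreover have "f = (\<lambda>_. \<zero>\<^bsub>A\<^esub>)" using empty by (auto simp: supp_def)
    ultimately show ?case by simp
  next
    case (insert \<gamma> S)
    show ?case
    proof (cases "\<gamma> \<in> carrier \<Gamma>")
      case True
      define g where "g = f(\<gamma> := \<zero>\<^bsub>A\<^esub>)"
      have sg: "supp A g \<subseteq> supp A f" "supp A g \<subseteq> S"
        using insert.prems by (auto simp: g_def supp_def split: if_splits)
      have fc: "f \<delta> \<in> carrier A" for \<delta> using insert.prems by (auto simp: finsupp_def)
      have g: "g \<in> finsupp \<Gamma> A"
        using insert.prems sg unfolding finsupp_def by (auto simp: g_def intro: finite_subset)
      have s: "single A \<gamma> (f \<gamma>) \<in> finsupp \<Gamma> A"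
        using True fc by (auto simp: finsupp_def single_def supp_def intro: finite_subset[of _ "{\<gamma>}"])
      have f: "f = (\<lambda>\<delta>. single A \<gamma> (f \<gamma>) \<delta> \<oplus>\<^bsub>A\<^esub> g \<delta>)"
        using fc by (auto simp: single_def g_def)
      show ?thesis
        by (subst f, subst (2) f) (simp only: add[OF s g] eq[OF True fc] insert.IH[OF sg(2) g])
    next
      case False
      then have "supp A f \<subseteq> S" using insert.prems by (auto simp: finsupp_def)
      with insert show ?thesis by blast
    qed
  qed
  with f show ?thesis by (auto simp: finsupp_def)
qed

text \<open>Every \<open>K\<close>-bilinear map on \<open>K\<Gamma> \<times> A\<close> factors uniquely through \<^const>\<open>tensor\<close>.\<close>

lemma (in assoc_algebra) tensor_universal:
  fixes N :: "('r, 'n, 'm) module_scheme" and \<phi> :: "('c \<Rightarrow> 'r) \<Rightarrow> 'a \<Rightarrow> 'n"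
  assumes "module R N"
    and closed: "\<And>x a. x \<in> finsupp \<Gamma> R \<Longrightarrow> a \<in> carrier A \<Longrightarrow> \<phi> x a \<in> carrier N"
    and add_left: "\<And>x y a. x \<in> finsupp \<Gamma> R \<Longrightarrow> y \<in> finsupp \<Gamma> R \<Longrightarrow> a \<in> carrier A \<Longrightarrow>
      \<phi> (x \<oplus>\<^bsub>group_algebra R \<Gamma>\<^esub> y) a = \<phi> x a \<oplus>\<^bsub>N\<^esub> \<phi> y a"
    and add_right: "\<And>x a b. x \<in> finsupp \<Gamma> R \<Longrightarrow> a \<in> carrier A \<Longrightarrow> b \<in> carrier A \<Longrightarrow>
      \<phi> x (a \<oplus>\<^bsub>A\<^esub> b) = \<phi> x a \<oplus>\<^bsub>N\<^esub> \<phi> x b"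
    and smult_left: "\<And>r x a. r \<in> carrier R \<Longrightarrow> x \<in> finsupp \<Gamma> R \<Longrightarrow> a \<in> carrier A \<Longrightarrow>
      \<phi> (r \<odot>\<^bsub>group_algebra R \<Gamma>\<^esub> x) a = r \<odot>\<^bsub>N\<^esub> \<phi> x a"
    and smult_right: "\<And>r x a. r \<in> carrier R \<Longrightarrow> x \<in> finsupp \<Gamma> R \<Longrightarrow> a \<in> carrier A \<Longrightarrow>
      \<phi> x (r \<odot>\<^bsub>A\<^esub> a) = r \<odot>\<^bsub>N\<^esub> \<phi> x a"
  defines "linear_lift \<equiv> \<lambda>T. T \<in> finsupp \<Gamma> A \<rightarrow> carrier N \<and>
      (\<forall>f \<in> finsupp \<Gamma> A. \<forall>g \<in> finsupp \<Gamma> A. T (f \<oplus>\<^bsub>scalar_extension R \<Gamma> A\<^esub> g) = T f \<oplus>\<^bsub>N\<^esub> T g) \<and>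
      (\<forall>r \<in> carrier R. \<forall>f \<in> finsupp \<Gamma> A. T (\<lambda>\<gamma>. r \<odot>\<^bsub>A\<^esub> f \<gamma>) = r \<odot>\<^bsub>N\<^esub> T f) \<and>
      (\<forall>x \<in> finsupp \<Gamma> R. \<forall>a \<in> carrier A. T (tensor A x a) = \<phi> x a)"
  shows "\<exists>T. linear_lift T"
    and "linear_lift T \<Longrightarrow> linear_lift T' \<Longrightarrow> f \<in> finsupp \<Gamma> A \<Longrightarrow> T f = T' f"
proof -
  interpret N: module R N by fact
  have E: "x \<oplus>\<^bsub>scalar_extension R \<Gamma> A\<^esub> y = (\<lambda>\<gamma>. x \<gamma> \<oplus>\<^bsub>A\<^esub> y \<gamma>)" for x y
    by (simp add: scalar_extension_def)
  have K: "x \<oplus>\<^bsub>group_algebra R \<Gamma>\<^esub> y = (\<lambda>\<gamma>. x \<gamma> \<oplus> y \<gamma>)"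
    "r \<odot>\<^bsub>group_algebra R \<Gamma>\<^esub> x = (\<lambda>\<gamma>. r \<otimes> x \<gamma>)" for x y :: "'c \<Rightarrow> 'r" and r
    by (simp_all add: group_algebra_def)
  have e: "group_elem R \<gamma> \<in> finsupp \<Gamma> R" if "\<gamma> \<in> carrier \<Gamma>" for \<gamma>
    using that by (simp add: R.ring_axioms)
  have single_tensor: "single A \<gamma> a = tensor A (group_elem R \<gamma>) a" if "a \<in> carrier A" for \<gamma> a
    using that by (auto simp: single_def tensor_def)
  have fin: "(\<lambda>\<gamma>. f \<gamma> \<oplus>\<^bsub>A\<^esub> g \<gamma>) \<in> finsupp \<Gamma> A" if "f \<in> finsupp \<Gamma> A" "g \<in> finsupp \<Gamma> A" for f g
    using abelian_monoid.a_closed[OF abelian_group.axioms(1)[OF scalar_extension_abelian_group], of f \<Gamma> g] that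
    by (simp add: scalar_extension_def)
  show "T f = T' f" if "linear_lift T" "linear_lift T'" "f \<in> finsupp \<Gamma> A" for T T' f
  proof (rule finsupp_additive_eq[where A = A and N = N and \<Gamma> = \<Gamma>])
    show "T (single A \<gamma> a) = T' (single A \<gamma> a)" if "\<gamma> \<in> carrier \<Gamma>" "a \<in> carrier A" for \<gamma> a
      using \<open>linear_lift T\<close> \<open>linear_lift T'\<close> that e by (simp add: linear_lift_def single_tensor)
  qed (use that in \<open>auto simp: linear_lift_def E M.abelian_group_axioms N.M.abelian_group_axioms\<close>)
  define T where "T f = (\<Oplus>\<^bsub>N\<^esub> \<gamma>\<in>supp A f. \<phi> (group_elem R \<gamma>) (f \<gamma>))" for f
  have \<phi>0: "\<phi> (group_elem R \<gamma>) \<zero>\<^bsub>A\<^esub> = \<zero>\<^bsub>N\<^esub>" if "\<gamma> \<in> carrier \<Gamma>" for \<gamma>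
    using smult_right[OF R.zero_closed e[OF that] M.zero_closed] closed[OF e[OF that] M.zero_closed] by simp
  have T: "T f = (\<Oplus>\<^bsub>N\<^esub> \<gamma>\<in>S. \<phi> (group_elem R \<gamma>) (f \<gamma>))"
    if "finite S" "supp A f \<subseteq> S" "S \<subseteq> carrier \<Gamma>" "\<And>\<gamma>. f \<gamma> \<in> carrier A" for S f
    unfolding T_def
  proof (rule N.M.finsum_superset)
    show "(\<lambda>\<gamma>. \<phi> (group_elem R \<gamma>) (f \<gamma>)) \<in> S \<rightarrow> carrier N" using that closed e by blast
    show "\<phi> (group_elem R \<gamma>) (f \<gamma>) = \<zero>\<^bsub>N\<^esub>" if "\<gamma> \<in> S - supp A f" for \<gamma>
    proof -
      have "f \<gamma> = \<zero>\<^bsub>A\<^esub>" "\<gamma> \<in> carrier \<Gamma>" using that \<open>S \<subseteq> carrier \<Gamma>\<close> by (auto simp: supp_def)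
      then show ?thesis using \<phi>0 by simp
    qed
  qed (use that in auto)
  have T_closed: "T f \<in> carrier N" if "f \<in> finsupp \<Gamma> A" for f
    unfolding T_def using that closed e by (intro N.M.finsum_closed) (auto simp: finsupp_def)
  have T_add: "T (\<lambda>\<gamma>. f \<gamma> \<oplus>\<^bsub>A\<^esub> g \<gamma>) = T f \<oplus>\<^bsub>N\<^esub> T g"
    if f: "f \<in> finsupp \<Gamma> A" and g: "g \<in> finsupp \<Gamma> A" for f g
  proof -
    let ?S = "supp A f \<union> supp A g"
    have f': "\<And>\<gamma>. f \<gamma> \<in> carrier A" and g': "\<And>\<gamma>. g \<gamma> \<in> carrier A"
      and S: "finite ?S" "?S \<subseteq> carrier \<Gamma>"
      using f g by (auto simp: finsupp_def)
    have "T (\<lambda>\<gamma>. f \<gamma> \<oplus>\<^bsub>A\<^esub> g \<gamma>) = (\<Oplus>\<^bsub>N\<^esub> \<gamma>\<in>?S. \<phi> (group_elem R \<gamma>) (f \<gamma> \<oplus>\<^bsub>A\<^esub> g \<gamma>))"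
      using f' g' S by (intro T) (auto simp: supp_def)
    also have "\<dots> = (\<Oplus>\<^bsub>N\<^esub> \<gamma>\<in>?S. \<phi> (group_elem R \<gamma>) (f \<gamma>) \<oplus>\<^bsub>N\<^esub> \<phi> (group_elem R \<gamma>) (g \<gamma>))"
      using f' g' S e closed by (intro N.M.finsum_cong' add_right) (auto intro!: N.M.a_closed)
    also have "\<dots> = (\<Oplus>\<^bsub>N\<^esub> \<gamma>\<in>?S. \<phi> (group_elem R \<gamma>) (f \<gamma>)) \<oplus>\<^bsub>N\<^esub> (\<Oplus>\<^bsub>N\<^esub> \<gamma>\<in>?S. \<phi> (group_elem R \<gamma>) (g \<gamma>))"
      using f' g' S e closed by (intro N.M.finsum_addf) auto
    also have "\<dots> = T f \<oplus>\<^bsub>N\<^esub> T g" using f' g' S by (simp add: T[of ?S])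
    finally show ?thesis .
  qed
  have T_smult: "T (\<lambda>\<gamma>. r \<odot>\<^bsub>A\<^esub> f \<gamma>) = r \<odot>\<^bsub>N\<^esub> T f" if r: "r \<in> carrier R" and f: "f \<in> finsupp \<Gamma> A" for r f
  proof -
    have f': "\<And>\<gamma>. f \<gamma> \<in> carrier A" "finite (supp A f)" "supp A f \<subseteq> carrier \<Gamma>"
      using f by (auto simp: finsupp_def)
    have "T (\<lambda>\<gamma>. r \<odot>\<^bsub>A\<^esub> f \<gamma>) = (\<Oplus>\<^bsub>N\<^esub> \<gamma>\<in>supp A f. \<phi> (group_elem R \<gamma>) (r \<odot>\<^bsub>A\<^esub> f \<gamma>))"
      using f' r by (intro T) (auto simp: supp_def)
    also have "\<dots> = (\<Oplus>\<^bsub>N\<^esub> \<gamma>\<in>supp A f. r \<odot>\<^bsub>N\<^esub> \<phi> (group_elem R \<gamma>) (f \<gamma>))"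
      using f' r e closed by (intro N.M.finsum_cong' smult_right) auto
    also have "\<dots> = r \<odot>\<^bsub>N\<^esub> T f"
      unfolding T_def using f' r e closed by (intro N.finsum_smult_ldistr[symmetric]) auto
    finally show ?thesis .
  qed
  have T_single: "T (single A \<gamma> a) = \<phi> (group_elem R \<gamma>) a" if "\<gamma> \<in> carrier \<Gamma>" "a \<in> carrier A" for \<gamma> a
  proof -
    have "T (single A \<gamma> a) = (\<Oplus>\<^bsub>N\<^esub> \<delta>\<in>{\<gamma>}. \<phi> (group_elem R \<delta>) (single A \<gamma> a \<delta>))"
      using that by (intro T) (auto simp: single_def supp_def)
    then show ?thesis using that closed e by (simp add: single_def[of A])
  qed
  have "T (tensor A x a) = \<phi> x a" if x: "x \<in> finsupp \<Gamma> R" and a: "a \<in> carrier A" for x a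
  proof (rule finsupp_additive_eq[where A = R and N = N and \<Gamma> = \<Gamma>])
    fix x y assume xy: "x \<in> finsupp \<Gamma> R" "y \<in> finsupp \<Gamma> R"
    show "\<phi> (\<lambda>\<gamma>. x \<gamma> \<oplus> y \<gamma>) a = \<phi> x a \<oplus>\<^bsub>N\<^esub> \<phi> y a"
      using add_left[OF xy a] by (simp add: K)
    have "tensor A (\<lambda>\<gamma>. x \<gamma> \<oplus> y \<gamma>) a = (\<lambda>\<gamma>. tensor A x a \<gamma> \<oplus>\<^bsub>A\<^esub> tensor A y a \<gamma>)"
      using xy a by (auto simp: tensor_def finsupp_def smult_l_distr)
    then show "T (tensor A (\<lambda>\<gamma>. x \<gamma> \<oplus> y \<gamma>) a) = T (tensor A x a) \<oplus>\<^bsub>N\<^esub> T (tensor A y a)"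
      using T_add[OF tensor_finsupp tensor_finsupp] xy a by simp
  next
    fix \<gamma> r assume \<gamma>: "\<gamma> \<in> carrier \<Gamma>" and r: "r \<in> carrier R"
    have "tensor A (single R \<gamma> r) a = single A \<gamma> (r \<odot>\<^bsub>A\<^esub> a)"
      using a by (auto simp: tensor_def single_def)
    moreover have "single R \<gamma> r = r \<odot>\<^bsub>group_algebra R \<Gamma>\<^esub> group_elem R \<gamma>"
      using r by (auto simp: K single_def)
    ultimately show "T (tensor A (single R \<gamma> r) a) = \<phi> (single R \<gamma> r) a"
      using r a \<gamma> e by (simp add: T_single smult_left smult_right)
  qed (use x a T_closed tensor_finsupp closed in \<open>auto simp: R.abelian_group_axioms N.M.abelian_group_axioms\<close>)
  then show "\<exists>T. linear_lift T"
    unfolding linear_lift_def E using T_closed T_add T_smult by (intro exI[of _ T]) auto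
qed

context graded_algebra begin

lemma component_sub: "g \<in> carrier G \<Longrightarrow> \<A> g \<subseteq> carrier A"
  and component_zero: "g \<in> carrier G \<Longrightarrow> \<zero>\<^bsub>A\<^esub> \<in> \<A> g"
  using submoduleE(1)[OF component_submodule]
    subgroup.one_closed[OF submodule.axioms(1)[OF component_submodule]] by auto

lemma is_decomposition_component:
  "a \<in> carrier A \<Longrightarrow> is_decomposition G A \<A> a (component G A \<A> a)"
  unfolding component_def by (rule theI'[OF direct_sum])

lemma scalar_extension_direct_sum:
  assumes f: "f \<in> finsupp \<Gamma> A"
  shows "\<exists>!c. is_decomposition G (scalar_extension R \<Gamma> A) (extended_grading \<Gamma> A \<A>) f c"
proof -
  let ?E = "scalar_extension R \<Gamma> A"
  have Z: "\<zero>\<^bsub>?E\<^esub> = (\<lambda>_. \<zero>\<^bsub>A\<^esub>)" by (simp add: scalar_extension_def)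
  have f': "\<And>\<gamma>. f \<gamma> \<in> carrier A" "finite (supp A f)" "supp A f \<subseteq> carrier \<Gamma>"
    using f by (auto simp: finsupp_def)
  note D = is_decomposition_component[OF f'(1), unfolded is_decomposition_def]
  have c0: "component G A \<A> \<zero>\<^bsub>A\<^esub> = (\<lambda>_. \<zero>\<^bsub>A\<^esub>)"
  proof -
    have "component G A \<A> \<zero>\<^bsub>A\<^esub> = single A \<one> \<zero>\<^bsub>A\<^esub>"
      by (rule M.component_homogeneous[OF direct_sum]) (auto simp: component_zero)
    then show ?thesis by (auto simp: single_def)
  qed
  define c where "c = (\<lambda>g \<gamma>. component G A \<A> (f \<gamma>) g)"
  have supp_c: "supp ?E c = (\<Union>\<gamma>\<in>supp A f. supp A (component G A \<A> (f \<gamma>)))"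
    unfolding supp_def Z c_def using c0 by (auto simp: fun_eq_iff) metis
  have fin: "finite (supp ?E c)" and inG: "supp ?E c \<subseteq> carrier G"
    using D f' unfolding supp_c by auto
  have comp: "component G A \<A> (f \<gamma>) g \<in> \<A> g" if "g \<in> carrier G" for g \<gamma>
    using D that by auto
  have c: "c g \<in> extended_grading \<Gamma> A \<A> g" if "g \<in> carrier G" for g
  proof -
    have "supp A (c g) \<subseteq> supp A f"
      using c0 by (auto simp: supp_def c_def)
    then show ?thesis
      using comp[OF that] component_sub[OF that] f' unfolding extended_grading_def finsupp_def
      by (auto simp: c_def intro: finite_subset)
  qed
  show ?thesis
  proof (rule ex1I)
    have "f \<gamma> = (\<Oplus>\<^bsub>?E\<^esub> g\<in>supp ?E c. c g) \<gamma>" for \<gamma>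
    proof -
      have "f \<gamma> = (\<Oplus>\<^bsub>A\<^esub> g\<in>supp A (component G A \<A> (f \<gamma>)). component G A \<A> (f \<gamma>) g)"
        using D by blast
      also have "\<dots> = (\<Oplus>\<^bsub>A\<^esub> g\<in>supp ?E c. c g \<gamma>)"
        unfolding c_def
      proof (rule M.finsum_superset)
        show "supp A (component G A \<A> (f \<gamma>)) \<subseteq> supp ?E (\<lambda>g \<gamma>. component G A \<A> (f \<gamma>) g)"
          unfolding supp_def Z by (auto simp: fun_eq_iff)
        show "component G A \<A> (f \<gamma>) \<in> supp ?E (\<lambda>g \<gamma>. component G A \<A> (f \<gamma>) g) \<rightarrow> carrier A"
          using comp component_sub inG unfolding c_def by blast
      qed (use fin in \<open>auto simp: c_def supp_def\<close>)
      also have "\<dots> = (\<Oplus>\<^bsub>?E\<^esub> g\<in>supp ?E c. c g) \<gamma>"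
        using fin c inG by (intro finsum_scalar_extension[symmetric]) (auto simp: extended_grading_def)
      finally show ?thesis .
    qed
    then show "is_decomposition G ?E (extended_grading \<Gamma> A \<A>) f c"
      unfolding is_decomposition_def using c fin inG by auto
  next
    fix d assume d: "is_decomposition G ?E (extended_grading \<Gamma> A \<A>) f d"
    have d': "\<And>g \<gamma>. g \<in> carrier G \<Longrightarrow> d g \<gamma> \<in> \<A> g" "\<And>g. g \<in> carrier G \<Longrightarrow> d g \<in> finsupp \<Gamma> A"
      "finite (supp ?E d)" "supp ?E d \<subseteq> carrier G"
      using d by (auto simp: is_decomposition_def extended_grading_def)
    have "is_decomposition G A \<A> (f \<gamma>) (\<lambda>g. d g \<gamma>)" for \<gamma>
    proof -
      have sub: "supp A (\<lambda>g. d g \<gamma>) \<subseteq> supp ?E d" unfolding supp_def Z by auto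
      have "f \<gamma> = (\<Oplus>\<^bsub>?E\<^esub> g\<in>supp ?E d. d g) \<gamma>" using d by (simp add: is_decomposition_def)
      also have "\<dots> = (\<Oplus>\<^bsub>A\<^esub> g\<in>supp ?E d. d g \<gamma>)"
        using d' by (intro finsum_scalar_extension) auto
      also have "\<dots> = (\<Oplus>\<^bsub>A\<^esub> g\<in>supp A (\<lambda>g. d g \<gamma>). d g \<gamma>)"
      proof (rule M.finsum_superset[symmetric])
        show "(\<lambda>g. d g \<gamma>) \<in> supp ?E d \<rightarrow> carrier A" using d' component_sub by blast
      qed (use sub d' in \<open>auto simp: supp_def\<close>)
      finally show ?thesis
        using d' sub unfolding is_decomposition_def by (auto intro: finite_subset)
    qed
    then have "(\<lambda>g. d g \<gamma>) = component G A \<A> (f \<gamma>)" for \<gamma>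
      using direct_sum[OF f'(1)] is_decomposition_component[OF f'(1)] by blast
    then show "d = c" unfolding c_def by (auto simp: fun_eq_iff)
  qed
qed

text \<open>\<open>(x \<otimes> a) \<star> (y \<otimes> b) = \<mu>(g, h) xy \<otimes> ab\<close> for \<open>a\<close>, \<open>b\<close> homogeneous of degrees \<open>g\<close>, \<open>h\<close>.\<close>

lemma cocycle_extension_homogeneous:
  assumes gh: "g \<in> carrier G" "h \<in> carrier G" and x: "x \<in> finsupp \<Gamma> R" and y: "y \<in> finsupp \<Gamma> R"
    and a: "a \<in> \<A> g" and b: "b \<in> \<A> h" and \<mu>: "\<mu> g h \<in> carrier \<Gamma>" and "group \<Gamma>"
  shows "tensor A x a \<otimes>\<^bsub>cocycle_extension G R \<Gamma> A \<A> \<mu>\<^esub> tensor A y b =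
    tensor A (group_elem R (\<mu> g h) \<otimes>\<^bsub>group_algebra R \<Gamma>\<^esub> (x \<otimes>\<^bsub>group_algebra R \<Gamma>\<^esub> y)) (a \<otimes>\<^bsub>A\<^esub> b)"
proof -
  interpret \<Gamma>: group \<Gamma> by fact
  let ?E = "scalar_extension R \<Gamma> A" and ?B = "extended_grading \<Gamma> A \<A>"
  interpret E: abelian_group ?E by (rule scalar_extension_abelian_group)
  have ab: "a \<in> carrier A" "b \<in> carrier A" using a b gh component_sub by auto
  have fin: "tensor A x a \<in> finsupp \<Gamma> A" "tensor A y b \<in> finsupp \<Gamma> A"
    using tensor_finsupp x y ab by auto
  have E: "carrier ?E = finsupp \<Gamma> A" "\<zero>\<^bsub>?E\<^esub> = (\<lambda>_. \<zero>\<^bsub>A\<^esub>)" by (auto simp: scalar_extension_def)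
  have hom: "tensor A z c \<in> ?B k" if "z \<in> finsupp \<Gamma> R" "c \<in> \<A> k" "k \<in> carrier G" for z c k
  proof -
    have "c \<in> carrier A" using that component_sub by blast
    with that show ?thesis
      using tensor_finsupp[of z \<Gamma> c] submodule.smult_closed[OF component_submodule[OF that(3)]]
      unfolding extended_grading_def by (auto simp: tensor_def finsupp_def)
  qed
  have z: "\<zero>\<^bsub>?E\<^esub> \<in> ?B k" if "k \<in> carrier G" for k
    using component_zero[OF that] by (auto simp: E extended_grading_def finsupp_def supp_def)
  have c: "component G ?E ?B (tensor A x a) = single ?E g (tensor A x a)"
    "component G ?E ?B (tensor A y b) = single ?E h (tensor A y b)"
    by (rule E.component_homogeneous[OF scalar_extension_direct_sum]; use fin E gh hom x y a b z in blast)+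
  have s: "supp ?E (single ?E k u) = (if u = \<zero>\<^bsub>?E\<^esub> then {} else {k})" for k :: 'g and u
    by (auto simp: supp_def single_def)
  have prod: "tensor A x a \<otimes>\<^bsub>?E\<^esub> tensor A y b = tensor A (x \<otimes>\<^bsub>group_algebra R \<Gamma>\<^esub> y) (a \<otimes>\<^bsub>A\<^esub> b)"
    using tensor_mult x y ab by blast
  let ?s = "group_elem R (\<mu> g h)" and ?P = "tensor A x a \<otimes>\<^bsub>?E\<^esub> tensor A y b"
  have [simp]: "supp A (\<lambda>_. \<zero>\<^bsub>A\<^esub>) = {}" by (simp add: supp_def)
  have zero: "?s \<odot>\<^bsub>?E\<^esub> ?P = \<zero>\<^bsub>?E\<^esub>" if "tensor A x a = \<zero>\<^bsub>?E\<^esub> \<or> tensor A y b = \<zero>\<^bsub>?E\<^esub>"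
  proof -
    have "?P = \<zero>\<^bsub>?E\<^esub>"
      using that by (auto simp: scalar_extension_def convolution_def)
    then show ?thesis by (simp add: scalar_extension_def convolution_def)
  qed
  have sP: "?s \<odot>\<^bsub>?E\<^esub> ?P =
      tensor A (?s \<otimes>\<^bsub>group_algebra R \<Gamma>\<^esub> (x \<otimes>\<^bsub>group_algebra R \<Gamma>\<^esub> y)) (a \<otimes>\<^bsub>A\<^esub> b)"
    unfolding prod using x y ab \<mu>
    by (intro smult_tensor group_algebra_mult_closed) (auto simp: \<Gamma>.is_monoid R.ring_axioms)
  have closed: "?s \<odot>\<^bsub>?E\<^esub> ?P \<in> carrier ?E"
    unfolding sP E using x y ab \<mu>
    by (intro tensor_finsupp group_algebra_mult_closed) (auto simp: \<Gamma>.is_monoid R.ring_axioms)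
  have "tensor A x a \<otimes>\<^bsub>cocycle_extension G R \<Gamma> A \<A> \<mu>\<^esub> tensor A y b = ?s \<odot>\<^bsub>?E\<^esub> ?P"
    using zero closed by (simp add: cocycle_extension_def twist_def c s) (auto simp: single_def)
  then show ?thesis by (simp only: sP)
qed

end

end

theory Submission
  imports Defs
begin

text \<open>A class in \<open>H\<^sup>2(G, \<complex>\<^sup>\<times>)\<close> has order dividing \<open>n = |G|\<close>, and since \<open>\<complex>\<^sup>\<times>\<close> is divisible the class can
  be represented by a cocycle with values in the group of \<open>n\<close>th roots of unity. Concretely, with
  \<open>P(g) = \<Prod>\<^sub>k \<nu>(g, k)\<close> the cocycle identity multiplied over \<open>k\<close> reads \<open>\<nu>(g, h)\<^sup>n P(gh) = P(g) P(h)\<close>, so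
  after a choice of \<open>n\<close>th roots \<open>c(g)\<^sup>n = P(g)\<close> the cocycle \<open>\<tau>(g, h) = \<nu>(g, h) c(gh) / (c(g) c(h))\<close>
  satisfies \<open>\<tau>\<^sup>n = 1\<close> (\<open>cocycle_cohomologous_roots_of_unity\<close>). Hence \<open>\<tau> = q\<^bsup>\<mu>\<^esup>\<close> for a primitive
  \<open>n\<close>th root of unity \<open>q\<close> and a cocycle \<open>\<mu>\<close> with values in the cyclic group of order \<open>n\<close>
  (\<open>discrete_logarithm_cocycle\<close>), and multiplication by \<open>c(g)\<close> in degree \<open>g\<close> is an isomorphism from
  the twist by \<open>\<nu>\<close> to the twist by \<open>\<tau>\<close> (\<open>twist_cohomologous\<close>).

  It remains to identify the twist by \<open>q\<^bsup>\<mu>\<^esup>\<close> with the specialisation of the cocycle extension of \<open>\<mu>\<close>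
  at \<open>z = q\<close>, which works over every commutative base ring (\<open>specialisation_cocycle_extension\<close>).
  Evaluation at the character \<open>z \<mapsto> q\<close>, that is \<open>\<Sum>\<^sub>i z\<^sup>i \<otimes> a\<^sub>i \<mapsto> \<Sum>\<^sub>i q\<^sup>i a\<^sub>i\<close>, is a surjective graded
  homomorphism from the scalar extension to \<open>A\<close> that turns the scalar \<open>\<mu>(g, h)\<close> into
  \<open>q\<^bsup>\<mu>(g, h)\<^esup>\<close>. Twisting is natural for such maps (\<open>twist_natural\<close>), so evaluation is also multiplicative
  between the twisted algebras. Its kernel is the ideal generated by \<open>z - q\<close>
  (\<open>kernel_evaluation_cyclic\<close>), and a surjective homomorphism induces an isomorphism on the quotient
  by its kernel.\<close>


section \<open>Quotients by kernels\<close>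

lemma (in abelian_monoid) finsum_swap:
  assumes "finite S" "finite T" "\<And>i j. i \<in> S \<Longrightarrow> j \<in> T \<Longrightarrow> f i j \<in> carrier G"
  shows "(\<Oplus>i\<in>S. \<Oplus>j\<in>T. f i j) = (\<Oplus>j\<in>T. \<Oplus>i\<in>S. f i j)"
  using assms(1,3)
proof (induction S rule: finite_induct)
  case (insert i S)
  have "(\<Oplus>i\<in>insert i S. \<Oplus>j\<in>T. f i j) = (\<Oplus>j\<in>T. f i j) \<oplus> (\<Oplus>i\<in>S. \<Oplus>j\<in>T. f i j)"
    using insert by (intro finsum_insert) (auto intro!: finsum_closed)
  also have "\<dots> = (\<Oplus>j\<in>T. f i j) \<oplus> (\<Oplus>j\<in>T. \<Oplus>i\<in>S. f i j)"
    using insert by simp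
  also have "\<dots> = (\<Oplus>j\<in>T. f i j \<oplus> (\<Oplus>i\<in>S. f i j))"
    using insert assms(2) by (intro finsum_addf[symmetric]) (auto intro!: finsum_closed)
  also have "\<dots> = (\<Oplus>j\<in>T. \<Oplus>i\<in>insert i S. f i j)"
    using insert by (intro finsum_cong') (auto simp: Pi_def intro!: finsum_closed)
  finally show ?case .
qed (simp add: finsum_zero)

lemma additive_finsum:
  assumes "abelian_group E" "abelian_group A" and \<phi>: "\<phi> \<in> carrier E \<rightarrow> carrier A"
    and add: "\<And>x y. x \<in> carrier E \<Longrightarrow> y \<in> carrier E \<Longrightarrow> \<phi> (x \<oplus>\<^bsub>E\<^esub> y) = \<phi> x \<oplus>\<^bsub>A\<^esub> \<phi> y"
    and "finite S" "f \<in> S \<rightarrow> carrier E"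
  shows "\<phi> (\<Oplus>\<^bsub>E\<^esub> i\<in>S. f i) = (\<Oplus>\<^bsub>A\<^esub> i\<in>S. \<phi> (f i))"
proof -
  interpret E: abelian_group E by fact
  interpret A: abelian_group A by fact
  have 0: "\<phi> \<zero>\<^bsub>E\<^esub> = \<zero>\<^bsub>A\<^esub>"
    using add[of "\<zero>\<^bsub>E\<^esub>" "\<zero>\<^bsub>E\<^esub>"] \<phi> by (auto simp: A.add.l_cancel_one' Pi_iff)
  show ?thesis using assms(5,6)
  proof (induction S rule: finite_induct)
    case (insert i S)
    moreover have "(\<lambda>i. \<phi> (f i)) \<in> insert i S \<rightarrow> carrier A" using insert.prems \<phi> by auto
    ultimately show ?case by (simp add: add Pi_def)
  qed (simp add: 0)
qed

text \<open>The elements of the quotient by the kernel are the fibres of \<open>\<Psi>\<close>, and all operations on fibres can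
  be read off in \<open>T\<close>. In this form the isomorphism theorem applies to a cocycle extension directly
  from its definition as a twist.\<close>

context
  fixes B :: "('b, 'u) ring_scheme" and T :: "('t, 'v) ring_scheme" and \<Psi> :: "'b \<Rightarrow> 't"
  assumes B: "abelian_group B" and T: "abelian_group T" and \<Psi>: "\<Psi> \<in> ring_hom B T"
begin

lemma kernel_coset_eq_fibre:
  assumes b: "b \<in> carrier B"
  shows "a_kernel B T \<Psi> +>\<^bsub>B\<^esub> b = {c \<in> carrier B. \<Psi> c = \<Psi> b}"
proof -
  interpret B: abelian_group B by (rule B)
  interpret T: abelian_group T by (rule T)
  have \<Psi>c: "\<Psi> x \<in> carrier T" if "x \<in> carrier B" for x using that \<Psi> by (rule ring_hom_closed[rotated])
  have add: "\<Psi> (x \<oplus>\<^bsub>B\<^esub> y) = \<Psi> x \<oplus>\<^bsub>T\<^esub> \<Psi> y" if "x \<in> carrier B" "y \<in> carrier B" for x y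
    using ring_hom_add[OF \<Psi>] that by blast
  show ?thesis
  proof (intro equalityI subsetI)
    fix c assume "c \<in> a_kernel B T \<Psi> +>\<^bsub>B\<^esub> b"
    then show "c \<in> {c \<in> carrier B. \<Psi> c = \<Psi> b}"
      using b \<Psi>c by (auto simp: a_r_coset_def' a_kernel_def kernel_def add)
  next
    fix c assume c: "c \<in> {c \<in> carrier B. \<Psi> c = \<Psi> b}"
    have cb: "c \<ominus>\<^bsub>B\<^esub> b \<in> carrier B" "(c \<ominus>\<^bsub>B\<^esub> b) \<oplus>\<^bsub>B\<^esub> b = c"
      using b c by (auto simp: a_minus_def B.a_assoc B.l_neg)
    then have "\<Psi> (c \<ominus>\<^bsub>B\<^esub> b) \<oplus>\<^bsub>T\<^esub> \<Psi> b = \<Psi> b"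
      using add[OF cb(1) b] c by simp
    then have "\<Psi> (c \<ominus>\<^bsub>B\<^esub> b) = \<zero>\<^bsub>T\<^esub>"
      using \<Psi>c cb b by (metis T.add.r_cancel_one)
    with cb show "c \<in> a_kernel B T \<Psi> +>\<^bsub>B\<^esub> b"
      by (auto simp: a_r_coset_def' a_kernel_def kernel_def intro!: bexI[of _ "c \<ominus>\<^bsub>B\<^esub> b"])
  qed
qed

lemma fibre_map_ring_iso:
  assumes surj: "\<Psi> ` carrier B = carrier T"
    and one: "\<one>\<^bsub>B\<^esub> \<in> carrier B"
    and mult: "\<And>x y. x \<in> carrier B \<Longrightarrow> y \<in> carrier B \<Longrightarrow> x \<otimes>\<^bsub>B\<^esub> y \<in> carrier B"
  shows "(\<lambda>a. {b \<in> carrier B. \<Psi> b = a}) \<in> ring_iso T (B Quot a_kernel B T \<Psi>)"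
proof -
  interpret B: abelian_group B by (rule B)
  let ?K = "a_kernel B T \<Psi>" and ?F = "\<lambda>a. {b \<in> carrier B. \<Psi> b = a}"
  have lift: "\<exists>b \<in> carrier B. \<Psi> b = a" if "a \<in> carrier T" for a
    using that surj by (metis imageE)
  note coset = kernel_coset_eq_fibre
  have Q: "carrier (B Quot ?K) = ?F ` carrier T"
    unfolding FactRing_simps partial_object.simps surj[symmetric] image_image
    using coset by (auto simp: image_iff)
  have m: "\<Psi> (x \<otimes>\<^bsub>B\<^esub> y) = \<Psi> x \<otimes>\<^bsub>T\<^esub> \<Psi> y" and a: "\<Psi> (x \<oplus>\<^bsub>B\<^esub> y) = \<Psi> x \<oplus>\<^bsub>T\<^esub> \<Psi> y"
    if "x \<in> carrier B" "y \<in> carrier B" for x y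
    using ring_hom_mult[OF \<Psi>] ring_hom_add[OF \<Psi>] that by blast+
  have hom: "?F \<in> ring_hom T (B Quot ?K)"
  proof (rule ring_hom_memI)
    fix x y assume xy: "x \<in> carrier T" "y \<in> carrier T"
    from lift xy obtain u v where uv: "u \<in> carrier B" "v \<in> carrier B" "\<Psi> u = x" "\<Psi> v = y"
      by metis
    have "?F x \<otimes>\<^bsub>B Quot ?K\<^esub> ?F y = (\<Union>b\<in>?F x. \<Union>c\<in>?F y. ?F (x \<otimes>\<^bsub>T\<^esub> y))"
      unfolding FactRing_def monoid.simps rcoset_mult_def
      using coset mult m by (intro SUP_cong refl) auto
    also have "\<dots> = ?F (x \<otimes>\<^bsub>T\<^esub> y)" using uv by auto
    finally show "?F (x \<otimes>\<^bsub>T\<^esub> y) = ?F x \<otimes>\<^bsub>B Quot ?K\<^esub> ?F y" ..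
    show "?F (x \<oplus>\<^bsub>T\<^esub> y) = ?F x \<oplus>\<^bsub>B Quot ?K\<^esub> ?F y"
    proof (intro equalityI subsetI)
      fix w assume w: "w \<in> ?F (x \<oplus>\<^bsub>T\<^esub> y)"
      have "w \<in> ?F (\<Psi> (u \<oplus>\<^bsub>B\<^esub> v))" using w uv by (simp add: a)
      then have "w \<in> ?K +>\<^bsub>B\<^esub> (u \<oplus>\<^bsub>B\<^esub> v)" using uv by (subst coset) auto
      then obtain k where k: "k \<in> ?K" "w = k \<oplus>\<^bsub>B\<^esub> (u \<oplus>\<^bsub>B\<^esub> v)"
        by (auto simp: a_r_coset_def')
      then have kc: "k \<in> carrier B" by (auto simp: a_kernel_def kernel_def)
      have "k \<oplus>\<^bsub>B\<^esub> u \<in> ?F x" using coset[OF uv(1)] k uv by (auto simp: a_r_coset_def')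
      moreover have "w = (k \<oplus>\<^bsub>B\<^esub> u) \<oplus>\<^bsub>B\<^esub> v" using k kc uv by (simp add: B.a_assoc)
      ultimately show "w \<in> ?F x \<oplus>\<^bsub>B Quot ?K\<^esub> ?F y"
        using uv by (auto simp: FactRing_def set_add_def')
    qed (auto simp: FactRing_def set_add_def' a)
  next
    show "?F \<one>\<^bsub>T\<^esub> = \<one>\<^bsub>B Quot ?K\<^esub>"
      using coset[OF one] ring_hom_one[OF \<Psi>] by (simp add: FactRing_def)
  qed (use Q in auto)
  have "inj_on ?F (carrier T)"
    by (rule inj_onI) (use lift in blast)
  with hom Q show ?thesis by (simp add: ring_iso_def bij_betw_def)
qed

end

lemma twist_simps [simp]:
  "carrier (twist G A \<A> \<sigma>) = carrier A" "\<one>\<^bsub>twist G A \<A> \<sigma>\<^esub> = \<one>\<^bsub>A\<^esub>" "\<zero>\<^bsub>twist G A \<A> \<sigma>\<^esub> = \<zero>\<^bsub>A\<^esub>"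
  "x \<oplus>\<^bsub>twist G A \<A> \<sigma>\<^esub> y = x \<oplus>\<^bsub>A\<^esub> y" "r \<odot>\<^bsub>twist G A \<A> \<sigma>\<^esub> x = r \<odot>\<^bsub>A\<^esub> x"
  by (simp_all add: twist_def)

lemma twist_abelian_group: "abelian_group A \<Longrightarrow> abelian_group (twist G A \<A> \<sigma>)"
  by (simp add: abelian_group_def abelian_monoid_def abelian_group_axioms_def twist_def)

lemma (in abelian_monoid) is_decompositionI:
  fixes \<A> :: "'g \<Rightarrow> 'a set"
  assumes "finite S" "S \<subseteq> carrier H" "\<And>g. g \<in> carrier H \<Longrightarrow> c g \<in> \<A> g"
    and "\<And>g. g \<in> carrier H \<Longrightarrow> \<A> g \<subseteq> carrier G" "\<And>g. g \<notin> S \<Longrightarrow> c g = \<zero>" "a = (\<Oplus>g\<in>S. c g)"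
  shows "is_decomposition H G \<A> a c"
proof -
  have sub: "supp G c \<subseteq> S" using assms(5) by (auto simp: supp_def)
  have "(\<Oplus>g\<in>supp G c. c g) = (\<Oplus>g\<in>S. c g)"
    by (rule finsum_superset) (use assms sub in \<open>auto simp: supp_def\<close>)
  then show ?thesis
    using assms sub finite_subset[OF sub] by (auto simp: is_decomposition_def)
qed

section \<open>Homogeneous components and twists\<close>

context graded_algebra begin

abbreviation comp :: "'a \<Rightarrow> 'g \<Rightarrow> 'a" where "comp \<equiv> component G A \<A>"

lemma component_eqI:
  "a \<in> carrier A \<Longrightarrow> is_decomposition G A \<A> a c \<Longrightarrow> comp a = c"
  unfolding component_def using direct_sum by (intro the1_equality)

lemma finite_supp_component: "a \<in> carrier A \<Longrightarrow> finite (supp A (comp a))"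
  and supp_component: "a \<in> carrier A \<Longrightarrow> supp A (comp a) \<subseteq> carrier G"
  and component_mem: "a \<in> carrier A \<Longrightarrow> g \<in> carrier G \<Longrightarrow> comp a g \<in> \<A> g"
  using is_decomposition_component unfolding is_decomposition_def by blast+

lemma component_outside: "a \<in> carrier A \<Longrightarrow> g \<notin> carrier G \<Longrightarrow> comp a g = \<zero>\<^bsub>A\<^esub>"
  using supp_component by (auto simp: supp_def)

lemma component_closed: "a \<in> carrier A \<Longrightarrow> comp a g \<in> carrier A"
  using component_mem[of a g] component_sub[of g] component_outside[of a g]
  by (cases "g \<in> carrier G") auto

lemma finsum_component:
  assumes "a \<in> carrier A" "finite S" "supp A (comp a) \<subseteq> S"
  shows "(\<Oplus>\<^bsub>A\<^esub> g\<in>S. comp a g) = a"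
proof -
  have "a = (\<Oplus>\<^bsub>A\<^esub> g\<in>supp A (comp a). comp a g)"
    using is_decomposition_component[OF assms(1)] by (simp add: is_decomposition_def)
  also have "\<dots> = (\<Oplus>\<^bsub>A\<^esub> g\<in>S. comp a g)"
    by (rule M.finsum_superset) (use assms component_closed in \<open>auto simp: supp_def\<close>)
  finally show ?thesis ..
qed

text \<open>Applying a degree-preserving additive map to each component of \<open>x\<close> gives a decomposition of the image,
  and decompositions in \<open>A\<close> are unique. So such maps commute with taking components.\<close>

lemma component_image:
  fixes E :: "('e, 'u) ring_scheme" and \<E> :: "'g \<Rightarrow> 'e set"
  assumes E: "abelian_group E" and \<E>: "\<And>g. g \<in> carrier G \<Longrightarrow> \<E> g \<subseteq> carrier E"
    and \<phi>: "\<phi> \<in> carrier E \<rightarrow> carrier A"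
    and add: "\<And>x y. x \<in> carrier E \<Longrightarrow> y \<in> carrier E \<Longrightarrow> \<phi> (x \<oplus>\<^bsub>E\<^esub> y) = \<phi> x \<oplus>\<^bsub>A\<^esub> \<phi> y"
    and deg: "\<And>g x. g \<in> carrier G \<Longrightarrow> x \<in> \<E> g \<Longrightarrow> \<phi> x \<in> \<A> g"
    and c: "is_decomposition G E \<E> x c"
  shows "comp (\<phi> x) = (\<lambda>g. \<phi> (c g))"
proof -
  interpret E: abelian_group E by fact
  have 0: "\<phi> \<zero>\<^bsub>E\<^esub> = \<zero>\<^bsub>A\<^esub>"
    using additive_finsum[OF E M.abelian_group_axioms \<phi> add, of "{}" "\<lambda>_. \<zero>\<^bsub>E\<^esub>"] by simp
  have c': "\<And>g. g \<in> carrier G \<Longrightarrow> c g \<in> \<E> g" "supp E c \<subseteq> carrier G" "finite (supp E c)"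
    "x = (\<Oplus>\<^bsub>E\<^esub> g\<in>supp E c. c g)" using c by (auto simp: is_decomposition_def)
  then have ce: "c \<in> supp E c \<rightarrow> carrier E" using \<E> by blast
  then have x: "x \<in> carrier E" by (subst c'(4)) (rule E.finsum_closed)
  have "\<phi> x = (\<Oplus>\<^bsub>A\<^esub> g\<in>supp E c. \<phi> (c g))"
    by (subst c'(4)) (rule additive_finsum[OF E M.abelian_group_axioms \<phi> add c'(3) ce])
  then have "is_decomposition G A \<A> (\<phi> x) (\<lambda>g. \<phi> (c g))"
    by (intro M.is_decompositionI[OF c'(3,2)]) (use c' deg component_sub 0 in \<open>auto simp: supp_def\<close>)
  with x \<phi> show ?thesis by (intro component_eqI) auto
qed

lemma component_homogeneous_elem:
  assumes "g \<in> carrier G" "a \<in> \<A> g"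
  shows "comp a = single A g a"
  by (rule M.component_homogeneous[OF direct_sum])
    (use assms component_sub component_zero in blast)+

lemma component_add:
  assumes a: "a \<in> carrier A" and b: "b \<in> carrier A"
  shows "comp (a \<oplus>\<^bsub>A\<^esub> b) = (\<lambda>g. comp a g \<oplus>\<^bsub>A\<^esub> comp b g)"
proof -
  let ?S = "supp A (comp a) \<union> supp A (comp b)"
  note fin = finite_supp_component[OF a] finite_supp_component[OF b]
  have "a \<oplus>\<^bsub>A\<^esub> b = (\<Oplus>\<^bsub>A\<^esub> g\<in>?S. comp a g) \<oplus>\<^bsub>A\<^esub> (\<Oplus>\<^bsub>A\<^esub> g\<in>?S. comp b g)"
    using finsum_component[OF a, of ?S] finsum_component[OF b, of ?S] fin by simp
  also have "\<dots> = (\<Oplus>\<^bsub>A\<^esub> g\<in>?S. comp a g \<oplus>\<^bsub>A\<^esub> comp b g)"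
    using fin component_closed a b by (intro M.finsum_addf[symmetric]) auto
  finally have "is_decomposition G A \<A> (a \<oplus>\<^bsub>A\<^esub> b) (\<lambda>g. comp a g \<oplus>\<^bsub>A\<^esub> comp b g)"
    using fin supp_component[OF a] supp_component[OF b] component_sub
      component_mem[OF a] component_mem[OF b] submoduleE(5)[OF component_submodule]
    by (intro M.is_decompositionI) (auto simp: supp_def)
  then show ?thesis using a b by (intro component_eqI) auto
qed

lemma component_smult:
  assumes a: "a \<in> carrier A" and r: "r \<in> carrier R"
  shows "comp (r \<odot>\<^bsub>A\<^esub> a) = (\<lambda>g. r \<odot>\<^bsub>A\<^esub> comp a g)"
  by (rule component_image[OF M.abelian_group_axioms])
    (use a r component_sub is_decomposition_component[OF a]
       submodule.smult_closed[OF component_submodule] in \<open>auto simp: smult_r_distr\<close>)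

text \<open>The twisted product sums over exact supports, which shrink under maps that kill components. Allowing
  arbitrary finite sets of degrees makes the products before and after such a map comparable.\<close>

lemma twist_mult_superset:
  assumes ab: "a \<in> carrier A" "b \<in> carrier A"
    and S: "finite S" "supp A (comp a) \<subseteq> S" "S \<subseteq> carrier G"
    and T: "finite T" "supp A (comp b) \<subseteq> T" "T \<subseteq> carrier G"
    and \<rho>: "\<And>g h. g \<in> carrier G \<Longrightarrow> h \<in> carrier G \<Longrightarrow> \<rho> g h \<in> carrier R"
  shows "a \<otimes>\<^bsub>twist G A \<A> \<rho>\<^esub> b = (\<Oplus>\<^bsub>A\<^esub> g\<in>S. \<Oplus>\<^bsub>A\<^esub> h\<in>T. \<rho> g h \<odot>\<^bsub>A\<^esub> (comp a g \<otimes>\<^bsub>A\<^esub> comp b h))"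
proof -
  have cl: "\<rho> g h \<odot>\<^bsub>A\<^esub> (comp a g \<otimes>\<^bsub>A\<^esub> comp b h) \<in> carrier A" if "g \<in> S" "h \<in> T" for g h
    using that S T \<rho> component_closed ab by (auto intro!: smult_closed simp: subset_iff)
  have inner: "(\<Oplus>\<^bsub>A\<^esub> h\<in>supp A (comp b). \<rho> g h \<odot>\<^bsub>A\<^esub> (comp a g \<otimes>\<^bsub>A\<^esub> comp b h)) =
      (\<Oplus>\<^bsub>A\<^esub> h\<in>T. \<rho> g h \<odot>\<^bsub>A\<^esub> (comp a g \<otimes>\<^bsub>A\<^esub> comp b h))" if "g \<in> S" for g
    by (rule M.finsum_superset) (use that S T \<rho> cl component_closed ab in \<open>auto simp: supp_def subset_iff\<close>)
  have "a \<otimes>\<^bsub>twist G A \<A> \<rho>\<^esub> b =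
     (\<Oplus>\<^bsub>A\<^esub> g\<in>supp A (comp a). \<Oplus>\<^bsub>A\<^esub> h\<in>supp A (comp b). \<rho> g h \<odot>\<^bsub>A\<^esub> (comp a g \<otimes>\<^bsub>A\<^esub> comp b h))"
    by (simp add: twist_def)
  also have "\<dots> = (\<Oplus>\<^bsub>A\<^esub> g\<in>supp A (comp a). \<Oplus>\<^bsub>A\<^esub> h\<in>T. \<rho> g h \<odot>\<^bsub>A\<^esub> (comp a g \<otimes>\<^bsub>A\<^esub> comp b h))"
    by (rule M.finsum_cong'[OF refl]) (use S inner cl in \<open>auto intro!: M.finsum_closed simp: subset_iff\<close>)
  also have "\<dots> = (\<Oplus>\<^bsub>A\<^esub> g\<in>S. \<Oplus>\<^bsub>A\<^esub> h\<in>T. \<rho> g h \<odot>\<^bsub>A\<^esub> (comp a g \<otimes>\<^bsub>A\<^esub> comp b h))"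
  proof (rule M.finsum_superset)
    show "(\<Oplus>\<^bsub>A\<^esub> h\<in>T. \<rho> g h \<odot>\<^bsub>A\<^esub> (comp a g \<otimes>\<^bsub>A\<^esub> comp b h)) = \<zero>\<^bsub>A\<^esub>" if "g \<in> S - supp A (comp a)" for g
    proof (rule M.add.finprod_one_eqI)
      fix h assume "h \<in> T"
      then have "\<rho> g h \<in> carrier R" using that S T by (intro \<rho>) auto
      moreover have "comp a g = \<zero>\<^bsub>A\<^esub>" using that by (simp add: supp_def)
      ultimately show "\<rho> g h \<odot>\<^bsub>A\<^esub> (comp a g \<otimes>\<^bsub>A\<^esub> comp b h) = \<zero>\<^bsub>A\<^esub>"
        using component_closed ab by simp
    qed
  qed (use S cl in \<open>auto intro!: M.finsum_closed\<close>)
  finally show ?thesis .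
qed

text \<open>Naturality of twisting: \<open>\<phi>\<close> commutes with taking components, so it carries the double sum that
  defines the product twisted by \<open>\<rho>\<close> term by term to the one twisted by \<open>\<tau>\<close>. The base rings may
  differ: the source of interest is a scalar extension, where \<open>\<rho>\<close> takes values in the group algebra.\<close>

lemma twist_natural:
  fixes E :: "('s, 'e, 'u) module_scheme" and \<E> :: "'g \<Rightarrow> 'e set"
  assumes E: "abelian_group E" and \<E>: "\<And>g. g \<in> carrier G \<Longrightarrow> \<E> g \<subseteq> carrier E"
    and dec: "\<And>x. x \<in> carrier E \<Longrightarrow> \<exists>!c. is_decomposition G E \<E> x c"
    and mult_closed: "\<And>x y. x \<in> carrier E \<Longrightarrow> y \<in> carrier E \<Longrightarrow> x \<otimes>\<^bsub>E\<^esub> y \<in> carrier E"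
    and scalar_closed: "\<And>g h x. g \<in> carrier G \<Longrightarrow> h \<in> carrier G \<Longrightarrow> x \<in> carrier E \<Longrightarrow>
        \<rho> g h \<odot>\<^bsub>E\<^esub> x \<in> carrier E"
    and \<phi>: "\<phi> \<in> ring_hom E A"
    and deg: "\<And>g x. g \<in> carrier G \<Longrightarrow> x \<in> \<E> g \<Longrightarrow> \<phi> x \<in> \<A> g"
    and \<tau>: "\<And>g h. g \<in> carrier G \<Longrightarrow> h \<in> carrier G \<Longrightarrow> \<tau> g h \<in> carrier R"
    and smult: "\<And>g h x. g \<in> carrier G \<Longrightarrow> h \<in> carrier G \<Longrightarrow> x \<in> carrier E \<Longrightarrow>
        \<phi> (\<rho> g h \<odot>\<^bsub>E\<^esub> x) = \<tau> g h \<odot>\<^bsub>A\<^esub> \<phi> x"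
  shows "x \<in> carrier E \<Longrightarrow> y \<in> carrier E \<Longrightarrow> x \<otimes>\<^bsub>twist G E \<E> \<rho>\<^esub> y \<in> carrier E"
    and "\<phi> \<in> ring_hom (twist G E \<E> \<rho>) (twist G A \<A> \<tau>)"
proof -
  interpret E: abelian_group E by fact
  let ?c = "component G E \<E>"
  have c: "is_decomposition G E \<E> x (?c x)" if "x \<in> carrier E" for x
    unfolding component_def by (rule theI'[OF dec[OF that]])
  then have fin: "finite (supp E (?c x))" and inG: "supp E (?c x) \<subseteq> carrier G" if "x \<in> carrier E" for x
    using that by (auto simp: is_decomposition_def)
  have closed: "?c x g \<in> carrier E" if "x \<in> carrier E" for x g
  proof (cases "g \<in> supp E (?c x)")
    case True
    then show ?thesis using c[OF that] \<E> inG[OF that] by (auto simp: is_decomposition_def)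
  qed (auto simp: supp_def)
  have \<phi>c: "\<phi> \<in> carrier E \<rightarrow> carrier A"
    and add: "\<And>x y. x \<in> carrier E \<Longrightarrow> y \<in> carrier E \<Longrightarrow> \<phi> (x \<oplus>\<^bsub>E\<^esub> y) = \<phi> x \<oplus>\<^bsub>A\<^esub> \<phi> y"
    using \<phi> by (auto simp: ring_hom_def)
  have 0: "\<phi> \<zero>\<^bsub>E\<^esub> = \<zero>\<^bsub>A\<^esub>"
    using additive_finsum[OF E M.abelian_group_axioms \<phi>c add, of "{}" "\<lambda>_. \<zero>\<^bsub>E\<^esub>"] by simp
  have comp: "comp (\<phi> x) = (\<lambda>g. \<phi> (?c x g))" if "x \<in> carrier E" for x
    by (rule component_image[OF E \<E> \<phi>c add deg c[OF that]])
  have sub: "supp A (comp (\<phi> x)) \<subseteq> supp E (?c x)" if "x \<in> carrier E" for x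
    using that by (auto simp: supp_def comp 0)
  have prod: "x \<otimes>\<^bsub>twist G E \<E> \<rho>\<^esub> y =
      (\<Oplus>\<^bsub>E\<^esub> g\<in>supp E (?c x). \<Oplus>\<^bsub>E\<^esub> h\<in>supp E (?c y). \<rho> g h \<odot>\<^bsub>E\<^esub> (?c x g \<otimes>\<^bsub>E\<^esub> ?c y h))" for x y
    by (simp add: twist_def)
  have term_closed: "\<rho> g h \<odot>\<^bsub>E\<^esub> (?c x g \<otimes>\<^bsub>E\<^esub> ?c y h) \<in> carrier E"
    if "x \<in> carrier E" "y \<in> carrier E" "g \<in> supp E (?c x)" "h \<in> supp E (?c y)" for x y g h
    by (intro scalar_closed mult_closed closed) (use that inG in blast)+
  show prod_closed: "x \<otimes>\<^bsub>twist G E \<E> \<rho>\<^esub> y \<in> carrier E" if "x \<in> carrier E" "y \<in> carrier E" for x y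
    unfolding prod using that term_closed by (auto intro!: E.finsum_closed)
  have "\<phi> (x \<otimes>\<^bsub>twist G E \<E> \<rho>\<^esub> y) = \<phi> x \<otimes>\<^bsub>twist G A \<A> \<tau>\<^esub> \<phi> y"
    if x: "x \<in> carrier E" and y: "y \<in> carrier E" for x y
  proof -
    have "\<phi> (x \<otimes>\<^bsub>twist G E \<E> \<rho>\<^esub> y) =
        (\<Oplus>\<^bsub>A\<^esub> g\<in>supp E (?c x). \<phi> (\<Oplus>\<^bsub>E\<^esub> h\<in>supp E (?c y). \<rho> g h \<odot>\<^bsub>E\<^esub> (?c x g \<otimes>\<^bsub>E\<^esub> ?c y h)))"
      unfolding prod using term_closed[OF x y]
      by (intro additive_finsum[OF E M.abelian_group_axioms \<phi>c add fin[OF x]])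
        (auto intro!: E.finsum_closed)
    also have "\<dots> = (\<Oplus>\<^bsub>A\<^esub> g\<in>supp E (?c x). \<Oplus>\<^bsub>A\<^esub> h\<in>supp E (?c y).
        \<phi> (\<rho> g h \<odot>\<^bsub>E\<^esub> (?c x g \<otimes>\<^bsub>E\<^esub> ?c y h)))"
      using term_closed[OF x y] \<phi>c
      by (intro M.finsum_cong' additive_finsum[OF E M.abelian_group_axioms \<phi>c add fin[OF y]])
        (auto intro!: M.finsum_closed)
    also have "\<dots> = (\<Oplus>\<^bsub>A\<^esub> g\<in>supp E (?c x). \<Oplus>\<^bsub>A\<^esub> h\<in>supp E (?c y).
        \<tau> g h \<odot>\<^bsub>A\<^esub> (comp (\<phi> x) g \<otimes>\<^bsub>A\<^esub> comp (\<phi> y) h))"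
    proof -
      have "\<phi> (\<rho> g h \<odot>\<^bsub>E\<^esub> (?c x g \<otimes>\<^bsub>E\<^esub> ?c y h)) = \<tau> g h \<odot>\<^bsub>A\<^esub> (comp (\<phi> x) g \<otimes>\<^bsub>A\<^esub> comp (\<phi> y) h)"
        if "g \<in> supp E (?c x)" "h \<in> supp E (?c y)" for g h
        using that inG[OF x] inG[OF y] closed[OF x] closed[OF y] mult_closed x y
        by (simp add: comp smult ring_hom_mult[OF \<phi>] subset_iff)
      moreover have "\<tau> g h \<odot>\<^bsub>A\<^esub> (comp (\<phi> x) g \<otimes>\<^bsub>A\<^esub> comp (\<phi> y) h) \<in> carrier A"
        if "g \<in> supp E (?c x)" "h \<in> supp E (?c y)" for g h
        using that inG[OF x] inG[OF y] component_closed \<tau>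
          funcset_mem[OF \<phi>c x] funcset_mem[OF \<phi>c y]
        by (auto intro!: smult_closed simp: subset_iff)
      ultimately show ?thesis by (intro M.finsum_cong') (auto intro!: M.finsum_closed)
    qed
    also have "\<dots> = \<phi> x \<otimes>\<^bsub>twist G A \<A> \<tau>\<^esub> \<phi> y"
      by (rule twist_mult_superset[symmetric]) (use \<phi>c x y sub fin inG \<tau> in auto)
    finally show ?thesis .
  qed
  then show "\<phi> \<in> ring_hom (twist G E \<E> \<rho>) (twist G A \<A> \<tau>)"
    by (intro ring_hom_memI) (use \<phi>c add ring_hom_one[OF \<phi>] in auto)
qed

definition rescale :: "('g \<Rightarrow> 'r) \<Rightarrow> 'a \<Rightarrow> 'a"
  where "rescale c a = (\<Oplus>\<^bsub>A\<^esub> g\<in>supp A (comp a). c g \<odot>\<^bsub>A\<^esub> comp a g)"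

context
  fixes c :: "'g \<Rightarrow> 'r"
  assumes c: "c \<in> carrier G \<rightarrow> carrier R"
begin

lemma rescale_superset:
  assumes "a \<in> carrier A" "finite S" "supp A (comp a) \<subseteq> S" "S \<subseteq> carrier G"
  shows "rescale c a = (\<Oplus>\<^bsub>A\<^esub> g\<in>S. c g \<odot>\<^bsub>A\<^esub> comp a g)"
  unfolding rescale_def
  by (rule M.finsum_superset)
    (use assms c component_closed in \<open>auto simp: supp_def subset_iff Pi_iff intro!: smult_closed\<close>)

lemma rescale_closed: "a \<in> carrier A \<Longrightarrow> rescale c a \<in> carrier A"
  unfolding rescale_def using c supp_component component_closed
  by (auto simp: subset_iff Pi_iff intro!: M.finsum_closed smult_closed)

lemma component_rescale:
  assumes a: "a \<in> carrier A" and g: "g \<in> carrier G"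
  shows "comp (rescale c a) g = c g \<odot>\<^bsub>A\<^esub> comp a g"
proof -
  let ?S = "supp A (comp a)"
  let ?d = "\<lambda>g. if g \<in> ?S then c g \<odot>\<^bsub>A\<^esub> comp a g else \<zero>\<^bsub>A\<^esub>"
  have cl: "c g \<odot>\<^bsub>A\<^esub> comp a g \<in> carrier A" if "g \<in> carrier G" for g
    using that c component_closed[OF a] by (auto intro!: smult_closed)
  have "rescale c a = (\<Oplus>\<^bsub>A\<^esub> g\<in>?S. ?d g)"
    unfolding rescale_def using cl supp_component[OF a] by (intro M.finsum_cong') auto
  then have "is_decomposition G A \<A> (rescale c a) ?d"
    using finite_supp_component[OF a] supp_component[OF a] component_sub component_zero
      component_mem[OF a] submodule.smult_closed[OF component_submodule] c
    by (intro M.is_decompositionI) (auto simp: Pi_iff)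
  then have "comp (rescale c a) g = ?d g"
    using component_eqI rescale_closed a by simp
  also have "\<dots> = c g \<odot>\<^bsub>A\<^esub> comp a g"
    using g c by (auto simp: supp_def Pi_iff)
  finally show ?thesis .
qed

lemma supp_component_rescale:
  assumes a: "a \<in> carrier A"
  shows "supp A (comp (rescale c a)) \<subseteq> supp A (comp a)"
proof
  fix g assume g: "g \<in> supp A (comp (rescale c a))"
  then have "g \<in> carrier G" using supp_component[OF rescale_closed[OF a]] by blast
  then show "g \<in> supp A (comp a)" using g c by (auto simp: supp_def component_rescale[OF a] Pi_iff)
qed

lemma rescale_homogeneous:
  assumes "g \<in> carrier G" "a \<in> \<A> g"
  shows "rescale c a = c g \<odot>\<^bsub>A\<^esub> a"
proof -
  have a: "a \<in> carrier A" using assms component_sub by blast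
  have "rescale c a = (\<Oplus>\<^bsub>A\<^esub> h\<in>{g}. c h \<odot>\<^bsub>A\<^esub> comp a h)"
    using assms a by (intro rescale_superset) (auto simp: component_homogeneous_elem single_def supp_def)
  also have "\<dots> = c g \<odot>\<^bsub>A\<^esub> a"
    using assms a c by (simp add: component_homogeneous_elem single_def Pi_iff)
  finally show ?thesis .
qed

lemma rescale_add:
  assumes a: "a \<in> carrier A" and b: "b \<in> carrier A"
  shows "rescale c (a \<oplus>\<^bsub>A\<^esub> b) = rescale c a \<oplus>\<^bsub>A\<^esub> rescale c b"
proof -
  let ?S = "supp A (comp a) \<union> supp A (comp b)"
  have S: "finite ?S" "?S \<subseteq> carrier G" and sub: "supp A (comp (a \<oplus>\<^bsub>A\<^esub> b)) \<subseteq> ?S"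
    using finite_supp_component supp_component a b by (auto simp: component_add supp_def)
  have "rescale c (a \<oplus>\<^bsub>A\<^esub> b) = (\<Oplus>\<^bsub>A\<^esub> g\<in>?S. c g \<odot>\<^bsub>A\<^esub> comp (a \<oplus>\<^bsub>A\<^esub> b) g)"
    using S sub a b by (intro rescale_superset) auto
  also have "\<dots> = (\<Oplus>\<^bsub>A\<^esub> g\<in>?S. c g \<odot>\<^bsub>A\<^esub> comp a g \<oplus>\<^bsub>A\<^esub> c g \<odot>\<^bsub>A\<^esub> comp b g)"
    using S c a b component_closed
    by (intro M.finsum_cong') (auto simp: component_add smult_r_distr Pi_iff subset_iff intro!: M.a_closed smult_closed)
  also have "\<dots> = (\<Oplus>\<^bsub>A\<^esub> g\<in>?S. c g \<odot>\<^bsub>A\<^esub> comp a g) \<oplus>\<^bsub>A\<^esub> (\<Oplus>\<^bsub>A\<^esub> g\<in>?S. c g \<odot>\<^bsub>A\<^esub> comp b g)"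
    using S c a b component_closed
    by (intro M.finsum_addf) (auto simp: Pi_iff subset_iff intro!: smult_closed)
  also have "\<dots> = rescale c a \<oplus>\<^bsub>A\<^esub> rescale c b"
    using S a b by (simp add: rescale_superset[of _ ?S])
  finally show ?thesis .
qed

lemma rescale_smult:
  assumes a: "a \<in> carrier A" and r: "r \<in> carrier R"
  shows "rescale c (r \<odot>\<^bsub>A\<^esub> a) = r \<odot>\<^bsub>A\<^esub> rescale c a"
proof -
  let ?S = "supp A (comp a)"
  have S: "finite ?S" "?S \<subseteq> carrier G" using finite_supp_component supp_component a by auto
  have cl: "c g \<odot>\<^bsub>A\<^esub> comp a g \<in> carrier A" if "g \<in> ?S" for g
    using that S c component_closed[OF a] by (auto intro!: smult_closed)
  have "rescale c (r \<odot>\<^bsub>A\<^esub> a) = (\<Oplus>\<^bsub>A\<^esub> g\<in>?S. c g \<odot>\<^bsub>A\<^esub> comp (r \<odot>\<^bsub>A\<^esub> a) g)"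
    using S a r by (intro rescale_superset) (auto simp: component_smult supp_def)
  also have "\<dots> = (\<Oplus>\<^bsub>A\<^esub> g\<in>?S. r \<odot>\<^bsub>A\<^esub> (c g \<odot>\<^bsub>A\<^esub> comp a g))"
  proof (intro M.finsum_cong' refl)
    show "c g \<odot>\<^bsub>A\<^esub> comp (r \<odot>\<^bsub>A\<^esub> a) g = r \<odot>\<^bsub>A\<^esub> (c g \<odot>\<^bsub>A\<^esub> comp a g)" if "g \<in> ?S" for g
    proof -
      have "c g \<in> carrier R" using that S c by auto
      then show ?thesis using component_closed[OF a] r a
        by (simp add: component_smult smult_assoc1[symmetric] R.m_comm)
    qed
  qed (use cl r in auto)
  also have "\<dots> = r \<odot>\<^bsub>A\<^esub> rescale c a"
    unfolding rescale_def using S cl r by (intro finsum_smult_ldistr[symmetric]) auto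
  finally show ?thesis .
qed

end

lemma rescale_inverse:
  assumes c: "c \<in> carrier G \<rightarrow> carrier R" and d: "d \<in> carrier G \<rightarrow> carrier R"
    and cd: "\<And>g. g \<in> carrier G \<Longrightarrow> d g \<otimes>\<^bsub>R\<^esub> c g = \<one>\<^bsub>R\<^esub>" and a: "a \<in> carrier A"
  shows "rescale d (rescale c a) = a"
proof -
  let ?S = "supp A (comp a)"
  have S: "finite ?S" "?S \<subseteq> carrier G" using finite_supp_component supp_component a by auto
  have ca: "rescale c a \<in> carrier A" by (rule rescale_closed[OF c a])
  have "rescale d (rescale c a) = (\<Oplus>\<^bsub>A\<^esub> g\<in>?S. d g \<odot>\<^bsub>A\<^esub> comp (rescale c a) g)"
    using S ca supp_component_rescale[OF c a] by (intro rescale_superset[OF d])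
  also have "\<dots> = (\<Oplus>\<^bsub>A\<^esub> g\<in>?S. comp a g)"
  proof (intro M.finsum_cong' refl)
    fix g assume "g \<in> ?S"
    then have g: "g \<in> carrier G" using S by blast
    then have "c g \<in> carrier R" "d g \<in> carrier R" using c d by auto
    then show "d g \<odot>\<^bsub>A\<^esub> comp (rescale c a) g = comp a g"
      using component_closed[OF a] by (simp add: component_rescale[OF c a g] smult_assoc1[symmetric] cd[OF g])
  qed (use component_closed[OF a] in auto)
  also have "\<dots> = a" using S a by (intro finsum_component) auto
  finally show ?thesis .
qed

text \<open>The product of elements of degrees \<open>g\<close>, \<open>h\<close> lies in degree \<open>gh\<close>. Hence rescaling after multiplying
  contributes \<open>c(gh) \<rho>(g, h)\<close>, rescaling before multiplying contributes \<open>\<tau>(g, h) c(g) c(h)\<close>, and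
  the cohomology relation says that these agree.\<close>

lemma twist_cohomologous:
  assumes c: "c \<in> carrier G \<rightarrow> carrier R" and d: "d \<in> carrier G \<rightarrow> carrier R"
    and cd: "\<And>g. g \<in> carrier G \<Longrightarrow> c g \<otimes>\<^bsub>R\<^esub> d g = \<one>\<^bsub>R\<^esub>" and c1: "c \<one>\<^bsub>G\<^esub> = \<one>\<^bsub>R\<^esub>"
    and \<rho>: "\<And>g h. g \<in> carrier G \<Longrightarrow> h \<in> carrier G \<Longrightarrow> \<rho> g h \<in> carrier R"
    and \<tau>: "\<And>g h. g \<in> carrier G \<Longrightarrow> h \<in> carrier G \<Longrightarrow> \<tau> g h \<in> carrier R"
    and eq: "\<And>g h. g \<in> carrier G \<Longrightarrow> h \<in> carrier G \<Longrightarrow>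
        c (g \<otimes>\<^bsub>G\<^esub> h) \<otimes>\<^bsub>R\<^esub> \<rho> g h = \<tau> g h \<otimes>\<^bsub>R\<^esub> (c g \<otimes>\<^bsub>R\<^esub> c h)"
  shows "rescale c \<in> algebra_iso R (twist G A \<A> \<rho>) (twist G A \<A> \<tau>)"
proof -
  note cl = rescale_closed[OF c] and add = rescale_add[OF c]
  have dc: "d g \<otimes>\<^bsub>R\<^esub> c g = \<one>\<^bsub>R\<^esub>" if "g \<in> carrier G" for g
    using cd[OF that] c d that R.m_comm by (simp add: Pi_iff)
  have mult: "rescale c (a \<otimes>\<^bsub>twist G A \<A> \<rho>\<^esub> b) = rescale c a \<otimes>\<^bsub>twist G A \<A> \<tau>\<^esub> rescale c b"
    if a: "a \<in> carrier A" and b: "b \<in> carrier A" for a b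
  proof -
    let ?S = "supp A (comp a)" and ?T = "supp A (comp b)"
    have S: "finite ?S" "?S \<subseteq> carrier G" and T: "finite ?T" "?T \<subseteq> carrier G"
      using finite_supp_component supp_component a b by auto
    have cla: "\<rho> g h \<odot>\<^bsub>A\<^esub> (comp a g \<otimes>\<^bsub>A\<^esub> comp b h) \<in> carrier A"
      "\<tau> g h \<odot>\<^bsub>A\<^esub> (comp (rescale c a) g \<otimes>\<^bsub>A\<^esub> comp (rescale c b) h) \<in> carrier A"
      if "g \<in> ?S" "h \<in> ?T" for g h
      using that S T \<rho> \<tau> component_closed cl a b by (auto intro!: smult_closed simp: subset_iff)
    have hom: "rescale c (\<rho> g h \<odot>\<^bsub>A\<^esub> (comp a g \<otimes>\<^bsub>A\<^esub> comp b h)) =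
        \<tau> g h \<odot>\<^bsub>A\<^esub> (comp (rescale c a) g \<otimes>\<^bsub>A\<^esub> comp (rescale c b) h)"
      if "g \<in> ?S" "h \<in> ?T" for g h
    proof -
      have gh: "g \<in> carrier G" "h \<in> carrier G" using that S T by auto
      then have r: "c g \<in> carrier R" "c h \<in> carrier R" "c (g \<otimes>\<^bsub>G\<^esub> h) \<in> carrier R" "\<rho> g h \<in> carrier R"
        "\<tau> g h \<in> carrier R"
        using c \<rho> \<tau> by auto
      have "comp a g \<otimes>\<^bsub>A\<^esub> comp b h \<in> \<A> (g \<otimes>\<^bsub>G\<^esub> h)"
        using gh component_mem a b by (intro mult_components)
      then have "\<rho> g h \<odot>\<^bsub>A\<^esub> (comp a g \<otimes>\<^bsub>A\<^esub> comp b h) \<in> \<A> (g \<otimes>\<^bsub>G\<^esub> h)"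
        using gh r by (intro submodule.smult_closed[OF component_submodule]) auto
      then have "rescale c (\<rho> g h \<odot>\<^bsub>A\<^esub> (comp a g \<otimes>\<^bsub>A\<^esub> comp b h)) =
          c (g \<otimes>\<^bsub>G\<^esub> h) \<odot>\<^bsub>A\<^esub> (\<rho> g h \<odot>\<^bsub>A\<^esub> (comp a g \<otimes>\<^bsub>A\<^esub> comp b h))"
        using gh by (intro rescale_homogeneous[OF c]) auto
      also have "\<dots> = (\<tau> g h \<otimes>\<^bsub>R\<^esub> (c g \<otimes>\<^bsub>R\<^esub> c h)) \<odot>\<^bsub>A\<^esub> (comp a g \<otimes>\<^bsub>A\<^esub> comp b h)"
        using r component_closed a b by (simp add: smult_assoc1[symmetric] eq[OF gh])
      also have "\<dots> = \<tau> g h \<odot>\<^bsub>A\<^esub> (comp (rescale c a) g \<otimes>\<^bsub>A\<^esub> comp (rescale c b) h)"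
        using r component_closed a b gh
        by (simp add: component_rescale[OF c] R.m_comm[of "c g" "c h"]
            smult_mult_left smult_mult_right smult_assoc1)
      finally show ?thesis .
    qed
    have "rescale c (a \<otimes>\<^bsub>twist G A \<A> \<rho>\<^esub> b) =
       rescale c (\<Oplus>\<^bsub>A\<^esub> g\<in>?S. \<Oplus>\<^bsub>A\<^esub> h\<in>?T. \<rho> g h \<odot>\<^bsub>A\<^esub> (comp a g \<otimes>\<^bsub>A\<^esub> comp b h))"
      by (simp add: twist_def)
    also have "\<dots> = (\<Oplus>\<^bsub>A\<^esub> g\<in>?S. rescale c (\<Oplus>\<^bsub>A\<^esub> h\<in>?T. \<rho> g h \<odot>\<^bsub>A\<^esub> (comp a g \<otimes>\<^bsub>A\<^esub> comp b h)))"
      using S cl cla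
      by (intro additive_finsum[OF M.abelian_group_axioms M.abelian_group_axioms _ add])
        (auto intro!: M.finsum_closed)
    also have "\<dots> = (\<Oplus>\<^bsub>A\<^esub> g\<in>?S. \<Oplus>\<^bsub>A\<^esub> h\<in>?T. rescale c (\<rho> g h \<odot>\<^bsub>A\<^esub> (comp a g \<otimes>\<^bsub>A\<^esub> comp b h)))"
      using T cl cla
      by (intro M.finsum_cong' refl additive_finsum[OF M.abelian_group_axioms M.abelian_group_axioms _ add])
        (auto intro!: M.finsum_closed)
    also have "\<dots> = (\<Oplus>\<^bsub>A\<^esub> g\<in>?S. \<Oplus>\<^bsub>A\<^esub> h\<in>?T.
        \<tau> g h \<odot>\<^bsub>A\<^esub> (comp (rescale c a) g \<otimes>\<^bsub>A\<^esub> comp (rescale c b) h))"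
      using hom cla by (intro M.finsum_cong' refl) (auto intro!: M.finsum_closed)
    also have "\<dots> = rescale c a \<otimes>\<^bsub>twist G A \<A> \<tau>\<^esub> rescale c b"
      by (rule twist_mult_superset[symmetric]) (use S T supp_component_rescale[OF c] cl a b \<tau> in auto)
    finally show ?thesis .
  qed
  have "rescale c \<in> ring_hom (twist G A \<A> \<rho>) (twist G A \<A> \<tau>)"
    by (rule ring_hom_memI)
      (use cl add mult c1 one_component rescale_homogeneous[OF c _ one_component] in auto)
  moreover have "bij_betw (rescale c) (carrier A) (carrier A)"
    by (rule bij_betw_byWitness[where f' = "rescale d"])
      (use rescale_inverse[OF c d dc] rescale_inverse[OF d c cd] cl rescale_closed[OF d] in auto)
  ultimately show ?thesis
    using rescale_smult[OF c] by (simp add: algebra_iso_def ring_iso_def)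
qed

end

section \<open>Evaluating a scalar extension at a character\<close>

lemma (in cring) group_algebra_abelian_group: "abelian_group (group_algebra R \<Gamma>)"
proof (rule abelian_groupI)
  fix x y assume *: "x \<in> carrier (group_algebra R \<Gamma>)" "y \<in> carrier (group_algebra R \<Gamma>)"
  have "supp R (\<lambda>\<gamma>. x \<gamma> \<oplus> y \<gamma>) \<subseteq> supp R x \<union> supp R y"
    using * by (auto simp: supp_def group_algebra_def finsupp_def)
  with * show "x \<oplus>\<^bsub>group_algebra R \<Gamma>\<^esub> y \<in> carrier (group_algebra R \<Gamma>)"
    by (auto simp: group_algebra_def finsupp_def intro: finite_subset)
next
  fix x assume *: "x \<in> carrier (group_algebra R \<Gamma>)"
  have "supp R (\<lambda>\<gamma>. \<ominus> x \<gamma>) \<subseteq> supp R x"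
    by (auto simp: supp_def)
  with * have "(\<lambda>\<gamma>. \<ominus> x \<gamma>) \<in> carrier (group_algebra R \<Gamma>)"
    by (auto simp: group_algebra_def finsupp_def intro: finite_subset)
  with * show "\<exists>y\<in>carrier (group_algebra R \<Gamma>). y \<oplus>\<^bsub>group_algebra R \<Gamma>\<^esub> x = \<zero>\<^bsub>group_algebra R \<Gamma>\<^esub>"
    by (intro bexI[of _ "\<lambda>\<gamma>. \<ominus> x \<gamma>"]) (auto simp: group_algebra_def finsupp_def l_neg)
qed (auto simp: group_algebra_def finsupp_def supp_def a_ac)

lemma (in cring) group_algebra_smult_one:
  "c \<in> carrier R \<Longrightarrow> c \<odot>\<^bsub>group_algebra R \<Gamma>\<^esub> \<one>\<^bsub>group_algebra R \<Gamma>\<^esub> = single R \<one>\<^bsub>\<Gamma>\<^esub> c"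
  by (auto simp: group_algebra_def single_def)

text \<open>Subtraction in a ring record is derived from its addition by a description of inverses, so it
  has to be computed through the group laws.\<close>

lemma (in cring) group_algebra_minus:
  fixes \<Gamma> :: "('c, 'z) monoid_scheme"
  assumes x: "x \<in> finsupp \<Gamma> R" and y: "y \<in> finsupp \<Gamma> R"
  shows "x \<ominus>\<^bsub>group_algebra R \<Gamma>\<^esub> y = (\<lambda>\<gamma>. x \<gamma> \<ominus> y \<gamma>)"
    and "x \<ominus>\<^bsub>group_algebra R \<Gamma>\<^esub> y \<in> finsupp \<Gamma> R"
proof -
  interpret K: abelian_group "group_algebra R \<Gamma>" by (rule group_algebra_abelian_group)
  have C: "carrier (group_algebra R \<Gamma>) = finsupp \<Gamma> R" by (simp add: group_algebra_def)
  let ?d = "x \<ominus>\<^bsub>group_algebra R \<Gamma>\<^esub> y"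
  have K: "x \<in> carrier (group_algebra R \<Gamma>)" "y \<in> carrier (group_algebra R \<Gamma>)" using x y C by auto
  then show d: "?d \<in> finsupp \<Gamma> R" using K.minus_closed C by blast
  have K_add: "u \<oplus>\<^bsub>group_algebra R \<Gamma>\<^esub> v = (\<lambda>\<gamma>. u \<gamma> \<oplus> v \<gamma>)" for u v :: "'c \<Rightarrow> 'a"
    by (simp add: group_algebra_def)
  have "?d \<oplus>\<^bsub>group_algebra R \<Gamma>\<^esub> y = x"
    using K by (simp add: a_minus_def K.a_assoc K.l_neg)
  then have sum: "x \<gamma> = ?d \<gamma> \<oplus> y \<gamma>" for \<gamma>
    by (simp add: fun_eq_iff K_add)
  have "x \<gamma> \<ominus> y \<gamma> = ?d \<gamma>" for \<gamma>
  proof -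
    have "?d \<gamma> \<in> carrier R" "y \<gamma> \<in> carrier R" using d y by (auto simp: finsupp_def)
    then show ?thesis by (subst sum) (simp only: a_minus_def a_assoc r_neg r_zero a_inv_closed)
  qed
  then show "?d = (\<lambda>\<gamma>. x \<gamma> \<ominus> y \<gamma>)" by auto
qed

locale character_evaluation = assoc_algebra R A + \<Gamma>: group \<Gamma>
  for R :: "('r, 'x) ring_scheme" (structure) and A :: "('r, 'a, 'y) module_scheme" (structure)
    and \<Gamma> :: "('c, 'z) monoid_scheme" (structure) +
  fixes \<chi> :: "'c \<Rightarrow> 'r"
  assumes finite_group: "finite (carrier \<Gamma>)"
    and character_closed: "\<gamma> \<in> carrier \<Gamma> \<Longrightarrow> \<chi> \<gamma> \<in> carrier R"
    and character_one: "\<chi> \<one>\<^bsub>\<Gamma>\<^esub> = \<one>\<^bsub>R\<^esub>"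
    and character_mult: "\<gamma> \<in> carrier \<Gamma> \<Longrightarrow> \<delta> \<in> carrier \<Gamma> \<Longrightarrow> \<chi> (\<gamma> \<otimes>\<^bsub>\<Gamma>\<^esub> \<delta>) = \<chi> \<gamma> \<otimes>\<^bsub>R\<^esub> \<chi> \<delta>"
begin

definition evaluate :: "('c \<Rightarrow> 'a) \<Rightarrow> 'a"
  where "evaluate f = (\<Oplus>\<^bsub>A\<^esub> \<gamma>\<in>carrier \<Gamma>. \<chi> \<gamma> \<odot>\<^bsub>A\<^esub> f \<gamma>)"

definition evaluate_scalar :: "('c \<Rightarrow> 'r) \<Rightarrow> 'r"
  where "evaluate_scalar x = (\<Oplus>\<^bsub>R\<^esub> \<gamma>\<in>carrier \<Gamma>. \<chi> \<gamma> \<otimes>\<^bsub>R\<^esub> x \<gamma>)"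

lemma evaluate_closed: "f \<in> finsupp \<Gamma> A \<Longrightarrow> evaluate f \<in> carrier A"
  unfolding evaluate_def finsupp_def
  by (auto intro!: M.finsum_closed smult_closed character_closed)

lemma evaluate_add:
  assumes "f \<in> finsupp \<Gamma> A" "g \<in> finsupp \<Gamma> A"
  shows "evaluate (\<lambda>\<gamma>. f \<gamma> \<oplus>\<^bsub>A\<^esub> g \<gamma>) = evaluate f \<oplus>\<^bsub>A\<^esub> evaluate g"
proof -
  have fg: "\<And>\<gamma>. f \<gamma> \<in> carrier A" "\<And>\<gamma>. g \<gamma> \<in> carrier A" using assms by (auto simp: finsupp_def)
  have "evaluate (\<lambda>\<gamma>. f \<gamma> \<oplus>\<^bsub>A\<^esub> g \<gamma>) =
      (\<Oplus>\<^bsub>A\<^esub> \<gamma>\<in>carrier \<Gamma>. \<chi> \<gamma> \<odot>\<^bsub>A\<^esub> f \<gamma> \<oplus>\<^bsub>A\<^esub> \<chi> \<gamma> \<odot>\<^bsub>A\<^esub> g \<gamma>)"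
    unfolding evaluate_def using fg character_closed
    by (intro M.finsum_cong') (auto simp: smult_r_distr)
  also have "\<dots> = evaluate f \<oplus>\<^bsub>A\<^esub> evaluate g"
    unfolding evaluate_def using fg character_closed finite_group by (intro M.finsum_addf) auto
  finally show ?thesis .
qed

lemma evaluate_single:
  assumes "\<gamma> \<in> carrier \<Gamma>" "a \<in> carrier A"
  shows "evaluate (single A \<gamma> a) = \<chi> \<gamma> \<odot>\<^bsub>A\<^esub> a"
proof -
  have "evaluate (single A \<gamma> a) = (\<Oplus>\<^bsub>A\<^esub> \<delta>\<in>carrier \<Gamma>. if \<gamma> = \<delta> then \<chi> \<delta> \<odot>\<^bsub>A\<^esub> a else \<zero>\<^bsub>A\<^esub>)"
    unfolding evaluate_def using assms character_closed
    by (intro M.finsum_cong') (auto simp: single_def)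
  then show ?thesis
    using assms character_closed finite_group M.add.finprod_singleton[of \<gamma> "carrier \<Gamma>" "\<lambda>\<delta>. \<chi> \<delta> \<odot>\<^bsub>A\<^esub> a"]
    by simp
qed

lemma evaluate_scalar_single:
  assumes "\<gamma> \<in> carrier \<Gamma>" "r \<in> carrier R"
  shows "evaluate_scalar (single R \<gamma> r) = \<chi> \<gamma> \<otimes>\<^bsub>R\<^esub> r"
proof -
  have "evaluate_scalar (single R \<gamma> r) = (\<Oplus>\<^bsub>R\<^esub> \<delta>\<in>carrier \<Gamma>. if \<gamma> = \<delta> then \<chi> \<delta> \<otimes>\<^bsub>R\<^esub> r else \<zero>\<^bsub>R\<^esub>)"
    unfolding evaluate_scalar_def using assms character_closed
    by (intro R.finsum_cong') (auto simp: single_def)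
  then show ?thesis
    using assms character_closed finite_group R.add.finprod_singleton[of \<gamma> "carrier \<Gamma>" "\<lambda>\<delta>. \<chi> \<delta> \<otimes>\<^bsub>R\<^esub> r"]
    by simp
qed

text \<open>Both the product and the action of the group algebra on a scalar extension are convolutions with
  coefficients in \<open>A\<close>. Their common properties are treated for an arbitrary coefficient pairing.\<close>

context
  fixes P :: "('p, 'u) ring_scheme" and Q :: "('q, 'v) ring_scheme" and bop :: "'p \<Rightarrow> 'q \<Rightarrow> 'a"
    and x :: "'c \<Rightarrow> 'p" and y :: "'c \<Rightarrow> 'q"
  assumes xy: "supp P x \<subseteq> carrier \<Gamma>" "supp Q y \<subseteq> carrier \<Gamma>"
    and bop: "\<And>\<alpha> \<beta>. bop (x \<alpha>) (y \<beta>) \<in> carrier A"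
    and bop_zero: "\<And>\<alpha> \<beta>. x \<alpha> = \<zero>\<^bsub>P\<^esub> \<or> y \<beta> = \<zero>\<^bsub>Q\<^esub> \<Longrightarrow> bop (x \<alpha>) (y \<beta>) = \<zero>\<^bsub>A\<^esub>"
begin

lemma convolution_sum:
  "convolution \<Gamma> P Q A bop x y \<gamma> =
    (\<Oplus>\<^bsub>A\<^esub> \<alpha>\<in>carrier \<Gamma>. \<Oplus>\<^bsub>A\<^esub> \<beta>\<in>{\<beta> \<in> carrier \<Gamma>. \<alpha> \<otimes>\<^bsub>\<Gamma>\<^esub> \<beta> = \<gamma>}. bop (x \<alpha>) (y \<beta>))"
  using finite_group finite_group xy by (rule M.convolution_superset) (fact bop bop_zero)+

lemma convolution_finsupp: "convolution \<Gamma> P Q A bop x y \<in> finsupp \<Gamma> A"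
proof -
  have "convolution \<Gamma> P Q A bop x y \<gamma> = \<zero>\<^bsub>A\<^esub>" if "\<gamma> \<notin> carrier \<Gamma>" for \<gamma>
    unfolding convolution_sum
  proof (rule M.add.finprod_one_eqI)
    fix \<alpha> assume "\<alpha> \<in> carrier \<Gamma>"
    with that have "{\<beta> \<in> carrier \<Gamma>. \<alpha> \<otimes>\<^bsub>\<Gamma>\<^esub> \<beta> = \<gamma>} = {}" by auto
    then show "(\<Oplus>\<^bsub>A\<^esub> \<beta>\<in>{\<beta> \<in> carrier \<Gamma>. \<alpha> \<otimes>\<^bsub>\<Gamma>\<^esub> \<beta> = \<gamma>}. bop (x \<alpha>) (y \<beta>)) = \<zero>\<^bsub>A\<^esub>"
      by (simp only: M.finsum_empty)
  qed
  then have "supp A (convolution \<Gamma> P Q A bop x y) \<subseteq> carrier \<Gamma>" by (auto simp: supp_def)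
  moreover have "convolution \<Gamma> P Q A bop x y \<gamma> \<in> carrier A" for \<gamma>
    unfolding convolution_sum using bop by (auto intro!: M.finsum_closed)
  ultimately show ?thesis
    using finite_group by (auto simp: finsupp_def intro: finite_subset)
qed

text \<open>Collecting the terms by the pair \<open>(\<alpha>, \<beta>)\<close> instead of the product \<open>\<alpha>\<beta>\<close>, each pair contributes once,
  with weight \<open>\<chi>(\<alpha>\<beta>) = \<chi>(\<alpha>) \<chi>(\<beta>)\<close>.\<close>

lemma evaluate_convolution:
  "evaluate (convolution \<Gamma> P Q A bop x y) =
    (\<Oplus>\<^bsub>A\<^esub> \<alpha>\<in>carrier \<Gamma>. \<Oplus>\<^bsub>A\<^esub> \<beta>\<in>carrier \<Gamma>. (\<chi> \<alpha> \<otimes>\<^bsub>R\<^esub> \<chi> \<beta>) \<odot>\<^bsub>A\<^esub> bop (x \<alpha>) (y \<beta>))"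
proof -
  let ?t = "\<lambda>\<gamma> \<alpha> \<beta>. if \<alpha> \<otimes>\<^bsub>\<Gamma>\<^esub> \<beta> = \<gamma> then \<chi> \<gamma> \<odot>\<^bsub>A\<^esub> bop (x \<alpha>) (y \<beta>) else \<zero>\<^bsub>A\<^esub>"
  have t: "?t \<gamma> \<alpha> \<beta> \<in> carrier A" if "\<gamma> \<in> carrier \<Gamma>" for \<gamma> \<alpha> \<beta>
    using that bop character_closed by auto
  have "\<chi> \<gamma> \<odot>\<^bsub>A\<^esub> convolution \<Gamma> P Q A bop x y \<gamma> = (\<Oplus>\<^bsub>A\<^esub> \<alpha>\<in>carrier \<Gamma>. \<Oplus>\<^bsub>A\<^esub> \<beta>\<in>carrier \<Gamma>. ?t \<gamma> \<alpha> \<beta>)"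
    if \<gamma>: "\<gamma> \<in> carrier \<Gamma>" for \<gamma>
  proof -
    let ?F = "\<lambda>\<alpha>. {\<beta> \<in> carrier \<Gamma>. \<alpha> \<otimes>\<^bsub>\<Gamma>\<^esub> \<beta> = \<gamma>}"
    have inner: "\<chi> \<gamma> \<odot>\<^bsub>A\<^esub> (\<Oplus>\<^bsub>A\<^esub> \<beta>\<in>?F \<alpha>. bop (x \<alpha>) (y \<beta>)) = (\<Oplus>\<^bsub>A\<^esub> \<beta>\<in>carrier \<Gamma>. ?t \<gamma> \<alpha> \<beta>)" for \<alpha>
    proof -
      have "\<chi> \<gamma> \<odot>\<^bsub>A\<^esub> (\<Oplus>\<^bsub>A\<^esub> \<beta>\<in>?F \<alpha>. bop (x \<alpha>) (y \<beta>)) = (\<Oplus>\<^bsub>A\<^esub> \<beta>\<in>?F \<alpha>. \<chi> \<gamma> \<odot>\<^bsub>A\<^esub> bop (x \<alpha>) (y \<beta>))"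
        using finite_group bop character_closed[OF \<gamma>] by (intro finsum_smult_ldistr) auto
      also have "\<dots> = (\<Oplus>\<^bsub>A\<^esub> \<beta>\<in>?F \<alpha>. ?t \<gamma> \<alpha> \<beta>)"
        using t[OF \<gamma>] by (intro M.finsum_cong') auto
      also have "\<dots> = (\<Oplus>\<^bsub>A\<^esub> \<beta>\<in>carrier \<Gamma>. ?t \<gamma> \<alpha> \<beta>)"
        using finite_group t[OF \<gamma>] by (intro M.finsum_superset) auto
      finally show ?thesis .
    qed
    have "\<chi> \<gamma> \<odot>\<^bsub>A\<^esub> convolution \<Gamma> P Q A bop x y \<gamma> =
        (\<Oplus>\<^bsub>A\<^esub> \<alpha>\<in>carrier \<Gamma>. \<chi> \<gamma> \<odot>\<^bsub>A\<^esub> (\<Oplus>\<^bsub>A\<^esub> \<beta>\<in>?F \<alpha>. bop (x \<alpha>) (y \<beta>)))"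
      unfolding convolution_sum using finite_group bop character_closed[OF \<gamma>]
      by (intro finsum_smult_ldistr) (auto intro!: M.finsum_closed)
    then show ?thesis unfolding inner .
  qed
  then have "evaluate (convolution \<Gamma> P Q A bop x y) =
      (\<Oplus>\<^bsub>A\<^esub> \<gamma>\<in>carrier \<Gamma>. \<Oplus>\<^bsub>A\<^esub> \<alpha>\<in>carrier \<Gamma>. \<Oplus>\<^bsub>A\<^esub> \<beta>\<in>carrier \<Gamma>. ?t \<gamma> \<alpha> \<beta>)"
    unfolding evaluate_def using t by (intro M.finsum_cong') (auto intro!: M.finsum_closed)
  also have "\<dots> = (\<Oplus>\<^bsub>A\<^esub> \<alpha>\<in>carrier \<Gamma>. \<Oplus>\<^bsub>A\<^esub> \<gamma>\<in>carrier \<Gamma>. \<Oplus>\<^bsub>A\<^esub> \<beta>\<in>carrier \<Gamma>. ?t \<gamma> \<alpha> \<beta>)"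
    using finite_group t by (intro M.finsum_swap) (auto intro!: M.finsum_closed)
  also have "\<dots> = (\<Oplus>\<^bsub>A\<^esub> \<alpha>\<in>carrier \<Gamma>. \<Oplus>\<^bsub>A\<^esub> \<beta>\<in>carrier \<Gamma>. \<Oplus>\<^bsub>A\<^esub> \<gamma>\<in>carrier \<Gamma>. ?t \<gamma> \<alpha> \<beta>)"
  proof (rule M.finsum_cong'[OF refl])
    show "(\<Oplus>\<^bsub>A\<^esub> \<gamma>\<in>carrier \<Gamma>. \<Oplus>\<^bsub>A\<^esub> \<beta>\<in>carrier \<Gamma>. ?t \<gamma> \<alpha> \<beta>) =
        (\<Oplus>\<^bsub>A\<^esub> \<beta>\<in>carrier \<Gamma>. \<Oplus>\<^bsub>A\<^esub> \<gamma>\<in>carrier \<Gamma>. ?t \<gamma> \<alpha> \<beta>)" for \<alpha>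
      using t by (intro M.finsum_swap finite_group)
  qed (use t in \<open>auto intro!: M.finsum_closed\<close>)
  also have "\<dots> = (\<Oplus>\<^bsub>A\<^esub> \<alpha>\<in>carrier \<Gamma>. \<Oplus>\<^bsub>A\<^esub> \<beta>\<in>carrier \<Gamma>. (\<chi> \<alpha> \<otimes>\<^bsub>R\<^esub> \<chi> \<beta>) \<odot>\<^bsub>A\<^esub> bop (x \<alpha>) (y \<beta>))"
  proof -
    have *: "(\<Oplus>\<^bsub>A\<^esub> \<gamma>\<in>carrier \<Gamma>. ?t \<gamma> \<alpha> \<beta>) = (\<chi> \<alpha> \<otimes>\<^bsub>R\<^esub> \<chi> \<beta>) \<odot>\<^bsub>A\<^esub> bop (x \<alpha>) (y \<beta>)"
      if "\<alpha> \<in> carrier \<Gamma>" "\<beta> \<in> carrier \<Gamma>" for \<alpha> \<beta>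
      using that bop character_closed finite_group
      by (subst M.add.finprod_singleton) (auto simp: character_mult)
    have cl: "(\<chi> \<alpha> \<otimes>\<^bsub>R\<^esub> \<chi> \<beta>) \<odot>\<^bsub>A\<^esub> bop (x \<alpha>) (y \<beta>) \<in> carrier A"
      if "\<alpha> \<in> carrier \<Gamma>" "\<beta> \<in> carrier \<Gamma>" for \<alpha> \<beta>
      using that bop character_closed by auto
    show ?thesis
    proof (rule M.finsum_cong'[OF refl])
      show "(\<Oplus>\<^bsub>A\<^esub> \<beta>\<in>carrier \<Gamma>. \<Oplus>\<^bsub>A\<^esub> \<gamma>\<in>carrier \<Gamma>. ?t \<gamma> \<alpha> \<beta>) =
          (\<Oplus>\<^bsub>A\<^esub> \<beta>\<in>carrier \<Gamma>. (\<chi> \<alpha> \<otimes>\<^bsub>R\<^esub> \<chi> \<beta>) \<odot>\<^bsub>A\<^esub> bop (x \<alpha>) (y \<beta>))" if "\<alpha> \<in> carrier \<Gamma>" for \<alpha>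
        by (rule M.finsum_cong'[OF refl]) (use that * cl in auto)
    qed (use cl in \<open>auto intro!: M.finsum_closed\<close>)
  qed
  finally show ?thesis .
qed

end

abbreviation (input) E where "E \<equiv> scalar_extension R \<Gamma> A"

lemma finsuppD: "f \<in> finsupp \<Gamma> B \<Longrightarrow> f \<gamma> \<in> carrier B" "f \<in> finsupp \<Gamma> B \<Longrightarrow> supp B f \<subseteq> carrier \<Gamma>"
  by (auto simp: finsupp_def)

lemma finsupp_outside: "f \<in> finsupp \<Gamma> B \<Longrightarrow> \<gamma> \<notin> carrier \<Gamma> \<Longrightarrow> f \<gamma> = \<zero>\<^bsub>B\<^esub>"
  by (auto simp: finsupp_def supp_def)

lemma scalar_extension_mult:
  assumes f: "f \<in> finsupp \<Gamma> A" and g: "g \<in> finsupp \<Gamma> A"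
  shows "f \<otimes>\<^bsub>E\<^esub> g \<in> finsupp \<Gamma> A" and "evaluate (f \<otimes>\<^bsub>E\<^esub> g) = evaluate f \<otimes>\<^bsub>A\<^esub> evaluate g"
proof -
  note fg = finsuppD[OF f] finsuppD[OF g]
  have E: "f \<otimes>\<^bsub>E\<^esub> g = convolution \<Gamma> A A A (\<otimes>\<^bsub>A\<^esub>) f g" by (simp add: scalar_extension_def)
  show "f \<otimes>\<^bsub>E\<^esub> g \<in> finsupp \<Gamma> A"
    unfolding E by (rule convolution_finsupp) (use fg in auto)
  have cl: "\<chi> \<gamma> \<odot>\<^bsub>A\<^esub> f \<gamma> \<in> carrier A" "\<chi> \<gamma> \<odot>\<^bsub>A\<^esub> g \<gamma> \<in> carrier A" if "\<gamma> \<in> carrier \<Gamma>" for \<gamma>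
    using fg character_closed[OF that] by auto
  have split: "(\<chi> \<alpha> \<otimes>\<^bsub>R\<^esub> \<chi> \<beta>) \<odot>\<^bsub>A\<^esub> (f \<alpha> \<otimes>\<^bsub>A\<^esub> g \<beta>) = (\<chi> \<alpha> \<odot>\<^bsub>A\<^esub> f \<alpha>) \<otimes>\<^bsub>A\<^esub> (\<chi> \<beta> \<odot>\<^bsub>A\<^esub> g \<beta>)"
    if "\<alpha> \<in> carrier \<Gamma>" "\<beta> \<in> carrier \<Gamma>" for \<alpha> \<beta>
    using that fg character_closed 
    by (simp add: R.m_comm[of "\<chi> \<alpha>" "\<chi> \<beta>"] smult_assoc1 smult_mult_left smult_mult_right)
  have "evaluate (f \<otimes>\<^bsub>E\<^esub> g) =
      (\<Oplus>\<^bsub>A\<^esub> \<alpha>\<in>carrier \<Gamma>. \<Oplus>\<^bsub>A\<^esub> \<beta>\<in>carrier \<Gamma>. (\<chi> \<alpha> \<otimes>\<^bsub>R\<^esub> \<chi> \<beta>) \<odot>\<^bsub>A\<^esub> (f \<alpha> \<otimes>\<^bsub>A\<^esub> g \<beta>))"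
    unfolding E by (rule evaluate_convolution) (use fg in auto)
  also have "\<dots> = (\<Oplus>\<^bsub>A\<^esub> \<alpha>\<in>carrier \<Gamma>. (\<chi> \<alpha> \<odot>\<^bsub>A\<^esub> f \<alpha>) \<otimes>\<^bsub>A\<^esub> evaluate g)"
  proof (rule M.finsum_cong'[OF refl])
    fix \<alpha> assume \<alpha>: "\<alpha> \<in> carrier \<Gamma>"
    have "(\<Oplus>\<^bsub>A\<^esub> \<beta>\<in>carrier \<Gamma>. (\<chi> \<alpha> \<otimes>\<^bsub>R\<^esub> \<chi> \<beta>) \<odot>\<^bsub>A\<^esub> (f \<alpha> \<otimes>\<^bsub>A\<^esub> g \<beta>)) =
        (\<Oplus>\<^bsub>A\<^esub> \<beta>\<in>carrier \<Gamma>. (\<chi> \<alpha> \<odot>\<^bsub>A\<^esub> f \<alpha>) \<otimes>\<^bsub>A\<^esub> (\<chi> \<beta> \<odot>\<^bsub>A\<^esub> g \<beta>))"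
      by (rule M.finsum_cong'[OF refl]) (use \<alpha> cl split in auto)
    also have "\<dots> = (\<chi> \<alpha> \<odot>\<^bsub>A\<^esub> f \<alpha>) \<otimes>\<^bsub>A\<^esub> evaluate g"
      unfolding evaluate_def using \<alpha> cl finite_group by (intro finsum_rdistr[symmetric]) auto
    finally show "(\<Oplus>\<^bsub>A\<^esub> \<beta>\<in>carrier \<Gamma>. (\<chi> \<alpha> \<otimes>\<^bsub>R\<^esub> \<chi> \<beta>) \<odot>\<^bsub>A\<^esub> (f \<alpha> \<otimes>\<^bsub>A\<^esub> g \<beta>)) =
        (\<chi> \<alpha> \<odot>\<^bsub>A\<^esub> f \<alpha>) \<otimes>\<^bsub>A\<^esub> evaluate g" .
  qed (use cl evaluate_closed[OF g] in auto)
  also have "\<dots> = evaluate f \<otimes>\<^bsub>A\<^esub> evaluate g"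
    unfolding evaluate_def[of f] using cl finite_group evaluate_closed[OF g]
    by (intro finsum_ldistr[symmetric]) auto
  finally show "evaluate (f \<otimes>\<^bsub>E\<^esub> g) = evaluate f \<otimes>\<^bsub>A\<^esub> evaluate g" .
qed

text \<open>Evaluation is semilinear along the ring homomorphism from the group algebra to \<open>R\<close> that the
  character induces.\<close>

lemma scalar_extension_smult:
  assumes x: "x \<in> finsupp \<Gamma> R" and f: "f \<in> finsupp \<Gamma> A"
  shows "x \<odot>\<^bsub>E\<^esub> f \<in> finsupp \<Gamma> A" and "evaluate (x \<odot>\<^bsub>E\<^esub> f) = evaluate_scalar x \<odot>\<^bsub>A\<^esub> evaluate f"
    and "\<gamma> \<in> carrier \<Gamma> \<Longrightarrow> (x \<odot>\<^bsub>E\<^esub> f) \<gamma> = (\<Oplus>\<^bsub>A\<^esub> \<alpha>\<in>carrier \<Gamma>. x \<alpha> \<odot>\<^bsub>A\<^esub> f (inv\<^bsub>\<Gamma>\<^esub> \<alpha> \<otimes>\<^bsub>\<Gamma>\<^esub> \<gamma>))"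
proof -
  note xf = finsuppD[OF x] finsuppD[OF f]
  have E: "x \<odot>\<^bsub>E\<^esub> f = convolution \<Gamma> R A A (\<odot>\<^bsub>A\<^esub>) x f" by (simp add: scalar_extension_def)
  show "x \<odot>\<^bsub>E\<^esub> f \<in> finsupp \<Gamma> A"
    unfolding E by (rule convolution_finsupp) (use xf in auto)
  have cl: "\<chi> \<gamma> \<otimes>\<^bsub>R\<^esub> x \<gamma> \<in> carrier R" "\<chi> \<gamma> \<odot>\<^bsub>A\<^esub> f \<gamma> \<in> carrier A" if "\<gamma> \<in> carrier \<Gamma>" for \<gamma>
    using xf character_closed[OF that] by auto
  have split: "(\<chi> \<alpha> \<otimes>\<^bsub>R\<^esub> \<chi> \<beta>) \<odot>\<^bsub>A\<^esub> (x \<alpha> \<odot>\<^bsub>A\<^esub> f \<beta>) = (\<chi> \<alpha> \<otimes>\<^bsub>R\<^esub> x \<alpha>) \<odot>\<^bsub>A\<^esub> (\<chi> \<beta> \<odot>\<^bsub>A\<^esub> f \<beta>)"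
    if "\<alpha> \<in> carrier \<Gamma>" "\<beta> \<in> carrier \<Gamma>" for \<alpha> \<beta>
  proof -
    have r: "\<chi> \<alpha> \<in> carrier R" "\<chi> \<beta> \<in> carrier R" "x \<alpha> \<in> carrier R" "f \<beta> \<in> carrier A"
      using that xf character_closed by auto
    then have "(\<chi> \<alpha> \<otimes>\<^bsub>R\<^esub> \<chi> \<beta>) \<otimes>\<^bsub>R\<^esub> x \<alpha> = (\<chi> \<alpha> \<otimes>\<^bsub>R\<^esub> x \<alpha>) \<otimes>\<^bsub>R\<^esub> \<chi> \<beta>" by (simp add: R.m_ac)
    with r show ?thesis by (simp add: smult_assoc1[symmetric])
  qed
  have "evaluate (x \<odot>\<^bsub>E\<^esub> f) =
      (\<Oplus>\<^bsub>A\<^esub> \<alpha>\<in>carrier \<Gamma>. \<Oplus>\<^bsub>A\<^esub> \<beta>\<in>carrier \<Gamma>. (\<chi> \<alpha> \<otimes>\<^bsub>R\<^esub> \<chi> \<beta>) \<odot>\<^bsub>A\<^esub> (x \<alpha> \<odot>\<^bsub>A\<^esub> f \<beta>))"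
    unfolding E by (rule evaluate_convolution) (use xf in auto)
  also have "\<dots> = (\<Oplus>\<^bsub>A\<^esub> \<alpha>\<in>carrier \<Gamma>. (\<chi> \<alpha> \<otimes>\<^bsub>R\<^esub> x \<alpha>) \<odot>\<^bsub>A\<^esub> evaluate f)"
  proof (rule M.finsum_cong'[OF refl])
    fix \<alpha> assume \<alpha>: "\<alpha> \<in> carrier \<Gamma>"
    have "(\<Oplus>\<^bsub>A\<^esub> \<beta>\<in>carrier \<Gamma>. (\<chi> \<alpha> \<otimes>\<^bsub>R\<^esub> \<chi> \<beta>) \<odot>\<^bsub>A\<^esub> (x \<alpha> \<odot>\<^bsub>A\<^esub> f \<beta>)) =
        (\<Oplus>\<^bsub>A\<^esub> \<beta>\<in>carrier \<Gamma>. (\<chi> \<alpha> \<otimes>\<^bsub>R\<^esub> x \<alpha>) \<odot>\<^bsub>A\<^esub> (\<chi> \<beta> \<odot>\<^bsub>A\<^esub> f \<beta>))"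
      by (rule M.finsum_cong'[OF refl]) (use \<alpha> cl split in auto)
    also have "\<dots> = (\<chi> \<alpha> \<otimes>\<^bsub>R\<^esub> x \<alpha>) \<odot>\<^bsub>A\<^esub> evaluate f"
      unfolding evaluate_def using \<alpha> cl finite_group by (intro finsum_smult_ldistr[symmetric]) auto
    finally show "(\<Oplus>\<^bsub>A\<^esub> \<beta>\<in>carrier \<Gamma>. (\<chi> \<alpha> \<otimes>\<^bsub>R\<^esub> \<chi> \<beta>) \<odot>\<^bsub>A\<^esub> (x \<alpha> \<odot>\<^bsub>A\<^esub> f \<beta>)) =
        (\<chi> \<alpha> \<otimes>\<^bsub>R\<^esub> x \<alpha>) \<odot>\<^bsub>A\<^esub> evaluate f" .
  qed (use cl evaluate_closed[OF f] in auto)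
  also have "\<dots> = evaluate_scalar x \<odot>\<^bsub>A\<^esub> evaluate f"
    unfolding evaluate_scalar_def using cl finite_group evaluate_closed[OF f]
    by (intro finsum_smult_rdistr[symmetric]) auto
  finally show "evaluate (x \<odot>\<^bsub>E\<^esub> f) = evaluate_scalar x \<odot>\<^bsub>A\<^esub> evaluate f" .
  assume \<gamma>: "\<gamma> \<in> carrier \<Gamma>"
  have "(x \<odot>\<^bsub>E\<^esub> f) \<gamma> =
      (\<Oplus>\<^bsub>A\<^esub> \<alpha>\<in>carrier \<Gamma>. \<Oplus>\<^bsub>A\<^esub> \<beta>\<in>{\<beta> \<in> carrier \<Gamma>. \<alpha> \<otimes>\<^bsub>\<Gamma>\<^esub> \<beta> = \<gamma>}. x \<alpha> \<odot>\<^bsub>A\<^esub> f \<beta>)"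
    unfolding E by (rule convolution_sum) (use xf in auto)
  also have "\<dots> = (\<Oplus>\<^bsub>A\<^esub> \<alpha>\<in>carrier \<Gamma>. x \<alpha> \<odot>\<^bsub>A\<^esub> f (inv\<^bsub>\<Gamma>\<^esub> \<alpha> \<otimes>\<^bsub>\<Gamma>\<^esub> \<gamma>))"
  proof (rule M.finsum_cong'[OF refl])
    fix \<alpha> assume \<alpha>: "\<alpha> \<in> carrier \<Gamma>"
    have "{\<beta> \<in> carrier \<Gamma>. \<alpha> \<otimes>\<^bsub>\<Gamma>\<^esub> \<beta> = \<gamma>} = {inv\<^bsub>\<Gamma>\<^esub> \<alpha> \<otimes>\<^bsub>\<Gamma>\<^esub> \<gamma>}"
      using \<alpha> \<gamma> \<Gamma>.inv_solve_left by (auto simp: \<Gamma>.m_assoc[symmetric])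
    then show "(\<Oplus>\<^bsub>A\<^esub> \<beta>\<in>{\<beta> \<in> carrier \<Gamma>. \<alpha> \<otimes>\<^bsub>\<Gamma>\<^esub> \<beta> = \<gamma>}. x \<alpha> \<odot>\<^bsub>A\<^esub> f \<beta>) =
        x \<alpha> \<odot>\<^bsub>A\<^esub> f (inv\<^bsub>\<Gamma>\<^esub> \<alpha> \<otimes>\<^bsub>\<Gamma>\<^esub> \<gamma>)"
      using xf by simp
  qed (use xf in auto)
  finally show "(x \<odot>\<^bsub>E\<^esub> f) \<gamma> = (\<Oplus>\<^bsub>A\<^esub> \<alpha>\<in>carrier \<Gamma>. x \<alpha> \<odot>\<^bsub>A\<^esub> f (inv\<^bsub>\<Gamma>\<^esub> \<alpha> \<otimes>\<^bsub>\<Gamma>\<^esub> \<gamma>))" .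
qed

lemma evaluate_ring_hom: "evaluate \<in> ring_hom E A"
proof (rule ring_hom_memI)
  show "evaluate \<one>\<^bsub>E\<^esub> = \<one>\<^bsub>A\<^esub>"
    using evaluate_single[of "\<one>\<^bsub>\<Gamma>\<^esub>" "\<one>\<^bsub>A\<^esub>"] by (simp add: scalar_extension_def character_one)
qed (use evaluate_closed evaluate_add scalar_extension_mult in \<open>auto simp: scalar_extension_def\<close>)

lemma smult_difference:
  assumes z: "z \<in> carrier \<Gamma>" and q: "q \<in> carrier R" and f: "f \<in> finsupp \<Gamma> A" and \<gamma>: "\<gamma> \<in> carrier \<Gamma>"
  shows "((group_elem R z \<ominus>\<^bsub>group_algebra R \<Gamma>\<^esub> q \<odot>\<^bsub>group_algebra R \<Gamma>\<^esub> \<one>\<^bsub>group_algebra R \<Gamma>\<^esub>) \<odot>\<^bsub>E\<^esub> f) \<gamma> =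
    f (inv\<^bsub>\<Gamma>\<^esub> z \<otimes>\<^bsub>\<Gamma>\<^esub> \<gamma>) \<ominus>\<^bsub>A\<^esub> q \<odot>\<^bsub>A\<^esub> f \<gamma>"
proof -
  let ?x = "group_elem R z \<ominus>\<^bsub>group_algebra R \<Gamma>\<^esub> single R \<one>\<^bsub>\<Gamma>\<^esub> q"
  let ?f = "\<lambda>\<alpha>. f (inv\<^bsub>\<Gamma>\<^esub> \<alpha> \<otimes>\<^bsub>\<Gamma>\<^esub> \<gamma>)"
  have s: "group_elem R z \<in> finsupp \<Gamma> R" "single R \<one>\<^bsub>\<Gamma>\<^esub> q \<in> finsupp \<Gamma> R"
    using z q R.ring_axioms by auto
  note fc = finsuppD(1)[OF f]
  have x: "?x \<alpha> \<odot>\<^bsub>A\<^esub> a = (if z = \<alpha> then a else \<zero>\<^bsub>A\<^esub>) \<oplus>\<^bsub>A\<^esub> (if \<one>\<^bsub>\<Gamma>\<^esub> = \<alpha> then \<ominus>\<^bsub>A\<^esub> (q \<odot>\<^bsub>A\<^esub> a) else \<zero>\<^bsub>A\<^esub>)"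
    if "a \<in> carrier A" for \<alpha> a
    using that q unfolding R.group_algebra_minus(1)[OF s]
    by (auto simp: single_def a_minus_def smult_l_distr smult_l_minus)
  have "(?x \<odot>\<^bsub>E\<^esub> f) \<gamma> = (\<Oplus>\<^bsub>A\<^esub> \<alpha>\<in>carrier \<Gamma>. ?x \<alpha> \<odot>\<^bsub>A\<^esub> ?f \<alpha>)"
    by (rule scalar_extension_smult(3)[OF R.group_algebra_minus(2)[OF s] f \<gamma>])
  also have "\<dots> = (\<Oplus>\<^bsub>A\<^esub> \<alpha>\<in>carrier \<Gamma>. (if z = \<alpha> then ?f \<alpha> else \<zero>\<^bsub>A\<^esub>) \<oplus>\<^bsub>A\<^esub>
      (if \<one>\<^bsub>\<Gamma>\<^esub> = \<alpha> then \<ominus>\<^bsub>A\<^esub> (q \<odot>\<^bsub>A\<^esub> ?f \<alpha>) else \<zero>\<^bsub>A\<^esub>))"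
    using x[OF fc] by simp
  also have "\<dots> = (\<Oplus>\<^bsub>A\<^esub> \<alpha>\<in>carrier \<Gamma>. (if z = \<alpha> then ?f \<alpha> else \<zero>\<^bsub>A\<^esub>)) \<oplus>\<^bsub>A\<^esub>
      (\<Oplus>\<^bsub>A\<^esub> \<alpha>\<in>carrier \<Gamma>. (if \<one>\<^bsub>\<Gamma>\<^esub> = \<alpha> then \<ominus>\<^bsub>A\<^esub> (q \<odot>\<^bsub>A\<^esub> ?f \<alpha>) else \<zero>\<^bsub>A\<^esub>))"
    using fc q by (intro M.finsum_addf finite_group) auto
  also have "(\<Oplus>\<^bsub>A\<^esub> \<alpha>\<in>carrier \<Gamma>. (if z = \<alpha> then ?f \<alpha> else \<zero>\<^bsub>A\<^esub>)) = ?f z"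
    using fc z finite_group by (intro M.add.finprod_singleton) auto
  also have "(\<Oplus>\<^bsub>A\<^esub> \<alpha>\<in>carrier \<Gamma>. (if \<one>\<^bsub>\<Gamma>\<^esub> = \<alpha> then \<ominus>\<^bsub>A\<^esub> (q \<odot>\<^bsub>A\<^esub> ?f \<alpha>) else \<zero>\<^bsub>A\<^esub>)) =
      \<ominus>\<^bsub>A\<^esub> (q \<odot>\<^bsub>A\<^esub> ?f \<one>\<^bsub>\<Gamma>\<^esub>)"
    using fc q finite_group by (intro M.add.finprod_singleton) auto
  finally show ?thesis
    using \<gamma> q by (simp add: R.group_algebra_smult_one a_minus_def)
qed

text \<open>One half of the description of the kernel: by semilinearity \<open>z - \<chi>(z)\<close> acts after evaluation as
  \<open>\<chi>(z) - \<chi>(z) = 0\<close>.\<close>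

lemma evaluate_difference:
  assumes z: "z \<in> carrier \<Gamma>" and f: "f \<in> finsupp \<Gamma> A"
  shows "evaluate ((group_elem R z \<ominus>\<^bsub>group_algebra R \<Gamma>\<^esub>
      \<chi> z \<odot>\<^bsub>group_algebra R \<Gamma>\<^esub> \<one>\<^bsub>group_algebra R \<Gamma>\<^esub>) \<odot>\<^bsub>E\<^esub> f) = \<zero>\<^bsub>A\<^esub>"
    and "(group_elem R z \<ominus>\<^bsub>group_algebra R \<Gamma>\<^esub>
      \<chi> z \<odot>\<^bsub>group_algebra R \<Gamma>\<^esub> \<one>\<^bsub>group_algebra R \<Gamma>\<^esub>) \<odot>\<^bsub>E\<^esub> f \<in> finsupp \<Gamma> A"
proof -
  let ?q = "single R \<one>\<^bsub>\<Gamma>\<^esub> (\<chi> z)" and ?x = "group_elem R z \<ominus>\<^bsub>group_algebra R \<Gamma>\<^esub> single R \<one>\<^bsub>\<Gamma>\<^esub> (\<chi> z)"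
  have q: "\<chi> z \<in> carrier R" by (rule character_closed[OF z])
  have s: "group_elem R z \<in> finsupp \<Gamma> R" "?q \<in> finsupp \<Gamma> R"
    using z q R.ring_axioms by auto
  note x = R.group_algebra_minus[OF s]
  have cl: "\<chi> \<gamma> \<otimes>\<^bsub>R\<^esub> group_elem R z \<gamma> \<in> carrier R" "\<chi> \<gamma> \<otimes>\<^bsub>R\<^esub> ?q \<gamma> \<in> carrier R"
    "\<chi> \<gamma> \<otimes>\<^bsub>R\<^esub> ?x \<gamma> \<in> carrier R" if "\<gamma> \<in> carrier \<Gamma>" for \<gamma>
    using character_closed[OF that] finsuppD(1)[OF s(1)] finsuppD(1)[OF s(2)] finsuppD(1)[OF x(2)] by auto
  have "evaluate_scalar ?x \<oplus>\<^bsub>R\<^esub> evaluate_scalar ?q =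
      (\<Oplus>\<^bsub>R\<^esub> \<gamma>\<in>carrier \<Gamma>. \<chi> \<gamma> \<otimes>\<^bsub>R\<^esub> ?x \<gamma> \<oplus>\<^bsub>R\<^esub> \<chi> \<gamma> \<otimes>\<^bsub>R\<^esub> ?q \<gamma>)"
    unfolding evaluate_scalar_def using cl finite_group by (intro R.finsum_addf[symmetric]) auto
  also have "\<dots> = evaluate_scalar (group_elem R z)"
    unfolding evaluate_scalar_def
  proof (rule R.finsum_cong'[OF refl])
    fix \<gamma> assume "\<gamma> \<in> carrier \<Gamma>"
    then show "\<chi> \<gamma> \<otimes>\<^bsub>R\<^esub> ?x \<gamma> \<oplus>\<^bsub>R\<^esub> \<chi> \<gamma> \<otimes>\<^bsub>R\<^esub> ?q \<gamma> = \<chi> \<gamma> \<otimes>\<^bsub>R\<^esub> group_elem R z \<gamma>"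
      unfolding x(1) using character_closed finsuppD(1)[OF s(1)] finsuppD(1)[OF s(2)]
      by (simp add: a_minus_def R.r_distr[symmetric] R.a_assoc R.l_neg)
  qed (use cl in auto)
  finally have "evaluate_scalar ?x \<oplus>\<^bsub>R\<^esub> \<chi> z = \<chi> z"
    using z q by (simp add: evaluate_scalar_single character_one)
  moreover have "evaluate_scalar ?x \<in> carrier R"
    unfolding evaluate_scalar_def using cl by (auto intro!: R.finsum_closed)
  ultimately have "evaluate_scalar ?x = \<zero>\<^bsub>R\<^esub>" using q by (metis R.add.r_cancel_one)
  then show "evaluate ((group_elem R z \<ominus>\<^bsub>group_algebra R \<Gamma>\<^esub>
      \<chi> z \<odot>\<^bsub>group_algebra R \<Gamma>\<^esub> \<one>\<^bsub>group_algebra R \<Gamma>\<^esub>) \<odot>\<^bsub>E\<^esub> f) = \<zero>\<^bsub>A\<^esub>"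
    using scalar_extension_smult(2)[OF x(2) f] evaluate_closed[OF f] q
    by (simp add: R.group_algebra_smult_one)
  show "(group_elem R z \<ominus>\<^bsub>group_algebra R \<Gamma>\<^esub>
      \<chi> z \<odot>\<^bsub>group_algebra R \<Gamma>\<^esub> \<one>\<^bsub>group_algebra R \<Gamma>\<^esub>) \<odot>\<^bsub>E\<^esub> f \<in> finsupp \<Gamma> A"
    using scalar_extension_smult(1)[OF x(2) f] q by (simp add: R.group_algebra_smult_one)
qed

end

section \<open>Specialisations of cocycle extensions\<close>

lemma (in assoc_algebra) character_evaluation_cyclic:
  assumes m: "m > 0" and q: "q \<in> carrier R" "q [^]\<^bsub>R\<^esub> m = \<one>\<^bsub>R\<^esub>"
  shows "character_evaluation R A (integer_mod_group m) (\<lambda>\<gamma>. q [^]\<^bsub>R\<^esub> nat \<gamma>)"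
proof -
  interpret \<Gamma>: group "integer_mod_group m" by simp
  have red: "q [^]\<^bsub>R\<^esub> (k mod m) = q [^]\<^bsub>R\<^esub> k" for k
  proof -
    have "q [^]\<^bsub>R\<^esub> k = q [^]\<^bsub>R\<^esub> (m * (k div m) + k mod m)" by simp
    also have "\<dots> = q [^]\<^bsub>R\<^esub> (k mod m)"
      using q by (simp only: R.nat_pow_mult[symmetric] R.nat_pow_pow[symmetric] R.nat_pow_one R.nat_pow_closed R.l_one)
    finally show ?thesis ..
  qed
  show ?thesis
  proof
    fix \<gamma> \<delta> assume *: "\<gamma> \<in> carrier (integer_mod_group m)" "\<delta> \<in> carrier (integer_mod_group m)"
    then have "nat ((\<gamma> + \<delta>) mod int m) = (nat \<gamma> + nat \<delta>) mod m"
      using m by (simp add: carrier_integer_mod_group nat_mod_distrib nat_add_distrib)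
    then show "q [^]\<^bsub>R\<^esub> nat (\<gamma> \<otimes>\<^bsub>integer_mod_group m\<^esub> \<delta>) = q [^]\<^bsub>R\<^esub> nat \<gamma> \<otimes>\<^bsub>R\<^esub> q [^]\<^bsub>R\<^esub> nat \<delta>"
      using q by (simp add: red R.nat_pow_mult)
  next
    show "q [^]\<^bsub>R\<^esub> nat \<gamma> \<in> carrier R" for \<gamma> by (rule R.nat_pow_closed[OF q(1)])
  qed (use m in \<open>auto simp: carrier_integer_mod_group\<close>)
qed

text \<open>The other half: division by \<open>z - q\<close> by Horner's scheme. The equation \<open>(z - q) b = f\<close> means
  \<open>b(i - 1) - q b(i) = f(i)\<close> with indices modulo \<open>m\<close>. Since \<open>q\<close> is invertible with inverse \<open>q\<^bsup>m-1\<^esup>\<close>, it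
  determines all values of \<open>b\<close> successively from \<open>b(-1)\<close>, and starting with \<open>b(-1) = 0\<close> the
  recursion closes up, \<open>b(m - 1) = 0\<close>, exactly because \<open>f\<close> evaluates to \<open>0\<close>.\<close>

lemma (in assoc_algebra) kernel_evaluation_cyclic:
  assumes m: "m > 0" and q: "q \<in> carrier R" "q [^]\<^bsub>R\<^esub> m = \<one>\<^bsub>R\<^esub>"
    and f: "f \<in> finsupp (integer_mod_group m) A"
    and ker: "(\<Oplus>\<^bsub>A\<^esub> \<gamma>\<in>carrier (integer_mod_group m). q [^]\<^bsub>R\<^esub> nat \<gamma> \<odot>\<^bsub>A\<^esub> f \<gamma>) = \<zero>\<^bsub>A\<^esub>"
  obtains b where "b \<in> finsupp (integer_mod_group m) A"
    and "f = (group_elem R (1 mod int m) \<ominus>\<^bsub>group_algebra R (integer_mod_group m)\<^esub>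
      q \<odot>\<^bsub>group_algebra R (integer_mod_group m)\<^esub> \<one>\<^bsub>group_algebra R (integer_mod_group m)\<^esub>)
      \<odot>\<^bsub>scalar_extension R (integer_mod_group m) A\<^esub> b"
proof -
  let ?\<Gamma> = "integer_mod_group m" and ?z = "1 mod int m"
  interpret character_evaluation R A ?\<Gamma> "\<lambda>\<gamma>. q [^]\<^bsub>R\<^esub> nat \<gamma>"
    by (rule character_evaluation_cyclic[OF m q])
  have C: "carrier ?\<Gamma> = {0..<int m}" using m by (simp add: carrier_integer_mod_group)
  have z: "?z \<in> carrier ?\<Gamma>" using m by (simp add: C)
  note fc = finsuppD(1)[OF f]
  \<comment> \<open>\<open>B i\<close> is \<open>b(i - 1)\<close>, so that the recursion starts at \<open>B 0 = b(-1)\<close>.\<close>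
  define B where "B = rec_nat \<zero>\<^bsub>A\<^esub> (\<lambda>n u. q [^]\<^bsub>R\<^esub> (m - 1) \<odot>\<^bsub>A\<^esub> (u \<ominus>\<^bsub>A\<^esub> f (int n)))"
  have B0: "B 0 = \<zero>\<^bsub>A\<^esub>" and BS: "B (Suc n) = q [^]\<^bsub>R\<^esub> (m - 1) \<odot>\<^bsub>A\<^esub> (B n \<ominus>\<^bsub>A\<^esub> f (int n))" for n
    by (simp_all add: B_def)
  have Bc: "B n \<in> carrier A" for n
    by (induction n) (use fc q in \<open>auto simp: B0 BS\<close>)
  have qm: "q \<otimes>\<^bsub>R\<^esub> q [^]\<^bsub>R\<^esub> (m - 1) = \<one>\<^bsub>R\<^esub>"
  proof -
    have "q \<otimes>\<^bsub>R\<^esub> q [^]\<^bsub>R\<^esub> (m - 1) = q [^]\<^bsub>R\<^esub> Suc (m - 1)" using q by (simp add: R.nat_pow_Suc R.m_comm)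
    then show ?thesis using m q by simp
  qed
  have step: "q \<odot>\<^bsub>A\<^esub> B (Suc n) = B n \<ominus>\<^bsub>A\<^esub> f (int n)" for n
    using q fc Bc by (simp add: BS smult_assoc1[symmetric] qm del: One_nat_def)
  have sum: "q [^]\<^bsub>R\<^esub> n \<odot>\<^bsub>A\<^esub> B n = \<ominus>\<^bsub>A\<^esub> (\<Oplus>\<^bsub>A\<^esub> i\<in>{..<n}. q [^]\<^bsub>R\<^esub> i \<odot>\<^bsub>A\<^esub> f (int i))" for n
  proof (induction n)
    case (Suc n)
    have t: "q [^]\<^bsub>R\<^esub> i \<odot>\<^bsub>A\<^esub> f (int i) \<in> carrier A" for i using q fc by auto
    have "q [^]\<^bsub>R\<^esub> Suc n \<odot>\<^bsub>A\<^esub> B (Suc n) = q [^]\<^bsub>R\<^esub> n \<odot>\<^bsub>A\<^esub> (q \<odot>\<^bsub>A\<^esub> B (Suc n))"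
      using q Bc by (simp add: smult_assoc1)
    also have "\<dots> = \<ominus>\<^bsub>A\<^esub> (\<Oplus>\<^bsub>A\<^esub> i\<in>{..<n}. q [^]\<^bsub>R\<^esub> i \<odot>\<^bsub>A\<^esub> f (int i)) \<oplus>\<^bsub>A\<^esub> \<ominus>\<^bsub>A\<^esub> (q [^]\<^bsub>R\<^esub> n \<odot>\<^bsub>A\<^esub> f (int n))"
      using q fc Bc by (simp add: step a_minus_def smult_r_distr smult_r_minus Suc.IH)
    also have "\<dots> = \<ominus>\<^bsub>A\<^esub> (\<Oplus>\<^bsub>A\<^esub> i\<in>{..<Suc n}. q [^]\<^bsub>R\<^esub> i \<odot>\<^bsub>A\<^esub> f (int i))"
      using t by (simp add: lessThan_Suc M.minus_add M.a_comm Pi_def)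
    finally show ?case .
  qed (use q in \<open>simp add: B0\<close>)
  have Bm: "B m = \<zero>\<^bsub>A\<^esub>"
  proof -
    have "inj_on int {..<m}" by simp
    moreover have "int ` {..<m} = {0..<int m}"
      using image_int_atLeastLessThan[of 0 m] by (simp add: lessThan_atLeast0)
    moreover have "(\<lambda>\<gamma>. q [^]\<^bsub>R\<^esub> nat \<gamma> \<odot>\<^bsub>A\<^esub> f \<gamma>) \<in> {0..<int m} \<rightarrow> carrier A"
      using R.nat_pow_closed[OF q(1)] fc by auto
    ultimately have "(\<Oplus>\<^bsub>A\<^esub> i\<in>{..<m}. q [^]\<^bsub>R\<^esub> i \<odot>\<^bsub>A\<^esub> f (int i)) = \<zero>\<^bsub>A\<^esub>"
      using M.finsum_reindex[of "\<lambda>\<gamma>. q [^]\<^bsub>R\<^esub> nat \<gamma> \<odot>\<^bsub>A\<^esub> f \<gamma>" int "{..<m}"] ker by (simp add: C)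
    then show ?thesis using sum[of m] q Bc by simp
  qed
  define b where "b = (\<lambda>\<gamma>. if \<gamma> \<in> carrier ?\<Gamma> then B (Suc (nat \<gamma>)) else \<zero>\<^bsub>A\<^esub>)"
  have b: "b \<in> finsupp ?\<Gamma> A"
  proof -
    have "supp A b \<subseteq> carrier ?\<Gamma>" by (auto simp: supp_def b_def)
    then show ?thesis using finite_group Bc by (auto simp: finsupp_def b_def intro: finite_subset)
  qed
  let ?x = "group_elem R ?z \<ominus>\<^bsub>group_algebra R ?\<Gamma>\<^esub> q \<odot>\<^bsub>group_algebra R ?\<Gamma>\<^esub> \<one>\<^bsub>group_algebra R ?\<Gamma>\<^esub>"
  have "q [^]\<^bsub>R\<^esub> nat ?z = q"
    \<comment> \<open>For \<open>m = 1\<close> the generator is \<open>0\<close>, and then \<open>q = 1\<close>.\<close>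
    using m q by (cases "m = 1") auto
  then have xb: "?x \<odot>\<^bsub>E\<^esub> b \<in> finsupp ?\<Gamma> A" using evaluate_difference(2)[OF z b] by simp
  have "(?x \<odot>\<^bsub>E\<^esub> b) \<gamma> = f \<gamma>" for \<gamma>
  proof (cases "\<gamma> \<in> carrier ?\<Gamma>")
    case True
    have "b (inv\<^bsub>?\<Gamma>\<^esub> ?z \<otimes>\<^bsub>?\<Gamma>\<^esub> \<gamma>) = B (nat \<gamma>)"
    proof -
      have shift: "inv\<^bsub>?\<Gamma>\<^esub> ?z \<otimes>\<^bsub>?\<Gamma>\<^esub> \<gamma> = (\<gamma> - 1) mod int m"
        using z by (simp add: mod_simps)
      show ?thesis
      proof (cases "\<gamma> = 0")
        case True
        then show ?thesis unfolding shift using m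
          by (simp add: b_def C B0 Bm zmod_minus1 nat_diff_distrib)
      next
        case False
        then have "(\<gamma> - 1) mod int m = \<gamma> - 1" "Suc (nat (\<gamma> - 1)) = nat \<gamma>" using True by (auto simp: C)
        then show ?thesis unfolding shift using True False by (simp add: b_def C)
      qed
    qed
    then have "(?x \<odot>\<^bsub>E\<^esub> b) \<gamma> = B (nat \<gamma>) \<ominus>\<^bsub>A\<^esub> (B (nat \<gamma>) \<ominus>\<^bsub>A\<^esub> f \<gamma>)"
      using smult_difference[OF z q(1) b True] True step[of "nat \<gamma>"] by (simp add: b_def C)
    then show ?thesis
      using Bc fc by (simp add: a_minus_def M.minus_add M.a_assoc[symmetric] M.r_neg)
  next
    case False
    then show ?thesis using finsupp_outside[OF xb] finsupp_outside[OF f] by simp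
  qed
  then have "f = ?x \<odot>\<^bsub>E\<^esub> b" by auto
  with b show ?thesis by (rule that)
qed

lemma (in graded_algebra) finsum_homogeneous:
  assumes "finite S" "g \<in> carrier G" "f \<in> S \<rightarrow> \<A> g"
  shows "(\<Oplus>\<^bsub>A\<^esub> i\<in>S. f i) \<in> \<A> g"
  using assms(1,3)
proof (induction S rule: finite_induct)
  case (insert i S)
  then have "f \<in> insert i S \<rightarrow> carrier A" using component_sub[OF assms(2)] by auto
  with insert show ?case
    using submoduleE(5)[OF component_submodule[OF assms(2)]] by (simp add: Pi_def)
qed (use assms component_zero in auto)

text \<open>Evaluation at \<open>q\<close> is a homomorphism from the cocycle extension to the twist by \<open>q\<^bsup>\<mu>\<^esup>\<close>, onto because it
  retracts \<open>a \<mapsto> 1 \<otimes> a\<close>, and its kernel is the specialisation ideal. The isomorphism sends \<open>a\<close> to its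
  fibre.\<close>

theorem (in graded_algebra) specialisation_cocycle_extension:
  assumes m: "m > 0" and q: "q \<in> carrier R" "q [^]\<^bsub>R\<^esub> m = \<one>\<^bsub>R\<^esub>"
    and \<mu>: "\<And>g h. g \<in> carrier G \<Longrightarrow> h \<in> carrier G \<Longrightarrow> \<mu> g h \<in> carrier (integer_mod_group m)"
  shows "algebra_isomorphic R (twist G A \<A> (\<lambda>g h. q [^]\<^bsub>R\<^esub> nat (\<mu> g h)))
    (specialisation R (integer_mod_group m) (cocycle_extension G R (integer_mod_group m) A \<A> \<mu>) (1 mod int m) q)"
proof -
  let ?\<Gamma> = "integer_mod_group m" and ?z = "1 mod int m"
  interpret character_evaluation R A ?\<Gamma> "\<lambda>\<gamma>. q [^]\<^bsub>R\<^esub> nat \<gamma>"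
    by (rule character_evaluation_cyclic[OF m q])
  let ?T = "twist G A \<A> (\<lambda>g h. q [^]\<^bsub>R\<^esub> nat (\<mu> g h))"
  let ?B = "cocycle_extension G R ?\<Gamma> A \<A> \<mu>"
  let ?x = "group_elem R ?z \<ominus>\<^bsub>group_algebra R ?\<Gamma>\<^esub> q \<odot>\<^bsub>group_algebra R ?\<Gamma>\<^esub> \<one>\<^bsub>group_algebra R ?\<Gamma>\<^esub>"
  let ?F = "\<lambda>a. {b \<in> carrier ?B. evaluate b = a}" and ?I = "a_kernel ?B ?T evaluate"
  have z: "?z \<in> carrier ?\<Gamma>" using m by (simp add: carrier_integer_mod_group)
  have zq: "q [^]\<^bsub>R\<^esub> nat ?z = q" using m q by (cases "m = 1") auto
  have E: "carrier E = finsupp ?\<Gamma> A" "\<one>\<^bsub>E\<^esub> = single A \<one>\<^bsub>?\<Gamma>\<^esub> \<one>\<^bsub>A\<^esub>" by (auto simp: scalar_extension_def)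
  have BE: "carrier ?B = carrier E" "\<one>\<^bsub>?B\<^esub> = \<one>\<^bsub>E\<^esub>" "\<And>x b. x \<odot>\<^bsub>?B\<^esub> b = x \<odot>\<^bsub>E\<^esub> b"
    by (simp_all add: cocycle_extension_def)
  have ge: "group_elem R (\<mu> g h) \<in> finsupp ?\<Gamma> R" if "g \<in> carrier G" "h \<in> carrier G" for g h
    using \<mu>[OF that] R.ring_axioms by simp
  have smult_group_elem: "group_elem R (\<mu> g h) \<odot>\<^bsub>E\<^esub> f \<in> carrier E"
      "evaluate (group_elem R (\<mu> g h) \<odot>\<^bsub>E\<^esub> f) = q [^]\<^bsub>R\<^esub> nat (\<mu> g h) \<odot>\<^bsub>A\<^esub> evaluate f"
    if "g \<in> carrier G" "h \<in> carrier G" "f \<in> carrier E" for g h f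
    using scalar_extension_smult(1,2)[OF ge[OF that(1,2)] that(3)[unfolded E]]
      evaluate_scalar_single[OF \<mu>[OF that(1,2)] R.one_closed] q
    by (simp_all add: E)
  have degree: "evaluate f \<in> \<A> g" if g: "g \<in> carrier G" and f: "f \<in> extended_grading ?\<Gamma> A \<A> g" for g f
    unfolding evaluate_def
  proof (intro finsum_homogeneous finite_group g Pi_I)
    fix \<gamma>
    have "f \<gamma> \<in> \<A> g" using f by (simp add: extended_grading_def)
    then show "q [^]\<^bsub>R\<^esub> nat \<gamma> \<odot>\<^bsub>A\<^esub> f \<gamma> \<in> \<A> g"
      using R.nat_pow_closed[OF q(1)] by (intro submodule.smult_closed[OF component_submodule[OF g]])
  qed
  have grading: "extended_grading ?\<Gamma> A \<A> g \<subseteq> carrier E" for g by (auto simp: E extended_grading_def)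
  have mult: "x \<otimes>\<^bsub>E\<^esub> y \<in> carrier E" if "x \<in> carrier E" "y \<in> carrier E" for x y
    using that scalar_extension_mult(1) by (simp add: E)
  have decomposition: "\<exists>!c. is_decomposition G E (extended_grading ?\<Gamma> A \<A>) f c" if "f \<in> carrier E" for f
    using that scalar_extension_direct_sum by (simp add: E)
  note natural = twist_natural[where E = E and \<E> = "extended_grading ?\<Gamma> A \<A>" and \<phi> = evaluate
      and \<rho> = "\<lambda>g h. group_elem R (\<mu> g h)" and \<tau> = "\<lambda>g h. q [^]\<^bsub>R\<^esub> nat (\<mu> g h)"]
  note hypotheses = scalar_extension_abelian_group decomposition mult smult_group_elem
    evaluate_ring_hom degree
  note powers = R.nat_pow_closed[OF q(1)]
  have closed: "x \<otimes>\<^bsub>?B\<^esub> y \<in> carrier E" if "x \<in> carrier E" "y \<in> carrier E" for x y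
    unfolding cocycle_extension_def by (rule natural(1); (fact hypotheses that | rule grading powers))
  have hom: "evaluate \<in> ring_hom ?B ?T"
    unfolding cocycle_extension_def by (rule natural(2); (fact hypotheses | rule grading powers))
  have kernel: "?I = {b \<in> finsupp ?\<Gamma> A. evaluate b = \<zero>\<^bsub>A\<^esub>}"
    by (simp add: a_kernel_def kernel_def BE E)
  have "specialisation_ideal R ?\<Gamma> ?B ?z q = (\<lambda>b. ?x \<odot>\<^bsub>E\<^esub> b) ` finsupp ?\<Gamma> A"
    by (simp add: specialisation_ideal_def BE E)
  also have "\<dots> = ?I"
  proof (intro equalityI subsetI)
    fix f assume "f \<in> (\<lambda>b. ?x \<odot>\<^bsub>E\<^esub> b) ` finsupp ?\<Gamma> A"
    then show "f \<in> ?I" unfolding kernel using evaluate_difference[OF z] zq by auto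
  next
    fix f assume "f \<in> ?I"
    then have "f \<in> finsupp ?\<Gamma> A" "evaluate f = \<zero>\<^bsub>A\<^esub>" unfolding kernel by auto
    then obtain b where "b \<in> finsupp ?\<Gamma> A" "f = ?x \<odot>\<^bsub>E\<^esub> b"
      by (rule kernel_evaluation_cyclic[OF m q, unfolded evaluate_def[symmetric]])
    then show "f \<in> (\<lambda>b. ?x \<odot>\<^bsub>E\<^esub> b) ` finsupp ?\<Gamma> A" by blast
  qed
  finally have I: "specialisation_ideal R ?\<Gamma> ?B ?z q = ?I" .
  have lift: "\<exists>b \<in> finsupp ?\<Gamma> A. evaluate b = a" if "a \<in> carrier A" for a
    using that evaluate_single[OF \<Gamma>.one_closed that] ring_axioms
    by (intro bexI[of _ "single A \<one>\<^bsub>?\<Gamma>\<^esub> a"]) auto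
  have groups: "abelian_group ?B" "abelian_group ?T"
    unfolding cocycle_extension_def
    by (intro twist_abelian_group scalar_extension_abelian_group M.abelian_group_axioms)+
  have iso: "?F \<in> ring_iso ?T (?B Quot ?I)"
  proof (rule fibre_map_ring_iso[OF groups hom])
    have "evaluate ` finsupp ?\<Gamma> A = carrier A"
      using lift evaluate_closed by (intro equalityI subsetI) blast+
    then show "evaluate ` carrier ?B = carrier ?T" by (simp add: BE E)
    show "\<one>\<^bsub>?B\<^esub> \<in> carrier ?B" unfolding BE E
      using ring_axioms \<Gamma>.one_closed one_closed by (rule single_finsupp)
    show "x \<otimes>\<^bsub>?B\<^esub> y \<in> carrier ?B" if "x \<in> carrier ?B" "y \<in> carrier ?B" for x y
      using that unfolding BE(1) by (rule closed)
  qed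
  have smult: "?F (r \<odot>\<^bsub>A\<^esub> a) =
      (\<Union>b\<in>?F a. ?I +>\<^bsub>?B\<^esub> ((r \<odot>\<^bsub>group_algebra R ?\<Gamma>\<^esub> \<one>\<^bsub>group_algebra R ?\<Gamma>\<^esub>) \<odot>\<^bsub>?B\<^esub> b))"
    if r: "r \<in> carrier R" and a: "a \<in> carrier A" for r a
  proof -
    have s: "single R \<one>\<^bsub>?\<Gamma>\<^esub> r \<in> finsupp ?\<Gamma> R" using r R.ring_axioms by simp
    have "?I +>\<^bsub>?B\<^esub> ((r \<odot>\<^bsub>group_algebra R ?\<Gamma>\<^esub> \<one>\<^bsub>group_algebra R ?\<Gamma>\<^esub>) \<odot>\<^bsub>?B\<^esub> b) = ?F (r \<odot>\<^bsub>A\<^esub> a)"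
      if "b \<in> ?F a" for b
    proof -
      have b: "b \<in> finsupp ?\<Gamma> A" "evaluate b = a" using that by (auto simp: BE E)
      have "single R \<one>\<^bsub>?\<Gamma>\<^esub> r \<odot>\<^bsub>?B\<^esub> b \<in> carrier ?B" "evaluate (single R \<one>\<^bsub>?\<Gamma>\<^esub> r \<odot>\<^bsub>?B\<^esub> b) = r \<odot>\<^bsub>A\<^esub> a"
        using scalar_extension_smult(1,2)[OF s b(1)] evaluate_scalar_single[OF \<Gamma>.one_closed r] r b(2)
        by (simp_all add: BE E)
      then show ?thesis
        using kernel_coset_eq_fibre[OF groups hom] r by (simp add: R.group_algebra_smult_one)
    qed
    moreover have "?F a \<noteq> {}" using lift[OF a] by (auto simp: BE E)
    ultimately show ?thesis by auto
  qed
  have "?F \<in> algebra_iso R ?T (specialisation R ?\<Gamma> ?B ?z q)"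
    using iso smult by (simp add: algebra_iso_def specialisation_def Let_def I ring_iso_def ring_hom_def)
  then show ?thesis unfolding algebra_isomorphic_def by blast
qed

lemma complex_ring_simps [simp]:
  "carrier complex_ring = UNIV" "x \<otimes>\<^bsub>complex_ring\<^esub> y = x * y" "\<one>\<^bsub>complex_ring\<^esub> = 1"
  by (simp_all add: ring_of_type_algebra_def)

lemma complex_ring_pow [simp]: "x [^]\<^bsub>complex_ring\<^esub> (n::nat) = x ^ n"
  by (induction n) (simp_all add: nat_pow_def mult.commute)

lemma algebra_isomorphic_trans:
  assumes "algebra_isomorphic R A B" "algebra_isomorphic R B C"
  shows "algebra_isomorphic R A C"
proof -
  obtain \<phi> \<psi> where *: "\<phi> \<in> algebra_iso R A B" "\<psi> \<in> algebra_iso R B C"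
    using assms by (auto simp: algebra_isomorphic_def)
  then have "\<psi> \<circ> \<phi> \<in> algebra_iso R A C"
    using ring_iso_set_trans[of \<phi> A B \<psi> C] ring_iso_memE(1)[of \<phi> A B]
    by (auto simp: algebra_iso_def)
  then show ?thesis by (auto simp: algebra_isomorphic_def)
qed

lemma complex_nth_root_exists:
  assumes "n > 0"
  shows "\<exists>c::complex. c ^ n = w"
proof
  show "rcis (root n (cmod w)) (Arg w / n) ^ n = w"
    using assms by (simp add: DeMoivre2 rcis_cmod_Arg)
qed

text \<open>The product of the cocycle identities over all third arguments \<open>k\<close> exhibits \<open>\<nu>\<^sup>n\<close> for
  \<open>n = |G|\<close> as the coboundary of \<open>P(g) = \<Prod>\<^sub>k \<nu>(g, k)\<close>, because \<open>k \<mapsto> hk\<close> permutes \<open>G\<close>. An \<open>n\<close>th root of \<open>P\<close> then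
  corrects \<open>\<nu>\<close> to have values in the roots of unity.\<close>

lemma cocycle_cohomologous_roots_of_unity:
  fixes G :: "('g, 'x) monoid_scheme" and \<nu> :: "'g \<Rightarrow> 'g \<Rightarrow> complex"
  assumes "group G" and fin: "finite (carrier G)"
    and \<nu>: "\<nu> \<in> normalised_cocycles G (units_of complex_ring)"
  obtains c where "\<And>g. c g \<noteq> 0" "c \<one>\<^bsub>G\<^esub> = 1"
    and "\<And>g h. g \<in> carrier G \<Longrightarrow> h \<in> carrier G \<Longrightarrow>
      (\<nu> g h * c (g \<otimes>\<^bsub>G\<^esub> h) / (c g * c h)) ^ card (carrier G) = 1"
proof -
  interpret G: group G by fact
  let ?n = "card (carrier G)"
  have n: "?n > 0" using fin G.one_closed by (auto simp: card_gt_0_iff)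
  have nz: "\<nu> g h \<noteq> 0" if "g \<in> carrier G" "h \<in> carrier G" for g h
    using \<nu> that by (force simp: normalised_cocycles_def units_of_def Units_def)
  have cocycle: "\<nu> g h * \<nu> (g \<otimes>\<^bsub>G\<^esub> h) k = \<nu> g (h \<otimes>\<^bsub>G\<^esub> k) * \<nu> h k"
    if "g \<in> carrier G" "h \<in> carrier G" "k \<in> carrier G" for g h k
    using \<nu> that by (simp add: normalised_cocycles_def units_of_def)
  define P where "P g = (\<Prod>k\<in>carrier G. \<nu> g k)" for g
  have Pnz: "P g \<noteq> 0" if "g \<in> carrier G" for g
    using that nz fin by (simp add: P_def)
  have P1: "P \<one>\<^bsub>G\<^esub> = 1"
    using \<nu> by (simp add: P_def normalised_cocycles_def units_of_def)
  have P: "\<nu> g h ^ ?n * P (g \<otimes>\<^bsub>G\<^esub> h) = P g * P h" if gh: "g \<in> carrier G" "h \<in> carrier G" for g h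
  proof -
    have "\<nu> g h ^ ?n * P (g \<otimes>\<^bsub>G\<^esub> h) = (\<Prod>k\<in>carrier G. \<nu> g (h \<otimes>\<^bsub>G\<^esub> k) * \<nu> h k)"
      using gh by (simp add: P_def prod.distrib[symmetric] cocycle flip: prod_constant)
    also have "\<dots> = (\<Prod>k\<in>carrier G. \<nu> g (h \<otimes>\<^bsub>G\<^esub> k)) * P h"
      by (simp add: P_def prod.distrib)
    also have "(\<Prod>k\<in>carrier G. \<nu> g (h \<otimes>\<^bsub>G\<^esub> k)) = P g"
      unfolding P_def
      by (rule prod.reindex_bij_witness[where j = "\<lambda>k. h \<otimes>\<^bsub>G\<^esub> k" and i = "\<lambda>k. inv\<^bsub>G\<^esub> h \<otimes>\<^bsub>G\<^esub> k"])
        (use gh in \<open>auto simp: G.m_assoc[symmetric]\<close>)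
    finally show ?thesis .
  qed
  obtain r where r: "r w ^ ?n = w" for w :: complex
    using complex_nth_root_exists[OF n] by metis
  \<comment> \<open>The root of \<open>P(1) = 1\<close> has to be \<open>1\<close> for the corrected cocycle to be normalised. The value \<open>1\<close>
    off the group keeps \<open>c\<close> nonzero everywhere.\<close>
  define c where "c g = (if g \<in> carrier G \<and> g \<noteq> \<one>\<^bsub>G\<^esub> then r (P g) else 1)" for g
  have c: "c g ^ ?n = P g" if "g \<in> carrier G" for g
    using that r P1 by (simp add: c_def)
  have c0: "c g \<noteq> 0" for g
    using c[of g] Pnz[of g] n by (cases "g \<in> carrier G") (auto simp: c_def zero_power split: if_splits)
  have "(\<nu> g h * c (g \<otimes>\<^bsub>G\<^esub> h) / (c g * c h)) ^ ?n = 1" if gh: "g \<in> carrier G" "h \<in> carrier G" for g h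
    using P[OF gh] Pnz gh by (simp add: power_mult_distrib power_divide c)
  then show ?thesis using that[of c] c0 by (simp add: c_def)
qed

text \<open>The powers of a primitive \<open>n\<close>th root of unity identify the integers modulo \<open>n\<close> with the group of
  \<open>n\<close>th roots of unity, and a cocycle with values in the latter is transported along this isomorphism.\<close>

lemma discrete_logarithm_cocycle:
  fixes G :: "('g, 'x) monoid_scheme" and \<tau> :: "'g \<Rightarrow> 'g \<Rightarrow> complex"
  assumes "group G" and n: "n > 0"
    and root: "\<And>g h. g \<in> carrier G \<Longrightarrow> h \<in> carrier G \<Longrightarrow> \<tau> g h ^ n = 1"
    and cocycle: "\<And>g h k. g \<in> carrier G \<Longrightarrow> h \<in> carrier G \<Longrightarrow> k \<in> carrier G \<Longrightarrow>
        \<tau> g h * \<tau> (g \<otimes>\<^bsub>G\<^esub> h) k = \<tau> g (h \<otimes>\<^bsub>G\<^esub> k) * \<tau> h k"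
    and one: "\<And>g. g \<in> carrier G \<Longrightarrow> \<tau> \<one>\<^bsub>G\<^esub> g = 1 \<and> \<tau> g \<one>\<^bsub>G\<^esub> = 1"
  obtains q \<mu> where "q ^ n = 1" "\<mu> \<in> normalised_cocycles G (integer_mod_group n)"
    and "\<And>g h. g \<in> carrier G \<Longrightarrow> h \<in> carrier G \<Longrightarrow> \<tau> g h = q ^ nat (\<mu> g h)"
proof -
  interpret G: group G by fact
  define q where "q = cis (2 * pi / n)"
  have qk: "q ^ k = cis (2 * pi * k / n)" for k by (simp add: q_def DeMoivre mult.commute)
  have bij: "bij_betw (\<lambda>k. q ^ k) {..<n} {w. w ^ n = 1}"
    using bij_betw_roots_unity[OF n] by (simp add: qk)
  have qn: "q ^ n = 1" using n by (simp add: qk)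
  have red: "q ^ (k mod n) = q ^ k" for k
  proof -
    have "q ^ k = q ^ (n * (k div n) + k mod n)" by simp
    also have "\<dots> = q ^ (k mod n)" by (simp only: power_add power_mult qn power_one mult_1)
    finally show ?thesis ..
  qed
  define l where "l = inv_into {..<n} (\<lambda>k. q ^ k)"
  have l: "l w < n" "q ^ l w = w" if "w ^ n = 1" for w
    using bij that inv_into_into[of w "\<lambda>k. q ^ k" "{..<n}"] f_inv_into_f[of w "\<lambda>k. q ^ k" "{..<n}"]
    by (auto simp: l_def bij_betw_def)
  have inj: "i = j" if "q ^ i = q ^ j" "i < n" "j < n" for i j
    using bij that by (auto simp: bij_betw_def inj_on_def)
  define \<mu> where "\<mu> g h = int (l (\<tau> g h))" for g h
  have q\<mu>: "\<tau> g h = q ^ l (\<tau> g h)" "l (\<tau> g h) < n" if "g \<in> carrier G" "h \<in> carrier G" for g h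
    using l[OF root[OF that]] by auto
  have l1: "l 1 = 0" using l[of 1] inj[of "l 1" 0] n by simp
  have "\<mu> \<in> normalised_cocycles G (integer_mod_group n)"
    unfolding normalised_cocycles_def
  proof (intro CollectI conjI ballI Pi_I)
    fix g h k assume g: "g \<in> carrier G" and h: "h \<in> carrier G" and k: "k \<in> carrier G"
    have "q ^ ((l (\<tau> g h) + l (\<tau> (g \<otimes>\<^bsub>G\<^esub> h) k)) mod n) = q ^ ((l (\<tau> g (h \<otimes>\<^bsub>G\<^esub> k)) + l (\<tau> h k)) mod n)"
      using cocycle[OF g h k] q\<mu>(1) g h k by (simp add: red power_add)
    then have "(l (\<tau> g h) + l (\<tau> (g \<otimes>\<^bsub>G\<^esub> h) k)) mod n = (l (\<tau> g (h \<otimes>\<^bsub>G\<^esub> k)) + l (\<tau> h k)) mod n"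
      using n by (intro inj) auto
    then show "\<mu> g h \<otimes>\<^bsub>integer_mod_group n\<^esub> \<mu> (g \<otimes>\<^bsub>G\<^esub> h) k = \<mu> g (h \<otimes>\<^bsub>G\<^esub> k) \<otimes>\<^bsub>integer_mod_group n\<^esub> \<mu> h k"
      by (simp add: \<mu>_def flip: of_nat_add of_nat_mod)
  qed (use n q\<mu>(2) one l1 in \<open>auto simp: \<mu>_def carrier_integer_mod_group\<close>)
  then show ?thesis using that[of q \<mu>] qn q\<mu>(1) by (simp add: \<mu>_def)
qed

theorem corollary3p9:
  fixes G :: "('g, 'x) monoid_scheme"
    and A :: "(complex, 'a, 'y) module_scheme"
    and \<A> :: "'g \<Rightarrow> 'a set"
    and \<nu> :: "'g \<Rightarrow> 'g \<Rightarrow> complex"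
  assumes "group G" and "finite (carrier G)"
    and "graded_algebra G complex_ring A \<A>"
    and "\<nu> \<in> normalised_cocycles G (units_of complex_ring)"
  shows "\<exists>(m::nat) \<mu> q. m > 0 \<and>
    \<mu> \<in> normalised_cocycles G (integer_mod_group m) \<and>
    q ^ m = 1 \<and>
    algebra_isomorphic complex_ring
      (twist G A \<A> \<nu>)
      (specialisation complex_ring (integer_mod_group m)
        (cocycle_extension G complex_ring (integer_mod_group m) A \<A> \<mu>) (1 mod int m) q)"
proof -
  interpret graded_algebra G complex_ring A \<A> by fact
  let ?n = "card (carrier G)"
  have n: "?n > 0" using assms(2) G.one_closed by (auto simp: card_gt_0_iff)
  obtain c where c0: "\<And>g. c g \<noteq> 0" and c1: "c \<one>\<^bsub>G\<^esub> = 1"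
    and root: "\<And>g h. g \<in> carrier G \<Longrightarrow> h \<in> carrier G \<Longrightarrow>
      (\<nu> g h * c (g \<otimes>\<^bsub>G\<^esub> h) / (c g * c h)) ^ ?n = 1"
    using cocycle_cohomologous_roots_of_unity[OF assms(1,2,4)] by metis
  define \<tau> where "\<tau> g h = \<nu> g h * c (g \<otimes>\<^bsub>G\<^esub> h) / (c g * c h)" for g h
  have cocycle: "\<nu> g h * \<nu> (g \<otimes>\<^bsub>G\<^esub> h) k = \<nu> g (h \<otimes>\<^bsub>G\<^esub> k) * \<nu> h k"
    if "g \<in> carrier G" "h \<in> carrier G" "k \<in> carrier G" for g h k
    using assms(4) that by (simp add: normalised_cocycles_def units_of_def)
  obtain q \<mu> where q: "q ^ ?n = 1" and \<mu>: "\<mu> \<in> normalised_cocycles G (integer_mod_group ?n)"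
    and \<tau>: "\<And>g h. g \<in> carrier G \<Longrightarrow> h \<in> carrier G \<Longrightarrow> \<tau> g h = q ^ nat (\<mu> g h)"
  proof (rule discrete_logarithm_cocycle[OF assms(1) n, of \<tau>])
    fix g h k assume ghk: "g \<in> carrier G" "h \<in> carrier G" "k \<in> carrier G"
    show "\<tau> g h * \<tau> (g \<otimes>\<^bsub>G\<^esub> h) k = \<tau> g (h \<otimes>\<^bsub>G\<^esub> k) * \<tau> h k"
      using cocycle[OF ghk] ghk c0 by (simp add: \<tau>_def G.m_assoc field_simps)
  next
    show "\<tau> \<one>\<^bsub>G\<^esub> g = 1 \<and> \<tau> g \<one>\<^bsub>G\<^esub> = 1" if "g \<in> carrier G" for g
      using assms(4) that c0 c1 by (simp add: \<tau>_def normalised_cocycles_def units_of_def)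
  qed (use root in \<open>auto simp: \<tau>_def\<close>)
  have "rescale c \<in> algebra_iso complex_ring (twist G A \<A> \<nu>) (twist G A \<A> (\<lambda>g h. q ^ nat (\<mu> g h)))"
    by (rule twist_cohomologous[where d = "\<lambda>g. 1 / c g"])
      (use c0 c1 in \<open>auto simp: \<tau>[symmetric] \<tau>_def\<close>)
  then have "algebra_isomorphic complex_ring (twist G A \<A> \<nu>) (twist G A \<A> (\<lambda>g h. q ^ nat (\<mu> g h)))"
    by (auto simp: algebra_isomorphic_def)
  moreover have "algebra_isomorphic complex_ring (twist G A \<A> (\<lambda>g h. q ^ nat (\<mu> g h)))
      (specialisation complex_ring (integer_mod_group ?n)
        (cocycle_extension G complex_ring (integer_mod_group ?n) A \<A> \<mu>) (1 mod int ?n) q)"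
    using specialisation_cocycle_extension[OF n, of q \<mu>] q \<mu> by (auto simp: normalised_cocycles_def)
  ultimately show ?thesis using n q \<mu> algebra_isomorphic_trans by blast
qed

end
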